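(* Let $V$ be a grading-restricted vertex superalgebra, $g$ an automorphism of $V$, and $\{\phi^i(x)\}_{i\in I}$ generating fields satisfying the generation assumption in the context. Let $W$ be a $\mathbb C\times\mathbb Z_2\times\mathbb C/\mathbb Z$-graded vector space with operators $L_W(0),L_W(-1),g,\mathcal L_g,\mathcal S_g,\mathcal N_g$, and let $\phi_W^i:W\to x^{-\alpha^i}W((x))[\log x]$, $i\in I$, be generating twisted field maps, as in the context, satisfying the $L(0)$-, $L(-1)$- and $g$-properties listed there. Then the following are equivalent. (A) (Weak commutativity) For $i,j\in I$ there exists $M_{ij}\in\mathbb Z_+$ such that $(x_1-x_2)^{M_{ij}}\phi_W^i(x_1)\phi_W^j(x_2)=(x_1-x_2)^{M_{ij}}(-1)^{|\phi^i||\phi^j|}\phi_W^j(x_2)\phi_W^i(x_1)$. (B) The following two properties hold. (B1) For $w'\in W'$, $w\in W$, $i_1,\dots,i_k\in I$ and $p\in\mathbb Z$, the series $\langle w',\phi_W^{i_1;p}(z_1)\cdots\phi_W^{i_k;p}(z_k)w\rangle$ is absolutely convergent in the region $|z_1|>\cdots>|z_k|>0$. Moreover, there exists a multivalued analytic function of the form $$\sum_{n_1,\dots,n_k=0}^Nf_{n_1\cdots n_k}(z_1,\dots,z_k)z_1^{-\alpha^{i_1}}\cdots z_k^{-\alpha^{i_k}}(\log z_1)^{n_1}\cdots(\log z_k)^{n_k},$$ denoted $F(\langle w',\phi_W^{i_1}(z_1)\cdots\phi_W^{i_k}(z_k)w\rangle)$, where $N\in\mathbb N$ and the $f_{n_1\cdots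 n_k}$ are rational functions with the only possible poles $z_i=0$ ($1\le i\le k$) and $z_i-z_j=0$ ($i\neq j$), such that the sum of the series is equal in the region $|z_1|>\cdots>|z_k|>0$ to the branch $$F^p(\langle w',\phi_W^{i_1}(z_1)\cdots\phi_W^{i_k}(z_k)w\rangle)=\sum_{n_1,\dots,n_k=0}^Nf_{n_1\cdots n_k}(z_1,\dots,z_k)e^{-\alpha^{i_1}l_p(z_1)}\cdots e^{-\alpha^{i_k}l_p(z_k)}l_p(z_1)^{n_1}\cdots l_p(z_k)^{n_k}.$$ In addition, the orders of the poles $z_i=0$ of the $f_{n_1\cdots n_k}$ are bounded by a number independent of $\phi^{i_l}$ for $l\neq i$ and of $w'$, and the orders of the poles $z_i=z_j$ of the $f_{n_1\cdots n_k}$ are bounded by a number independent of $\phi^{i_l}$ for $l\ne i,j$, of $w$ and of $w'$. (B2) For $w\in W$, $w'\in W'$, $i_1,i_2\in I$ and $p\in\mathbb Z$, $$F^p(\langle w',\phi_W^{i_1}(z_1)\phi_W^{i_2}(z_2)w\rangle)=(-1)^{|\phi^{i_1}||\phi^{i_2}|}F^p(\langle w',\phi_W^{i_2}(z_2)\phi_W^{i_1}(z_1)w\rangle).$$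
   Context: **Conventions.** $\mathbb N=\{0,1,2,\dots\}$. For $z\in\mathbb C^\times$, $\arg z\in[0,2\pi)$ and $l_p(z)=\log|z|+i\arg z+2\pi i p$, $p\in\mathbb Z$. For $W=\coprod_nW_{[n]}$, $W'=\coprod_nW_{[n]}^*$. The $p$-th branch $\phi^p(z)$ of a series $\phi(x)$ in complex powers of $x$ and nonnegative integral powers of $\log x$ is obtained by substituting $x^n\mapsto e^{nl_p(z)}$, $\log x\mapsto l_p(z)$; $\phi_W^{i;p}(z)$ is the $p$-th branch of $\phi_W^i(x)$. $y^{\pm\mathcal N}=e^{\pm(\log y)\mathcal N}$. **Vertex superalgebras.** A grading-restricted vertex superalgebra is a $\frac12\mathbb Z\times\mathbb Z_2$-graded space $V=\coprod_{n,s}V_{(n)}^s$ ($|v|=s$ is the $\mathbb Z_2$-fermion number) with a map $Y_V:V\otimes V\to V((x))$, compatible with the $\mathbb Z_2$-grading, and a vacuum $\mathbf 1\in V_{(0)}^0$ such that: $\dim V_{(n)}<\infty$ and $V_{(n)}=0$ for $n$ sufficiently negative; $Y_V(\mathbf 1,x)=1_V$, $Y_V(u,x)\mathbf 1\in V[[x]]$ with constant term $u$; with $L_V(0)v=nv$ for $v\in V_{(n)}$, $[L_V(0),Y_V(v,x)]=x\frac{d}{dx}Y_V(v,x)+Y_V(L_V(0)v,x)$; with $L_V(-1)v=\mathrm{Res}_xx^{-2}Y_V(v,x)\mathbf 1$, $\frac{d}{dx}Y_V(v,x)=Y_V(L_V(-1)v,x)=[L_V(-1),Y_V(v,x)]$;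 and for $u_1,u_2,v\in V$, $v'\in V'$, the series $\langle v',Y_V(u_1,z_1)Y_V(u_2,z_2)v\rangle$, $(-1)^{|u_1||u_2|}\langle v',Y_V(u_2,z_2)Y_V(u_1,z_1)v\rangle$, $\langle v',Y_V(Y_V(u_1,z_1-z_2)u_2,z_2)v\rangle$ converge absolutely in $|z_1|>|z_2|>0$, $|z_2|>|z_1|>0$, $|z_2|>|z_1-z_2|>0$, respectively, to a common rational function with only possible poles $z_1=0$, $z_2=0$, $z_1=z_2$. An automorphism $g$ is a grading-preserving linear automorphism with $g\mathbf 1=\mathbf 1$, $gY_V(u,x)v=Y_V(gu,x)gv$. Then $V=\coprod_{\alpha\in P_V}V^{[\alpha]}$, $V^{[\alpha]}$ the generalized eigenspace of $g$ with eigenvalue $e^{2\pi i\alpha}$, $P_V=\{\alpha:\Re\alpha\in[0,1),\ e^{2\pi i\alpha}\text{ an eigenvalue of }g\}$; $g=e^{2\pi i\mathcal L_g}$, $\mathcal L_g=\mathcal S_g+\mathcal N_g$, $\mathcal S_g=\alpha$ on $V^{[\alpha]}$, $\mathcal N_g$ (locally) nilpotent commuting with $\mathcal S_g$. **Generation assumption.** $V$ is generated by fields $\phi^i(x)=Y_V(\phi^i_{-1}\mathbf 1,x)$, $i\in I$, with $\phi^i_{-1}\mathbf 1$ homogeneous of weight $\mathrm{wt}\,\phi^i$ and fermion number $|\phi^i|$, a generalized eigenvector of $g$ with eigenvalue $e^{2\pi i\alpha^i}$, $\alpha^i\in P_V$. For each $i\in I$ either $\mathcal N_g\phi^i_{-1}\mathbf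 1=0$ or $\mathcal N_g\phi^i_{-1}\mathbf 1=\phi^{\mathcal N_g(i)}_{-1}\mathbf 1$ for some $\mathcal N_g(i)\in I$; in the former case $\phi_W^{\mathcal N_g(i)}$ denotes $0$. **Data and properties.** $W=\coprod_{n\in\mathbb C,s\in\mathbb Z_2,\alpha\in P_W}W_{[n]}^{s;[\alpha]}$ is graded by weight, fermion number and $g$-weight ($P_W\subset\{\Re\alpha\in[0,1)\}$), with $W_{[n]}=0$ when $\Re n$ is sufficiently negative; $L_W(0),L_W(-1)$ are operators on $W$; $g$ acts on $W$, $g=e^{2\pi i\mathcal L_g}$ with $\mathcal L_g=\mathcal S_g+\mathcal N_g$ (semisimple and nilpotent parts). The weight and $g$-weight gradings are by generalized eigenspaces of $L_W(0)$ (eigenvalue $n$) and $g$ (eigenvalue $e^{2\pi i\alpha}$). The maps are $\phi_W^i(x)w=\sum_{k\in\mathbb N}\sum_{n\in\alpha^i+\mathbb Z}(\phi_W^i)_{n,k}w\,x^{-n-1}(\log x)^k\in x^{-\alpha^i}W((x))[\log x]$, of parity $|\phi^i|$. Properties: - $L(0)$: $L_W(0)=L_W(0)_S+L_W(0)_N$ (semisimple and nilpotent parts), $[L_W(0),\phi_W^i(x)]=x\frac{d}{dx}\phi_W^i(x)+(\mathrm{wt}\,\phi^i)\phi_W^i(x)$. - $L(-1)$: $[L_W(-1),\phi_W^i(x)]=\frac{d}{dx}\phi_W^i(x)$. - $g$: $g\phi_W^{i;p+1}(z)g^{-1}=\phi_W^{i;p}(z)$; $\phi_W^i(x)=x^{-\mathcal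 N_g}(\phi_W^i)_0(x)x^{\mathcal N_g}$ where $(\phi_W^i)_0(x)$ is the constant term of $\phi_W^i(x)$ as a power series in $\log x$; $e^{2\pi i\mathcal S_g}\phi_W^i(x)e^{-2\pi i\mathcal S_g}=e^{2\pi i\alpha^i}\phi_W^i(x)$; $[\mathcal N_g,\phi_W^i(x)]=\phi_W^{\mathcal N_g(i)}(x)$. *)

theory Defs
  imports "HOL-Analysis.Analysis" "HOL-Library.Z2"
begin

text \<open>A complex vector space is a type with a scalar multiplication \<open>s\<close> such that
  \<^term>\<open>vector_space s\<close>; the grading group \<open>Z_2\<close> is the type \<^typ>\<open>bit\<close>.\<close>

definition internal_direct_sum ::
  "(complex \<Rightarrow> 'v::ab_group_add \<Rightarrow> 'v) \<Rightarrow> ('j \<Rightarrow> 'v set) \<Rightarrow> bool" where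
  "internal_direct_sum s A \<longleftrightarrow>
     (\<forall>j. module.subspace s (A j)) \<and>
     (\<forall>v. \<exists>!c. (\<forall>j. c j \<in> A j) \<and> finite {j. c j \<noteq> 0} \<and> (\<Sum>j | c j \<noteq> 0. c j) = v)"

definition gen_eigenspace ::
  "(complex \<Rightarrow> 'v::ab_group_add \<Rightarrow> 'v) \<Rightarrow> ('v \<Rightarrow> 'v) \<Rightarrow> complex \<Rightarrow> 'v set" where
  "gen_eigenspace s T c = {v. \<exists>m. ((\<lambda>u. T u - s c u) ^^ m) v = 0}"

definition locally_nilpotent :: "('v::zero \<Rightarrow> 'v) \<Rightarrow> bool" where
  "locally_nilpotent N \<longleftrightarrow> (\<forall>v. \<exists>m. (N ^^ m) v = 0)"

definition semisimple_nilpotent_parts ::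
  "(complex \<Rightarrow> 'v::ab_group_add \<Rightarrow> 'v) \<Rightarrow> ('v \<Rightarrow> 'v) \<Rightarrow> ('v \<Rightarrow> 'v) \<Rightarrow> ('v \<Rightarrow> 'v) \<Rightarrow> bool" where
  "semisimple_nilpotent_parts s T S N \<longleftrightarrow>
     Vector_Spaces.linear s s T \<and> Vector_Spaces.linear s s S \<and> Vector_Spaces.linear s s N \<and>
     (\<forall>v. T v = S v + N v) \<and>
     module.span s {v. \<exists>c. S v = s c v} = UNIV \<and>
     locally_nilpotent N \<and>
     (\<forall>v. S (N v) = N (S v))"

text \<open>\<open>op_exp s c T\<close> is the exponential of \<open>c T\<close>.  For a locally finite \<open>T\<close> the vectors
  \<open>T^k v\<close> span a finite-dimensional space, in which the exponential series converges; this is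
  tested against all linear functionals, which separate points.\<close>

definition op_exp ::
  "(complex \<Rightarrow> 'v::ab_group_add \<Rightarrow> 'v) \<Rightarrow> complex \<Rightarrow> ('v \<Rightarrow> 'v) \<Rightarrow> 'v \<Rightarrow> 'v" where
  "op_exp s c T v = (THE u. \<forall>f. Vector_Spaces.linear s (*) f \<longrightarrow>
     (\<lambda>k. c ^ k / fact k * f ((T ^^ k) v)) sums f u)"

text \<open>The restricted dual, the direct sum of the duals of the \<open>G n\<close>; functionals on \<open>G n\<close> are
  extended by zero to the other homogeneous subspaces.\<close>

definition graded_dual ::
  "(complex \<Rightarrow> 'v::ab_group_add \<Rightarrow> 'v) \<Rightarrow> ('n \<Rightarrow> 'v set) \<Rightarrow> ('v \<Rightarrow> complex) set" where
  "graded_dual s G = {f. Vector_Spaces.linear s (*) f \<and> finite {n. \<exists>v\<in>G n. f v \<noteq> 0}}"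

text \<open>\<open>koszul s t\<close> is \<open>(-1)^(s t)\<close>.\<close>

definition koszul :: "bit \<Rightarrow> bit \<Rightarrow> complex" where
  "koszul s t = (if s = 1 \<and> t = 1 then -1 else 1)"

definition lp :: "int \<Rightarrow> complex \<Rightarrow> complex" where
  "lp p z = of_real (ln (cmod z)) + \<i> * of_real (Arg2pi z) + 2 * of_real pi * \<i> * of_int p"

text \<open>The \<open>p\<close>-th branch of \<open>x^r (log x)^k\<close>.\<close>

definition branch_monom :: "int \<Rightarrow> complex \<Rightarrow> nat \<Rightarrow> complex \<Rightarrow> complex" where
  "branch_monom p r k z = exp (r * lp p z) * lp p z ^ k"

text \<open>Points of \<open>C^k\<close> are lists of length \<open>k\<close>; positions are counted from 0.\<close>

definition polynomial_fun :: "nat \<Rightarrow> (complex list \<Rightarrow> complex) \<Rightarrow> bool" where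
  "polynomial_fun k P \<longleftrightarrow>
     (\<exists>E c. finite E \<and> (\<forall>e\<in>E. length e = k) \<and>
        (\<forall>zs. length zs = k \<longrightarrow> P zs = (\<Sum>e\<in>E. c e * (\<Prod>j<k. (zs ! j) ^ (e ! j :: nat)))))"

definition off_poles :: "complex list \<Rightarrow> bool" where
  "off_poles zs \<longleftrightarrow> 0 \<notin> set zs \<and> distinct zs"

text \<open>Rational functions of \<open>k\<close> variables whose only possible poles are \<open>z_j = 0\<close>, of order at
  most \<open>a j\<close>, and \<open>z_i = z_j\<close>, of order at most \<open>b i j\<close> (\<open>i < j\<close>).\<close>

definition rational_fun ::
  "nat \<Rightarrow> (nat \<Rightarrow> nat) \<Rightarrow> (nat \<Rightarrow> nat \<Rightarrow> nat) \<Rightarrow> (complex list \<Rightarrow> complex) \<Rightarrow> bool" where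
  "rational_fun k a b f \<longleftrightarrow>
     (\<exists>P. polynomial_fun k P \<and>
        (\<forall>zs. length zs = k \<and> off_poles zs \<longrightarrow>
           f zs = P zs / ((\<Prod>j<k. (zs ! j) ^ a j) *
                          (\<Prod>j<k. \<Prod>i<j. (zs ! i - zs ! j) ^ b i j))))"

definition radially_ordered :: "complex list \<Rightarrow> bool" where
  "radially_ordered zs \<longleftrightarrow> 0 \<notin> set zs \<and> sorted_wrt (\<lambda>z z'. cmod z > cmod z') zs"

definition converges_absolutely_to ::
  "('a \<Rightarrow> complex) \<Rightarrow> 'a set \<Rightarrow> complex \<Rightarrow> bool" where
  "converges_absolutely_to t A S \<longleftrightarrow> (\<lambda>x. norm (t x)) summable_on A \<and> (t has_sum S) A"

text \<open>\<open>Y u n v\<close> is \<open>u_n v\<close>, the coefficient of \<open>x^(-n-1)\<close> in \<open>Y_V(u,x)v\<close>; \<open>Vgr n s\<close> is the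
  subspace of weight \<open>n\<close> and fermion number \<open>s\<close>.\<close>

locale gr_vertex_superalgebra = vector_space sV
  for sV :: "complex \<Rightarrow> 'v::ab_group_add \<Rightarrow> 'v" +
  fixes Vgr :: "real \<Rightarrow> bit \<Rightarrow> 'v set"
    and Y :: "'v \<Rightarrow> int \<Rightarrow> 'v \<Rightarrow> 'v"
    and vac :: 'v
    and L0V Lm1V :: "'v \<Rightarrow> 'v"
  assumes grading: "internal_direct_sum sV (\<lambda>(n, s). Vgr n s)"
    and half_integral: "2 * n \<notin> \<int> \<Longrightarrow> Vgr n s = {0}"
    and finite_dim: "\<exists>B. finite B \<and> span (\<Union>s. Vgr n s) = span B"
    and lower_bounded: "\<exists>b. \<forall>n<b. \<forall>s. Vgr n s = {0}"
    and Y_linear_left: "Vector_Spaces.linear sV sV (\<lambda>u. Y u m v)"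
    and Y_linear_right: "Vector_Spaces.linear sV sV (Y u m)"
    and Y_truncation: "\<exists>m0. \<forall>m\<ge>m0. Y u m v = 0"
    and Y_fermion: "\<lbrakk>u \<in> span (\<Union>n. Vgr n s); v \<in> span (\<Union>n. Vgr n t)\<rbrakk>
                      \<Longrightarrow> Y u m v \<in> span (\<Union>n. Vgr n (s + t))"
    and vac_grading: "vac \<in> Vgr 0 0"
    and identity: "Y vac m v = (if m = -1 then v else 0)"
    and creation: "m \<ge> 0 \<Longrightarrow> Y u m vac = 0" "Y u (-1) vac = u"
    and L0V_linear: "Vector_Spaces.linear sV sV L0V"
    and L0V_weight: "v \<in> Vgr n s \<Longrightarrow> L0V v = sV (of_real n) v"
    and L0V_commutator:
      "L0V (Y u m v) - Y u m (L0V v) = sV (of_int (-m - 1)) (Y u m v) + Y (L0V u) m v"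
    and Lm1V_def: "Lm1V v = Y v (-2) vac"
    and Lm1V_derivative: "Y (Lm1V u) m v = sV (of_int (-m)) (Y u (m - 1) v)"
    and Lm1V_commutator: "Lm1V (Y u m v) - Y u m (Lm1V v) = sV (of_int (-m)) (Y u (m - 1) v)"
    and duality:
      "\<lbrakk>u1 \<in> span (\<Union>n. Vgr n s1); u2 \<in> span (\<Union>n. Vgr n s2);
        v' \<in> graded_dual sV (\<lambda>n. span (\<Union>s. Vgr n s))\<rbrakk> \<Longrightarrow>
       \<exists>a b f. rational_fun 2 a b f \<and>
         (\<forall>z1 z2.
            (cmod z1 > cmod z2 \<and> cmod z2 > 0 \<longrightarrow>
               converges_absolutely_to
                 (\<lambda>(m, n). v' (Y u1 m (Y u2 n v)) * z1 powi (-m - 1) * z2 powi (-n - 1))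
                 UNIV (f [z1, z2])) \<and>
            (cmod z2 > cmod z1 \<and> cmod z1 > 0 \<longrightarrow>
               converges_absolutely_to
                 (\<lambda>(m, n). koszul s1 s2 *
                    (v' (Y u2 n (Y u1 m v)) * z1 powi (-m - 1) * z2 powi (-n - 1)))
                 UNIV (f [z1, z2])) \<and>
            (cmod z2 > cmod (z1 - z2) \<and> cmod (z1 - z2) > 0 \<longrightarrow>
               converges_absolutely_to
                 (\<lambda>(m, n). v' (Y (Y u1 m u2) n v) * (z1 - z2) powi (-m - 1) * z2 powi (-n - 1))
                 UNIV (f [z1, z2])))"

text \<open>An automorphism \<open>g\<close> with \<open>LgV = SgV + NgV\<close> the operators \<open>L_g = S_g + N_g\<close> on \<open>V\<close>, and
  generating fields \<open>Y_V(a i, x)\<close> for \<open>i \<in> I\<close> (so \<open>a i\<close> is the vector written \<open>phi^i_{-1} 1\<close>), of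
  weight \<open>wt i\<close>, fermion number \<open>par i\<close> and eigenvalue exponent \<open>al i\<close>.  The map \<open>i \<mapsto> N_g(i)\<close> is
  \<open>Ng\<close>; it is \<open>None\<close> when \<open>N_g\<close> annihilates \<open>a i\<close>.\<close>

locale generated_vertex_superalgebra = gr_vertex_superalgebra sV Vgr Y vac L0V Lm1V
  for sV :: "complex \<Rightarrow> 'v::ab_group_add \<Rightarrow> 'v"
    and Vgr Y vac L0V Lm1V +
  fixes g LgV SgV NgV :: "'v \<Rightarrow> 'v"
    and I :: "'i set"
    and a :: "'i \<Rightarrow> 'v"
    and wt :: "'i \<Rightarrow> real"
    and par :: "'i \<Rightarrow> bit"
    and al :: "'i \<Rightarrow> complex"
    and Ng :: "'i \<Rightarrow> 'i option"
  assumes g_linear: "Vector_Spaces.linear sV sV g"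
    and g_bij: "bij g"
    and g_grading: "g ` Vgr n s = Vgr n s"
    and g_vac: "g vac = vac"
    and g_Y: "g (Y u m v) = Y (g u) m (g v)"
    and g_exp: "g = op_exp sV (2 * of_real pi * \<i>) LgV"
    and LgV_parts: "semisimple_nilpotent_parts sV LgV SgV NgV"
    and SgV_eigen: "\<lbrakk>0 \<le> Re c; Re c < 1; v \<in> gen_eigenspace sV g (exp (2 * of_real pi * \<i> * c))\<rbrakk>
                      \<Longrightarrow> SgV v = sV c v"
    and generated:
      "span {foldr (\<lambda>(i, m) u. Y (a i) m u) xs vac | xs. fst ` set xs \<subseteq> I} = UNIV"
    and generator_homogeneous: "i \<in> I \<Longrightarrow> a i \<in> Vgr (wt i) (par i)"
    and generator_weight: "i \<in> I \<Longrightarrow> 2 * wt i \<in> \<int>"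
    and al_range: "i \<in> I \<Longrightarrow> 0 \<le> Re (al i) \<and> Re (al i) < 1"
    and al_eigenvalue: "i \<in> I \<Longrightarrow> \<exists>v. v \<noteq> 0 \<and> g v = sV (exp (2 * of_real pi * \<i> * al i)) v"
    and generator_eigen:
      "i \<in> I \<Longrightarrow> a i \<noteq> 0 \<and> a i \<in> gen_eigenspace sV g (exp (2 * of_real pi * \<i> * al i))"
    and Ng_None: "\<lbrakk>i \<in> I; Ng i = None\<rbrakk> \<Longrightarrow> NgV (a i) = 0"
    and Ng_Some: "\<lbrakk>i \<in> I; Ng i = Some j\<rbrakk> \<Longrightarrow> j \<in> I \<and> NgV (a i) \<noteq> 0 \<and> NgV (a i) = a j"

text \<open>An operator-valued series \<open>A\<close> is given by its coefficients: \<open>A r k\<close> is the coefficient of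
  \<open>x^r (log x)^k\<close>.\<close>

type_synonym 'w series = "complex \<Rightarrow> nat \<Rightarrow> 'w \<Rightarrow> 'w"

definition series_deriv ::
  "(complex \<Rightarrow> 'w::ab_group_add \<Rightarrow> 'w) \<Rightarrow> 'w series \<Rightarrow> 'w series" where
  "series_deriv s A r k w = s (r + 1) (A (r + 1) k w) + s (of_nat (k + 1)) (A (r + 1) (k + 1) w)"

definition times_x :: "'w series \<Rightarrow> 'w series" where
  "times_x A r k w = A (r - 1) k w"

text \<open>The component of \<open>A^p(z) w\<close> at the power \<open>z^r\<close>; only finitely many powers of
  \<open>log\<close> occur in the series considered.  An identity between branches, whose values lie in the
  completion of \<open>W\<close>, is stated below for each of these components.\<close>

definition branch_component ::
  "(complex \<Rightarrow> 'w::ab_group_add \<Rightarrow> 'w) \<Rightarrow> 'w series \<Rightarrow> int \<Rightarrow> complex \<Rightarrow> complex \<Rightarrow> 'w \<Rightarrow> 'w" where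
  "branch_component s A p z r w =
     (\<Sum>k | A r k w \<noteq> 0. s (branch_monom p r k z) (A r k w))"

text \<open>A series in \<open>x_1\<close> and \<open>x_2\<close> has coefficients \<open>A r k s l\<close> of
  \<open>x_1^r (log x_1)^k x_2^s (log x_2)^l\<close>; this is its product with \<open>x_1 - x_2\<close>.\<close>

definition times_x1_minus_x2 ::
  "(complex \<Rightarrow> nat \<Rightarrow> complex \<Rightarrow> nat \<Rightarrow> 'w::ab_group_add) \<Rightarrow>
   (complex \<Rightarrow> nat \<Rightarrow> complex \<Rightarrow> nat \<Rightarrow> 'w)" where
  "times_x1_minus_x2 A = (\<lambda>r k s l. A (r - 1) k s l - A r k (s - 1) l)"

text \<open>\<open>Wgr n s c\<close> is the subspace of weight \<open>n\<close>, fermion number \<open>s\<close> and \<open>g\<close>-weight \<open>c\<close>.\<close>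

definition W_wt ::
  "(complex \<Rightarrow> 'w::ab_group_add \<Rightarrow> 'w) \<Rightarrow> (complex \<Rightarrow> bit \<Rightarrow> complex \<Rightarrow> 'w set) \<Rightarrow>
   complex \<Rightarrow> 'w set" where
  "W_wt s Wgr n = module.span s (\<Union>t c. Wgr n t c)"

definition W_fermion ::
  "(complex \<Rightarrow> 'w::ab_group_add \<Rightarrow> 'w) \<Rightarrow> (complex \<Rightarrow> bit \<Rightarrow> complex \<Rightarrow> 'w set) \<Rightarrow>
   bit \<Rightarrow> 'w set" where
  "W_fermion s Wgr t = module.span s (\<Union>n c. Wgr n t c)"

definition W_gwt ::
  "(complex \<Rightarrow> 'w::ab_group_add \<Rightarrow> 'w) \<Rightarrow> (complex \<Rightarrow> bit \<Rightarrow> complex \<Rightarrow> 'w set) \<Rightarrow>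
   complex \<Rightarrow> 'w set" where
  "W_gwt s Wgr c = module.span s (\<Union>n t. Wgr n t c)"

text \<open>The set \<open>P_W\<close> is the set of the \<open>c\<close> with some \<open>Wgr n s c \<noteq> {0}\<close>.\<close>

locale twisted_graded_space = vector_space sW
  for sW :: "complex \<Rightarrow> 'w::ab_group_add \<Rightarrow> 'w" +
  fixes Wgr :: "complex \<Rightarrow> bit \<Rightarrow> complex \<Rightarrow> 'w set"
    and L0W L0S L0N Lm1W gW LgW SgW NgW :: "'w \<Rightarrow> 'w"
  assumes W_grading: "internal_direct_sum sW (\<lambda>(n, s, c). Wgr n s c)"
    and W_gwt_range: "\<not> (0 \<le> Re c \<and> Re c < 1) \<Longrightarrow> Wgr n s c = {0}"
    and W_lower_bounded: "\<exists>b. \<forall>n. Re n < b \<longrightarrow> W_wt sW Wgr n = {0}"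
    and W_wt_eigen: "W_wt sW Wgr n = gen_eigenspace sW L0W n"
    and L0W_parts: "semisimple_nilpotent_parts sW L0W L0S L0N"
    and Lm1W_linear: "Vector_Spaces.linear sW sW Lm1W"
    and gW_linear: "Vector_Spaces.linear sW sW gW"
    and gW_bij: "bij gW"
    and gW_exp: "gW = op_exp sW (2 * of_real pi * \<i>) LgW"
    and LgW_parts: "semisimple_nilpotent_parts sW LgW SgW NgW"
    and W_gwt_eigen: "\<lbrakk>0 \<le> Re c; Re c < 1\<rbrakk>
          \<Longrightarrow> W_gwt sW Wgr c = gen_eigenspace sW gW (exp (2 * of_real pi * \<i> * c))"
    and SgW_eigen: "w \<in> W_gwt sW Wgr c \<Longrightarrow> SgW w = sW c w"

text \<open>\<open>phi i r k\<close> is the coefficient of \<open>x^r (log x)^k\<close> in the twisted field of index \<open>i\<close>, that is,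
  the mode usually indexed by \<open>n = -r-1\<close> and \<open>k\<close>.\<close>

locale twisted_field_maps =
  twisted_graded_space sW Wgr L0W L0S L0N Lm1W gW LgW SgW NgW
  for sW :: "complex \<Rightarrow> 'w::ab_group_add \<Rightarrow> 'w"
    and Wgr L0W L0S L0N Lm1W gW LgW SgW NgW +
  fixes I :: "'i set"
    and wt :: "'i \<Rightarrow> real"
    and par :: "'i \<Rightarrow> bit"
    and al :: "'i \<Rightarrow> complex"
    and Ng :: "'i \<Rightarrow> 'i option"
    and phi :: "'i \<Rightarrow> 'w series"
  assumes phi_linear: "i \<in> I \<Longrightarrow> Vector_Spaces.linear sW sW (phi i r k)"
    and phi_powers: "\<lbrakk>i \<in> I; r + al i \<notin> \<int>\<rbrakk> \<Longrightarrow> phi i r k w = 0"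
    and phi_truncation: "i \<in> I \<Longrightarrow> \<exists>m0::int. \<forall>m<m0. \<forall>k. phi i (of_int m - al i) k w = 0"
    and phi_log_polynomial: "i \<in> I \<Longrightarrow> \<exists>K. \<forall>k\<ge>K. \<forall>r. phi i r k w = 0"
    and phi_parity: "\<lbrakk>i \<in> I; w \<in> W_fermion sW Wgr s\<rbrakk>
                       \<Longrightarrow> phi i r k w \<in> W_fermion sW Wgr (par i + s)"
    and L0_property: "i \<in> I \<Longrightarrow>
          L0W (phi i r k w) - phi i r k (L0W w) =
            times_x (series_deriv sW (phi i)) r k w + sW (of_real (wt i)) (phi i r k w)"
    and Lm1_property: "i \<in> I \<Longrightarrow>
          Lm1W (phi i r k w) - phi i r k (Lm1W w) = series_deriv sW (phi i) r k w"
    and g_equivariance: "\<lbrakk>i \<in> I; z \<noteq> 0\<rbrakk> \<Longrightarrow>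
          gW (branch_component sW (phi i) (p + 1) z r (inv gW w)) =
            branch_component sW (phi i) p z r w"
    \<comment> \<open>\<open>x^(-N_g) phi_0(x) x^(N_g)\<close>, with both exponentials expanded in powers of \<open>log x\<close>\<close>
    and log_structure: "i \<in> I \<Longrightarrow>
          phi i r k w =
            (\<Sum>m\<le>k. sW ((-1) ^ m / (fact m * fact (k - m)))
                      ((NgW ^^ m) (phi i r 0 ((NgW ^^ (k - m)) w))))"
    and Sg_property: "i \<in> I \<Longrightarrow>
          op_exp sW (2 * of_real pi * \<i>) SgW
            (phi i r k (op_exp sW (- 2 * of_real pi * \<i>) SgW w)) =
          sW (exp (2 * of_real pi * \<i> * al i)) (phi i r k w)"
    and Ng_property: "i \<in> I \<Longrightarrow>
          NgW (phi i r k w) - phi i r k (NgW w) =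
            (case Ng i of None \<Rightarrow> 0 | Some j \<Rightarrow> phi j r k w)"

text \<open>The term of the \<open>p\<close>-th branch of the series \<open>\<langle>w', phi^{i_1}(z_1) ... phi^{i_k}(z_k) w\<rangle>\<close> belonging
  to the exponents \<open>es\<close>, a list of pairs (power of \<open>z_j\<close>, power of \<open>log z_j\<close>).\<close>

definition product_term ::
  "('i \<Rightarrow> 'w series) \<Rightarrow> ('w \<Rightarrow> complex) \<Rightarrow> 'i list \<Rightarrow> 'w \<Rightarrow> int \<Rightarrow> complex list \<Rightarrow>
   (complex \<times> nat) list \<Rightarrow> complex" where
  "product_term phi w' is w p zs es =
     w' (foldr (\<lambda>(i, r, k) u. phi i r k u) (zip is es) w) *
     (\<Prod>j<length is. branch_monom p (fst (es ! j)) (snd (es ! j)) (zs ! j))"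

definition log_exponents :: "nat \<Rightarrow> nat \<Rightarrow> nat list set" where
  "log_exponents k N = {ns. length ns = k \<and> set ns \<subseteq> {..N}}"

text \<open>The \<open>p\<close>-th branch of the multivalued function
  \<open>sum_{ns} f_{ns}(z_1,...,z_k) prod_j z_j^(-al i_j) (log z_j)^(n_j)\<close>.\<close>

definition F_branch ::
  "('i \<Rightarrow> complex) \<Rightarrow> 'i list \<Rightarrow> nat \<Rightarrow> (nat list \<Rightarrow> complex list \<Rightarrow> complex) \<Rightarrow>
   int \<Rightarrow> complex list \<Rightarrow> complex" where
  "F_branch al is N f p zs =
     (\<Sum>ns\<in>log_exponents (length is) N.
        f ns zs * (\<Prod>j<length is. branch_monom p (- al (is ! j)) (ns ! j) (zs ! j)))"

text \<open>\<open>(N, f)\<close> presents the multivalued function \<open>F(\<langle>w', phi^{i_1}(z_1) ... phi^{i_k}(z_k) w\<rangle>)\<close>: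
  the \<open>f ns\<close> are rational with poles only at \<open>z_j = 0\<close> and \<open>z_i = z_j\<close>, and for every \<open>p\<close> the
  \<open>p\<close>-th branch is the sum of the series in the region \<open>|z_1| > ... > |z_k| > 0\<close>.  The
  multivalued function is determined by this.\<close>

definition correlation_function ::
  "('i \<Rightarrow> complex) \<Rightarrow> ('i \<Rightarrow> 'w series) \<Rightarrow> ('w \<Rightarrow> complex) \<Rightarrow> 'i list \<Rightarrow> 'w \<Rightarrow>
   nat \<Rightarrow> (nat list \<Rightarrow> complex list \<Rightarrow> complex) \<Rightarrow> bool" where
  "correlation_function al phi w' is w N f \<longleftrightarrow>
     (\<forall>ns\<in>log_exponents (length is) N. \<exists>a b. rational_fun (length is) a b (f ns)) \<and>
     (\<forall>p zs. length zs = length is \<and> radially_ordered zs \<longrightarrow>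
        (product_term phi w' is w p zs has_sum F_branch al is N f p zs)
          {es. length es = length is})"

definition weak_commutativity ::
  "(complex \<Rightarrow> 'w::ab_group_add \<Rightarrow> 'w) \<Rightarrow> 'i set \<Rightarrow> ('i \<Rightarrow> bit) \<Rightarrow> ('i \<Rightarrow> 'w series) \<Rightarrow> bool" where
  "weak_commutativity sW I par phi \<longleftrightarrow>
     (\<forall>i\<in>I. \<forall>j\<in>I. \<exists>M>0. \<forall>w.
        (times_x1_minus_x2 ^^ M) (\<lambda>r k s l. phi i r k (phi j s l w)) =
        (times_x1_minus_x2 ^^ M)
          (\<lambda>r k s l. sW (koszul (par i) (par j)) (phi j s l (phi i r k w))))"

text \<open>\<open>A (i_j) w\<close> bounds the order of the pole \<open>z_j = 0\<close> and \<open>B (i_l) (i_j)\<close> that of \<open>z_l = z_j\<close>.\<close>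

definition product_rationality ::
  "(complex \<Rightarrow> 'w::ab_group_add \<Rightarrow> 'w) \<Rightarrow> (complex \<Rightarrow> bit \<Rightarrow> complex \<Rightarrow> 'w set) \<Rightarrow>
   'i set \<Rightarrow> ('i \<Rightarrow> complex) \<Rightarrow> ('i \<Rightarrow> 'w series) \<Rightarrow> bool" where
  "product_rationality sW Wgr I al phi \<longleftrightarrow>
     (\<exists>(A :: 'i \<Rightarrow> 'w \<Rightarrow> nat) (B :: 'i \<Rightarrow> 'i \<Rightarrow> nat).
        \<forall>w'\<in>graded_dual sW (W_wt sW Wgr). \<forall>w is. set is \<subseteq> I \<longrightarrow>
          (\<forall>p zs. length zs = length is \<and> radially_ordered zs \<longrightarrow>
             (\<lambda>es. norm (product_term phi w' is w p zs es)) summable_on {es. length es = length is}) \<and>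
          (\<exists>N f. correlation_function al phi w' is w N f \<and>
             (\<forall>ns\<in>log_exponents (length is) N.
                rational_fun (length is) (\<lambda>j. A (is ! j) w) (\<lambda>l j. B (is ! l) (is ! j)) (f ns))))"

definition commutativity ::
  "(complex \<Rightarrow> 'w::ab_group_add \<Rightarrow> 'w) \<Rightarrow> (complex \<Rightarrow> bit \<Rightarrow> complex \<Rightarrow> 'w set) \<Rightarrow>
   'i set \<Rightarrow> ('i \<Rightarrow> bit) \<Rightarrow> ('i \<Rightarrow> complex) \<Rightarrow> ('i \<Rightarrow> 'w series) \<Rightarrow> bool" where
  "commutativity sW Wgr I par al phi \<longleftrightarrow>
     (\<forall>w'\<in>graded_dual sW (W_wt sW Wgr). \<forall>w. \<forall>i1\<in>I. \<forall>i2\<in>I. \<forall>N12 f12 N21 f21.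
        correlation_function al phi w' [i1, i2] w N12 f12 \<and>
        correlation_function al phi w' [i2, i1] w N21 f21 \<longrightarrow>
        (\<forall>p z1 z2. z1 \<noteq> 0 \<and> z2 \<noteq> 0 \<and> z1 \<noteq> z2 \<longrightarrow>
           F_branch al [i1, i2] N12 f12 p [z1, z2] =
           koszul (par i1) (par i2) * F_branch al [i2, i1] N21 f21 p [z2, z1]))"

end

theory Submission
  imports Defs
begin

text \<open>Weak commutativity lets every field in a product be moved next to \<open>w\<close>, so after multiplication with
  \<open>\<Prod> (x\<^sub>l - x\<^sub>j)\<^bsup>M\<^esup>\<close> the exponents of each variable are bounded below. Since the total degree takes finitely
  many values, the matrix elements become Laurent polynomials, and dividing by the factors
  \<open>z\<^sub>l - z\<^sub>j\<close> again is absolutely convergent by geometric series. Only finitely many powers of the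
  logarithms occur, because the operator \<open>N_g\<close> is nilpotent on the generators of \<open>V\<close>.

  For two fields, multiplying the correlation function by \<open>(z\<^sub>1 - z\<^sub>2)\<^sup>M\<close> clears the pole at \<open>z\<^sub>1 = z\<^sub>2\<close>.
  Powers of \<open>z\<close> and \<open>log z\<close> are linearly independent, already on the real axis near infinity, so
  the coefficients of both orders of the product can be read off from the multivalued function.
  Hence weak commutativity and commutativity of the correlation functions are the same statement about
  coefficients.\<close>

subsection \<open>Uniqueness of expansions in powers and logarithms\<close>

text \<open>On bilateral series the factor \<open>x_l - x_j\<close> has a kernel; only truncation in
  the order of action makes division by it unique, and the expansion in powers of
  \<open>z_j / z_l\<close> is then the one that belongs to |z_l| > |z_j|. The poles at
  \<open>z_j = 0\<close> come from truncation on \<open>w\<close>, those at coinciding points from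
  the exponents of weak commutativity; hence the two separate bounds. The bound for the powers of
  log x must be uniform in the vector, since inner fields feed infinitely many vectors to the outer
  ones. It comes from V: the derivative of \<open>x^(-N_g) phi_0(x) x^(N_g)\<close> by log x is
  minus the commutator with \<open>N_g\<close>, so each further power of log x passes from a
  generator to its image under \<open>N_g\<close>. For the converse, the points are
  \<open>z = exp x\<close> with real x, where branch 0 of the logarithm is x itself; x > y > 0 lies
  in the region of convergence and keeps both logarithms nonzero. One exponent must serve all
  \<open>w\<close> and \<open>w'\<close>, which is why the pole bound at \<open>z_1 = z_2\<close>
  has to be independent of them.\<close>

lemma has_sum_finite_sum:
  assumes "\<And>i. i \<in> A \<Longrightarrow> (f i has_sum s i) B"
  shows "((\<lambda>x. \<Sum>i\<in>A. f i x) has_sum (\<Sum>i\<in>A. s i :: 'a::topological_comm_monoid_add)) B"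
  using assms by (induction A rule: infinite_finite_induct) (auto intro!: has_sum_add)

text \<open>A polynomial with a nonzero coefficient in positive degree is large near infinity by
  \<open>polyfun_extremal\<close>, so only the constant term can survive, and it equals the
  limit.\<close>

lemma poly_tendsto_zero:
  fixes a :: "nat \<Rightarrow> complex"
  assumes lim: "((\<lambda>x::real. \<Sum>n\<le>N. a n * of_real x ^ n) \<longlongrightarrow> 0) at_top" and n: "n \<le> N"
  shows "a n = 0"
proof -
  have inf: "filterlim (\<lambda>x::real. complex_of_real x) at_infinity at_top"
    by (simp add: filterlim_at_infinity_conv_norm_at_top filterlim_abs_real)
  have ev: "\<forall>\<^sub>F x in at_top. norm (\<Sum>n\<le>N. a n * of_real x ^ n) < 1"
    using tendstoD[OF lim, of 1] by simp
  have no: "\<not> (\<exists>k. k \<noteq> 0 \<and> k \<le> N \<and> a k \<noteq> 0)"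
  proof
    assume "\<exists>k. k \<noteq> 0 \<and> k \<le> N \<and> a k \<noteq> 0"
    from polyfun_extremal[OF this, of 1]
    have "\<forall>\<^sub>F x in at_top. norm (\<Sum>n\<le>N. a n * complex_of_real x ^ n) \<ge> 1"
      by (rule eventually_compose_filterlim[OF _ inf])
    with ev have "\<forall>\<^sub>F x::real in at_top. False" by eventually_elim simp
    then show False by simp
  qed
  have "(\<Sum>n\<le>N. a n * complex_of_real x ^ n) = a 0" for x
  proof -
    have "(\<Sum>n\<le>N. a n * complex_of_real x ^ n) = (\<Sum>n\<in>{0}. a n * complex_of_real x ^ n)"
      using no by (intro sum.mono_neutral_right) auto
    then show ?thesis by simp
  qed
  with lim have "a 0 = 0" by (simp add: tendsto_const_iff)
  with no n show ?thesis by (cases "n = 0") auto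
qed

lemma exp_neg_mult_power_tendsto_0:
  "((\<lambda>x::real. complex_of_real (exp (-x)) * of_real x ^ n) \<longlongrightarrow> 0) at_top"
proof -
  have "((\<lambda>x::real. x ^ n / exp x) \<longlongrightarrow> 0) at_top"
    by (rule tendsto_power_div_exp_0)
  from tendsto_of_real[OF this, where 'a=complex] show ?thesis
    by (simp add: exp_minus field_simps)
qed

text \<open>Comparing growth as \<open>x\<close> tends to infinity kills the coefficients of \<open>e\<^sup>m\<^sup>x x\<^sup>n\<close> one value of
  \<open>m\<close> after the other, the largest first.\<close>

lemma log_series_unique:
  fixes h :: "nat \<Rightarrow> int \<Rightarrow> complex"
  assumes bnd: "\<And>n m. m > b \<Longrightarrow> h n m = 0"
    and sm: "\<And>n x. n \<le> N \<Longrightarrow> x > r \<Longrightarrow>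
              (\<lambda>m. h n m * of_real (exp x) powi m) summable_on UNIV"
    and z: "\<And>x. x > r \<Longrightarrow>
              (\<Sum>n\<le>N. (\<Sum>\<^sub>\<infinity>m. h n m * of_real (exp x) powi m) * of_real x ^ n) = 0"
    and n: "n \<le> N"
  shows "h n m = 0"
proof -
  \<comment> \<open>Counted downward from the top exponent \<open>b\<close>, the series in
    \<open>exp x\<close> becomes a power series in \<open>w x\<close>, which tends to 0.\<close>
  define a where "a n k = h n (b - int k)" for n k
  define w where "w x = complex_of_real (exp (-x))" for x
  have w0: "w x \<noteq> 0" for x by (simp add: w_def)
  have sums: "(\<lambda>k. a n k * w x ^ k) sums (w x powi b * (\<Sum>\<^sub>\<infinity>m. h n m * of_real (exp x) powi m))"
    if "n \<le> N" "x > r" for n x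
  proof -
    let ?S = "\<Sum>\<^sub>\<infinity>m. h n m * of_real (exp x) powi m"
    have "((\<lambda>m. h n m * of_real (exp x) powi m) has_sum ?S) UNIV"
      using sm[OF that] by simp
    then have "((\<lambda>m. h n m * of_real (exp x) powi m) has_sum ?S) {..b}"
      by (rule has_sum_cong_neutral[THEN iffD1, rotated -1]) (auto intro!: bnd)
    then have "((\<lambda>k. h n (b - int k) * of_real (exp x) powi (b - int k)) has_sum ?S) UNIV"
      by (subst has_sum_reindex_bij_witness[where i = "\<lambda>m. nat (b - m)" and j = "\<lambda>k. b - int k"
            and T = "{..b}" and h = "\<lambda>m. h n m * of_real (exp x) powi m"]) auto
    then have "((\<lambda>k. w x powi b * (h n (b - int k) * of_real (exp x) powi (b - int k)))
        has_sum w x powi b * ?S) UNIV"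
      by (rule has_sum_cmult_right)
    moreover have "w x powi b * (h n (b - int k) * of_real (exp x) powi (b - int k)) = a n k * w x ^ k"
      for k
    proof -
      have "complex_of_real (exp x) = inverse (w x)" by (simp add: w_def exp_minus)
      then have "complex_of_real (exp x) powi (b - int k) = w x powi (int k - b)"
        by (simp add: power_int_inverse flip: power_int_minus)
      moreover have "w x powi b * w x powi (int k - b) = w x ^ k"
        using w0[of x] by (simp flip: power_int_add)
      ultimately show ?thesis by (simp add: a_def algebra_simps)
    qed
    ultimately show ?thesis by (simp add: has_sum_imp_sums)
  qed
  have eq0: "(\<Sum>n\<le>N. (\<Sum>k. a n k * w x ^ k) * of_real x ^ n) = 0" if "x > r" for x
  proof -
    have "(\<Sum>n\<le>N. (\<Sum>k. a n k * w x ^ k) * of_real x ^ n) =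
       (\<Sum>n\<le>N. w x powi b * ((\<Sum>\<^sub>\<infinity>m. h n m * of_real (exp x) powi m) * of_real x ^ n))"
      using sums[OF _ that] by (intro sum.cong) (auto simp: sums_iff)
    also have "\<dots> = w x powi b *
       (\<Sum>n\<le>N. (\<Sum>\<^sub>\<infinity>m. h n m * of_real (exp x) powi m) * of_real x ^ n)"
      by (simp only: sum_distrib_left)
    finally show ?thesis by (simp only: z[OF that] mult_zero_right)
  qed
  have a0: "\<forall>n\<le>N. a n k = 0" for k
  proof (induction k rule: less_induct)
    case (less k)
    define G where "G n v = (\<Sum>j. a n (Suc k + j) * v ^ j)" for n and v :: complex
    have smk: "summable (\<lambda>j. a n (l + j) * w x ^ j)" if "n \<le> N" "x > r" for n x l
    proof -
      have "summable (\<lambda>j. a n (j + l) * w x ^ (j + l))"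
        using sums[OF that] summable_iff_shift[of "\<lambda>k. a n k * w x ^ k" l]
        by (simp add: sums_iff)
      then have "summable (\<lambda>j. (a n (j + l) * w x ^ (j + l)) * inverse (w x) ^ l)"
        by (rule summable_mult2)
      moreover have "w x ^ (j + l) * inverse (w x) ^ l = w x ^ j" for j
        using w0[of x] by (simp add: power_add field_simps)
      ultimately show ?thesis by (simp add: mult.assoc add.commute)
    qed
    have expand: "(\<Sum>j. a n j * w x ^ j) = w x ^ k * (a n k + w x * G n (w x))"
      if "n \<le> N" "x > r" for n x
    proof -
      have s0: "summable (\<lambda>j. a n j * w x ^ j)" using smk[OF that, of 0] by simp
      have "(\<Sum>j. a n j * w x ^ j) = (\<Sum>j. a n (j + Suc k) * w x ^ (j + Suc k)) +
               (\<Sum>j<Suc k. a n j * w x ^ j)"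
        by (rule suminf_split_initial_segment[OF s0])
      also have "(\<Sum>j<Suc k. a n j * w x ^ j) = a n k * w x ^ k"
        using less that by (simp add: less_Suc_eq)
      also have "(\<Sum>j. a n (j + Suc k) * w x ^ (j + Suc k)) =
          (\<Sum>j. w x ^ Suc k * (a n (Suc k + j) * w x ^ j))"
        by (simp add: algebra_simps power_add)
      also have "\<dots> = w x ^ Suc k * G n (w x)"
        unfolding G_def by (rule suminf_mult[OF smk[OF that]])
      finally show ?thesis by (simp add: algebra_simps)
    qed
    have w_lim: "(w \<longlongrightarrow> 0) at_top"
      using exp_neg_mult_power_tendsto_0[of 0] by (simp add: w_def[abs_def])
    have lim1: "((\<lambda>x. w x * of_real x ^ n * G n (w x)) \<longlongrightarrow> 0) at_top" if "n \<le> N" for n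
    proof -
      have "isCont (\<lambda>v. \<Sum>j. a n (Suc k + j) * v ^ j) 0"
        by (rule isCont_powser[OF smk[OF that, of "r + 1"]]) (simp_all add: w0)
      then have "isCont (G n) 0" by (simp add: G_def[abs_def])
      then have "((\<lambda>x. G n (w x)) \<longlongrightarrow> G n 0) at_top"
        by (rule isCont_tendsto_compose[OF _ w_lim])
      from tendsto_mult[OF exp_neg_mult_power_tendsto_0[of n] this] show ?thesis
        by (simp add: w_def)
    qed
    \<comment> \<open>With the coefficients below k gone, divide by \<open>w x ^ k\<close>: all
      later terms carry a factor \<open>w x\<close>, which beats every power of x. So the polynomial
      in x formed by the k-th coefficients tends to 0.\<close>
    have "((\<lambda>x. \<Sum>n\<le>N. a n k * of_real x ^ n) \<longlongrightarrow> 0) at_top"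
    proof -
      have "((\<lambda>x. - (\<Sum>n\<le>N. w x * of_real x ^ n * G n (w x))) \<longlongrightarrow> - (\<Sum>n\<le>N. 0)) at_top"
        by (intro tendsto_minus tendsto_sum lim1) auto
      moreover have "\<forall>\<^sub>F x in at_top. - (\<Sum>n\<le>N. w x * of_real x ^ n * G n (w x)) =
          (\<Sum>n\<le>N. a n k * of_real x ^ n)"
        using eventually_gt_at_top[of r]
      proof eventually_elim
        case (elim x)
        have "0 = (\<Sum>n\<le>N. w x ^ k * (a n k * of_real x ^ n + w x * of_real x ^ n * G n (w x)))"
          unfolding eq0[OF elim, symmetric]
          by (intro sum.cong) (auto simp: expand elim algebra_simps)
        also have "\<dots> = w x ^ k * ((\<Sum>n\<le>N. a n k * of_real x ^ n) +
                         (\<Sum>n\<le>N. w x * of_real x ^ n * G n (w x)))"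
          by (simp only: sum_distrib_left sum.distrib distrib_left)
        finally show ?case using w0[of x] by (simp add: add_eq_0_iff)
      qed
      ultimately show ?thesis by (simp add: tendsto_cong)
    qed
    then show ?case using poly_tendsto_zero[where a = "\<lambda>n. a n k"] by blast
  qed
  show ?thesis
  proof (cases "m > b")
    case False
    then have "h n m = a n (nat (b - m))" by (simp add: a_def)
    then show ?thesis using a0 n by simp
  qed (rule bnd)
qed

definition laurent_has_sum :: "(int \<Rightarrow> int \<Rightarrow> complex) \<Rightarrow> complex \<Rightarrow> complex \<Rightarrow> complex \<Rightarrow> bool" where
  "laurent_has_sum Q z1 z2 S \<longleftrightarrow> ((\<lambda>(m, n). Q m n * z1 powi m * z2 powi n) has_sum S) UNIV"

text \<open>The one-variable result is used twice: at fixed y in the variable x, where the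
  coefficient of \<open>exp x powi m\<close> absorbs the sums over n and l, and then in y. The
  hypotheses are asymmetric because matrix elements of a product of two fields have exponents of the
  first variable bounded above and, for each of them, finitely many of the second.\<close>

lemma log_series_unique2:
  fixes e :: "nat \<Rightarrow> nat \<Rightarrow> int \<Rightarrow> int \<Rightarrow> complex"
  assumes bnd: "\<And>k l m n. m > b \<Longrightarrow> e k l m n = 0"
    and fin: "\<And>k l m. finite {n. e k l m n \<noteq> 0}"
    and sm: "\<And>k l x y. \<lbrakk>k \<le> N; l \<le> N; x > y; y > 0\<rbrakk> \<Longrightarrow>
               laurent_has_sum (e k l) (of_real (exp x)) (of_real (exp y)) (s k l x y)"
    and z: "\<And>x y. \<lbrakk>x > y; y > 0\<rbrakk> \<Longrightarrow>
              (\<Sum>k\<le>N. \<Sum>l\<le>N. s k l x y * of_real x ^ k * of_real y ^ l) = 0"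
    and kl: "k \<le> N" "l \<le> N"
  shows "e k l m n = 0"
proof -
  define g where "g k l m y = (\<Sum>\<^sub>\<infinity>n. e k l m n * of_real (exp y) powi n)" for k l m and y :: real
  have fsum: "(\<lambda>n. e k l m n * of_real (exp y) powi n) summable_on UNIV" for k l m and y :: real
  proof -
    have "(\<lambda>n. e k l m n * of_real (exp y) powi n) summable_on {n. e k l m n \<noteq> 0}"
      using fin by simp
    then show ?thesis
      by (rule summable_on_cong_neutral[THEN iffD1, rotated -1]) auto
  qed
  have hs: "((\<lambda>m. g k l m y * of_real (exp x) powi m) has_sum
      s k l x y) UNIV"
    if "k \<le> N" "l \<le> N" "x > y" "y > 0" for k l x y
  proof -
    have "((\<lambda>(m, n). e k l m n * of_real (exp x) powi m * of_real (exp y) powi n) has_sum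
        s k l x y) (SIGMA m:UNIV. UNIV)"
      using sm[OF that] unfolding laurent_has_sum_def by simp
    then show ?thesis
    proof (rule has_sum_SigmaD)
      fix m :: int
      have "((\<lambda>n. (e k l m n * of_real (exp y) powi n) * of_real (exp x) powi m) has_sum
           g k l m y * of_real (exp x) powi m) UNIV"
        unfolding g_def by (intro has_sum_cmult_left has_sum_infsum fsum)
      then show "((\<lambda>n. case (m, n) of (m, n) \<Rightarrow>
            e k l m n * of_real (exp x) powi m * of_real (exp y) powi n) has_sum
           g k l m y * of_real (exp x) powi m) UNIV"
        by (simp add: mult_ac)
    qed
  qed
  have g0: "(\<Sum>l\<le>N. g k l m y * of_real y ^ l) = 0" if "k \<le> N" "y > 0" for k m y
  proof (rule log_series_unique[where N = N and r = y and b = b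
        and h = "\<lambda>k m. \<Sum>l\<le>N. g k l m y * of_real y ^ l"])
    show "(\<Sum>l\<le>N. g k l m y * of_real y ^ l) = 0" if "m > b" for k m
      using bnd[OF that] by (simp add: g_def)
    have hs': "((\<lambda>m. (\<Sum>l\<le>N. g k l m y * of_real y ^ l) * of_real (exp x) powi m) has_sum
        (\<Sum>l\<le>N. s k l x y * of_real y ^ l)) UNIV"
      if "k \<le> N" "x > y" for k x
    proof -
      have "((\<lambda>m. \<Sum>l\<le>N. (g k l m y * of_real (exp x) powi m) * of_real y ^ l) has_sum
        (\<Sum>l\<le>N. s k l x y * of_real y ^ l)) UNIV"
        using that \<open>y > 0\<close> by (intro has_sum_finite_sum has_sum_cmult_left hs) auto
      then show ?thesis by (simp add: sum_distrib_right sum_distrib_left mult_ac)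
    qed
    show "(\<lambda>m. (\<Sum>l\<le>N. g k l m y * of_real y ^ l) * of_real (exp x) powi m) summable_on UNIV"
      if "k \<le> N" "x > y" for k x
      using hs'[OF that] by (rule has_sum_imp_summable)
    show "(\<Sum>k\<le>N. (\<Sum>\<^sub>\<infinity>m. (\<Sum>l\<le>N. g k l m y * of_real y ^ l) * of_real (exp x) powi m) *
            of_real x ^ k) = 0" if "x > y" for x
    proof -
      have "(\<Sum>k\<le>N. (\<Sum>\<^sub>\<infinity>m. (\<Sum>l\<le>N. g k l m y * of_real y ^ l) * of_real (exp x) powi m) *
            of_real x ^ k) = (\<Sum>k\<le>N. \<Sum>l\<le>N. s k l x y *
                 of_real x ^ k * of_real y ^ l)"
        using hs'[OF _ that] by (intro sum.cong) (auto simp: has_sum_iff sum_distrib_left mult_ac)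
      then show ?thesis using z[OF that \<open>y > 0\<close>] by simp
    qed
  qed (rule that)
  \<comment> \<open>Setting the coefficients with \<open>l > N\<close> to 0 leaves a finite union of
    supports, so that a common top exponent exists.\<close>
  have "(if l \<le> N then e k l m n else 0) = 0"
  proof (rule log_series_unique[where N = N and n = l and r = 0 and h = "\<lambda>l n. if l \<le> N then e k l m n else 0"
        and b = "Max (insert 0 (\<Union>l\<le>N. {n. e k l m n \<noteq> 0}))"])
    show "(if l \<le> N then e k l m n else 0) = 0"
      if "n > Max (insert 0 (\<Union>l\<le>N. {n. e k l m n \<noteq> 0}))" for l n
      using that fin by auto
    show "(\<lambda>n. (if l \<le> N then e k l m n else 0) * of_real (exp x) powi n) summable_on UNIV" for l x
      using fsum[of k l m x] by (cases "l \<le> N") auto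
    show "(\<Sum>l\<le>N. (\<Sum>\<^sub>\<infinity>n. (if l \<le> N then e k l m n else 0) * of_real (exp x) powi n) *
            of_real x ^ l) = 0" if "x > 0" for x
      using g0[OF \<open>k \<le> N\<close> that, of m] by (simp add: g_def)
    show "l \<le> N" by (rule kl)
  qed
  then show ?thesis using kl by simp
qed

subsection \<open>Multiplication of multivariate series by differences of variables\<close>

text \<open>The coefficient at \<open>ms\<close> of a product with \<open>x_l\<close> is the old
  coefficient at \<open>dec l ms\<close>.\<close>

definition dec :: "nat \<Rightarrow> int list \<Rightarrow> int list" where
  "dec l ms = ms[l := ms ! l - 1]"

text \<open>A family \<open>X\<close> over lists of exponents is a formal Laurent series in \<open>x\<^sub>0, x\<^sub>1, \<dots>\<close>; this is its product
  with \<open>x\<^sub>l - x\<^sub>j\<close>.\<close>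

definition times_diff :: "nat \<Rightarrow> nat \<Rightarrow> (int list \<Rightarrow> 'a::ab_group_add) \<Rightarrow> int list \<Rightarrow> 'a" where
  "times_diff l j X ms = X (dec l ms) - X (dec j ms)"

definition times_diffs ::
  "(nat \<times> nat) list \<Rightarrow> (int list \<Rightarrow> 'a::ab_group_add) \<Rightarrow> int list \<Rightarrow> 'a" where
  "times_diffs ps = fold (\<lambda>(l, j). times_diff l j) ps"

lemma length_dec [simp]: "length (dec l ms) = length ms"
  by (simp add: dec_def)

lemma dec_simps [simp]:
  "dec 0 (m # ms) = (m - 1) # ms" "dec (Suc l) (m # ms) = m # dec l ms"
  by (simp_all add: dec_def)

lemma dec_commute: "dec j (dec l ms) = dec l (dec j ms)"
  by (cases "j = l") (simp_all add: dec_def list_update_swap[of j])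

lemma dec_nth_le: "dec l ms ! j \<le> ms ! j"
  by (cases "l < length ms") (auto simp: dec_def nth_list_update list_update_beyond)

lemma sum_list_dec: "l < length ms \<Longrightarrow> sum_list (dec l ms) = sum_list ms - 1"
proof (induction ms arbitrary: l)
  case (Cons m ms)
  then show ?case by (cases l) auto
qed simp

lemma times_diff_commute: "times_diff a b (times_diff c d X) = times_diff c d (times_diff a b X)"
  by (rule ext) (simp add: times_diff_def dec_commute algebra_simps)

lemma times_diffs_simps [simp]:
  "times_diffs [] X = X"
  "times_diffs ((l, j) # ps) X = times_diffs ps (times_diff l j X)"
  "times_diffs (ps @ qs) X = times_diffs qs (times_diffs ps X)"
  by (simp_all add: times_diffs_def)

lemma times_diffs_cong_mset: "mset ps = mset qs \<Longrightarrow> times_diffs ps = times_diffs qs"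
  unfolding times_diffs_def
  by (rule fold_multiset_equiv) (auto simp: fun_eq_iff times_diff_commute)

lemma times_diffs_swap: "times_diffs ps (times_diffs qs X) = times_diffs qs (times_diffs ps X)"
  using fun_cong[OF times_diffs_cong_mset[of "qs @ ps" "ps @ qs"], of X] by (simp add: union_commute)

lemma times_diffs_replicate: "times_diffs (replicate n (l, j)) X = (times_diff l j ^^ n) X"
  by (induction n arbitrary: X) (simp_all add: funpow_swap1)

lemma times_diffs_cong:
  assumes "\<And>ms. length ms = k \<Longrightarrow> X ms = Y ms" "length ms = k"
  shows "times_diffs ps X ms = times_diffs ps Y ms"
  using assms
proof (induction ps arbitrary: X Y)
  case (Cons p ps)
  have "times_diffs ps (times_diff (fst p) (snd p) X) ms =
        times_diffs ps (times_diff (fst p) (snd p) Y) ms"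
    by (rule Cons.IH) (simp_all add: times_diff_def Cons.prems)
  then show ?case by (cases p) simp
qed simp

lemma times_diffs_linear:
  assumes "\<And>a b. f (a - b) = f a - f b"
  shows "times_diffs ps (\<lambda>ms. f (X ms)) ms = f (times_diffs ps X ms)"
proof (induction ps arbitrary: X)
  case (Cons p ps)
  have "times_diff (fst p) (snd p) (\<lambda>ms. f (X ms)) = (\<lambda>ms. f (times_diff (fst p) (snd p) X ms))"
    by (simp add: fun_eq_iff times_diff_def assms)
  with Cons.IH show ?case by (cases p) simp
qed simp

lemma times_diffs_shift:
  "times_diffs (map (map_prod Suc Suc) ps) X (m # ms) = times_diffs ps (\<lambda>ms. X (m # ms)) ms"
proof (induction ps arbitrary: X)
  case (Cons p ps)
  have "(\<lambda>ms. times_diff (Suc (fst p)) (Suc (snd p)) X (m # ms)) =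
        times_diff (fst p) (snd p) (\<lambda>ms. X (m # ms))"
    by (simp add: fun_eq_iff times_diff_def)
  with Cons.IH[of "times_diff (Suc (fst p)) (Suc (snd p)) X"] show ?case by (cases p) simp
qed simp

text \<open>These factors do not involve the variable at position 1, whose exponent
  \<open>m'\<close> becomes a parameter; \<open>hd\<close> and \<open>tl\<close> insert it again.
  This reduces a product over \<open>i # j # js\<close> to one over \<open>i # js\<close> once
  \<open>i\<close> has passed \<open>j\<close>.\<close>

lemma times_diffs_skip:
  "times_diffs (map (\<lambda>n. (0, Suc (Suc n))) ns) X (m # m' # ms) =
   times_diffs (map (\<lambda>n. (0, Suc n)) ns) (\<lambda>ms. X (hd ms # m' # tl ms)) (m # ms)"
proof (induction ns arbitrary: X)
  case (Cons n ns)
  have "times_diffs (map (\<lambda>n. (0, Suc n)) ns)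
          (\<lambda>ms. times_diff 0 (Suc (Suc n)) X (hd ms # m' # tl ms)) (m # ms) =
        times_diffs (map (\<lambda>n. (0, Suc n)) ns)
          (times_diff 0 (Suc n) (\<lambda>ms. X (hd ms # m' # tl ms))) (m # ms)"
    by (rule times_diffs_cong[where k = "Suc (length ms)"])
       (auto simp: times_diff_def length_Suc_conv)
  with Cons.IH[of "times_diff 0 (Suc (Suc n)) X"] show ?case by simp
qed simp

text \<open>Multiplication reads coefficients at decremented indices, and \<open>dec\<close> never
  raises an entry.\<close>

lemma times_diffs_vanish_below:
  assumes "\<And>ms. length ms = k \<Longrightarrow> ms ! l < c \<Longrightarrow> X ms = 0" "length ms = k" "ms ! l < c"
  shows "times_diffs ps X ms = 0"
  using assms
proof (induction ps arbitrary: X)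
  case (Cons p ps)
  have "times_diffs ps (times_diff (fst p) (snd p) X) ms = 0"
  proof (rule Cons.IH)
    fix ms :: "int list" assume "length ms = k" "ms ! l < c"
    then show "times_diff (fst p) (snd p) X ms = 0"
      using dec_nth_le[of "fst p" ms l] dec_nth_le[of "snd p" ms l]
      by (simp add: times_diff_def Cons.prems(1))
  qed (use Cons.prems in auto)
  then show ?case by (cases p) simp
qed simp

text \<open>Every factor is homogeneous of degree 1, so the degrees are translated by the number of
  factors.\<close>

lemma times_diffs_degrees:
  assumes "\<And>ms. length ms = k \<Longrightarrow> X ms \<noteq> 0 \<Longrightarrow> sum_list ms \<in> S" "length ms = k"
    and "times_diffs ps X ms \<noteq> 0" "\<And>l j. (l, j) \<in> set ps \<Longrightarrow> l < k \<and> j < k"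
  shows "sum_list ms - int (length ps) \<in> S"
  using assms
proof (induction ps arbitrary: X S)
  case (Cons p ps)
  have "sum_list ms - int (length ps) \<in> (+) 1 ` S"
  proof (rule Cons.IH[of "times_diff (fst p) (snd p) X"])
    fix ms :: "int list"
    assume ms: "length ms = k" "times_diff (fst p) (snd p) X ms \<noteq> 0"
    then have "X (dec (fst p) ms) \<noteq> 0 \<or> X (dec (snd p) ms) \<noteq> 0"
      by (auto simp: times_diff_def)
    then have "sum_list ms - 1 \<in> S"
      using Cons.prems(1)[of "dec (fst p) ms"] Cons.prems(1)[of "dec (snd p) ms"]
        Cons.prems(4)[of "fst p" "snd p"] ms(1) sum_list_dec[of _ ms] by auto
    then show "sum_list ms \<in> (+) 1 ` S" by (rule image_eqI[rotated]) simp
  qed (use Cons.prems in \<open>cases p; auto\<close>)+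
  then show ?case by (auto simp: algebra_simps)
qed simp

text \<open>The support condition satisfied by the matrix elements of a product of fields, the rightmost
  of which acts first.\<close>

definition lower_truncated :: "nat \<Rightarrow> (int list \<Rightarrow> 'a::zero) \<Rightarrow> bool" where
  "lower_truncated k X \<longleftrightarrow> (\<forall>ms j. length ms = k \<and> j < k \<longrightarrow>
     (\<exists>b. \<forall>ms'. length ms' = k \<and> drop (Suc j) ms' = drop (Suc j) ms \<and> ms' ! j < b \<longrightarrow> X ms' = 0))"

text \<open>Up to position j a decrement leaves the tail after j alone and at most lowers entry j;
  beyond j it changes equal tails in the same way.\<close>

lemma lower_truncated_dec:
  assumes "lower_truncated k X"
  shows "lower_truncated k (\<lambda>ms. X (dec l ms))"
  unfolding lower_truncated_def
proof (intro allI impI)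
  fix ms :: "int list" and j assume ms: "length ms = k \<and> j < k"
  with assms obtain b where b: "\<And>ms'. length ms' = k \<Longrightarrow>
      drop (Suc j) ms' = drop (Suc j) (dec l ms) \<Longrightarrow> ms' ! j < b \<Longrightarrow> X ms' = 0"
    unfolding lower_truncated_def by (metis length_dec)
  have "X (dec l ms') = 0"
    if ms': "length ms' = k" "drop (Suc j) ms' = drop (Suc j) ms" "ms' ! j < b" for ms'
  proof (rule b)
    show "drop (Suc j) (dec l ms') = drop (Suc j) (dec l ms)"
    proof (cases "l \<le> j")
      case True
      then show ?thesis using ms' by (simp add: dec_def)
    next
      case False
      then obtain d where l: "l = Suc j + d" by (metis less_iff_Suc_add not_le add_Suc)
      have dec_drop: "drop (Suc j) (dec l xs) = dec d (drop (Suc j) xs)" if "Suc j \<le> length xs" for xs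
        using that by (simp add: dec_def l drop_update_swap)
      show ?thesis using ms ms' by (simp add: dec_drop)
    qed
    show "dec l ms' ! j < b" using dec_nth_le[of l ms' j] ms'(3) by linarith
  qed (use ms' in simp)
  then show "\<exists>b. \<forall>ms'. length ms' = k \<and> drop (Suc j) ms' = drop (Suc j) ms \<and> ms' ! j < b \<longrightarrow>
      X (dec l ms') = 0"
    by (intro exI[of _ b]) blast
qed

lemma lower_truncated_minus:
  fixes X Y :: "int list \<Rightarrow> 'a::ab_group_add"
  assumes "lower_truncated k X" "lower_truncated k Y"
  shows "lower_truncated k (\<lambda>ms. X ms - Y ms)"
  unfolding lower_truncated_def
proof (intro allI impI)
  fix ms :: "int list" and j assume ms: "length ms = k \<and> j < k"
  from assms(1) ms obtain b where b: "\<And>ms'. length ms' = k \<Longrightarrow>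
      drop (Suc j) ms' = drop (Suc j) ms \<Longrightarrow> ms' ! j < b \<Longrightarrow> X ms' = 0"
    unfolding lower_truncated_def by blast
  from assms(2) ms obtain c where c: "\<And>ms'. length ms' = k \<Longrightarrow>
      drop (Suc j) ms' = drop (Suc j) ms \<Longrightarrow> ms' ! j < c \<Longrightarrow> Y ms' = 0"
    unfolding lower_truncated_def by blast
  show "\<exists>b. \<forall>ms'. length ms' = k \<and> drop (Suc j) ms' = drop (Suc j) ms \<and> ms' ! j < b \<longrightarrow>
      X ms' - Y ms' = 0"
    by (intro exI[of _ "min b c"]) (simp add: b c)
qed

lemma lower_truncated_times_diff:
  "lower_truncated k X \<Longrightarrow> lower_truncated k (times_diff l j X)"
  unfolding times_diff_def[abs_def] by (intro lower_truncated_minus lower_truncated_dec)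

section \<open>Evaluation of multivariate series and division by differences\<close>

definition monom_val :: "complex list \<Rightarrow> int list \<Rightarrow> complex" where
  "monom_val zs ms = (\<Prod>j<length zs. (zs ! j) powi (ms ! j))"

lemma monom_val_update:
  assumes "l < length zs" "length ms = length zs" "zs ! l \<noteq> 0"
  shows "monom_val zs (ms[l := ms ! l + d]) = monom_val zs ms * (zs ! l) powi d"
proof -
  have "monom_val zs (ms[l := ms ! l + d]) =
        (\<Prod>j<length zs. (zs ! j) powi (ms ! j) * (if j = l then (zs ! l) powi d else 1))"
    unfolding monom_val_def using assms
    by (intro prod.cong) (auto simp: nth_list_update power_int_add)
  also have "\<dots> = monom_val zs ms * (zs ! l) powi d"
    using assms by (simp add: prod.distrib monom_val_def prod.delta)
  finally show ?thesis .
qed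

text \<open>Dividing by \<open>z\<^sub>l - z\<^sub>j\<close> amounts to multiplying with the geometric series in \<open>z\<^sub>j / z\<^sub>l\<close>; by
  truncation this is the only way to undo \<^const>\<open>times_diff\<close>.\<close>

lemma has_sum_divide_diff:
  assumes zs: "radially_ordered zs" and k: "length zs = k" and lj: "l < j" "j < k"
    and trunc: "lower_truncated k X"
    and sum: "((\<lambda>ms. times_diff l j X ms * monom_val zs ms) has_sum S) {ms. length ms = k}"
  shows "((\<lambda>ms. X ms * monom_val zs ms) has_sum S / (zs ! l - zs ! j)) {ms. length ms = k}"
proof -
  let ?L = "{ms :: int list. length ms = k}"
  define K where "K = times_diff l j X"
  define z where "z = zs ! l"
  define z' where "z' = zs ! j"
  define q where "q = z' / z"
  have nz: "z \<noteq> 0" "z' \<noteq> 0" and less: "cmod z' < cmod z"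
    using zs k lj unfolding radially_ordered_def z_def z'_def
    by (auto simp: sorted_wrt_iff_nth_less in_set_conv_nth)
  have q: "norm q < 1" "q \<noteq> 0" using nz less by (simp_all add: q_def norm_divide)
  have zz: "z - z' \<noteq> 0" using less by auto
  \<comment> \<open>In the product of \<open>K\<close> with the sum of
    \<open>z_j^n z_l^(-n-1)\<close> over n, the n-th contribution to the coefficient at
    \<open>ms\<close> is \<open>K (T n ms)\<close>; \<open>T' n\<close> inverts
    \<open>T n\<close>.\<close>
  define T where "T n ms = ms[l := ms ! l + (1 + int n), j := ms ! j - int n]" for n ms
  define T' where "T' n ms = ms[l := ms ! l + (- 1 - int n), j := ms ! j + int n]" for n ms
  have len: "length (T n ms) = length ms" "length (T' n ms) = length ms" for n ms
    by (simp_all add: T_def T'_def)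
  have TT': "T n (T' n ms) = ms" "T' n (T n ms) = ms" if "length ms = k" for n ms
    using that lj by (auto simp: T_def T'_def list_eq_iff_nth_eq nth_list_update)
  have mon_T: "monom_val zs ms = monom_val zs (T n ms) * (q ^ n / z)" if "length ms = k" for n ms
  proof -
    have "monom_val zs (T n ms) = monom_val zs ms * z powi (1 + int n) * z' powi (- int n)"
      using monom_val_update[of l zs ms "1 + int n"]
        monom_val_update[of j zs "ms[l := ms ! l + (1 + int n)]" "- int n"] that k lj nz
      by (simp add: T_def z_def z'_def)
    moreover have "z powi (1 + int n) = z * z ^ n"
      using nz by (simp add: power_int_add)
    moreover have "z' powi (- int n) = inverse (z' ^ n)"
      by (simp add: power_int_minus)
    ultimately show ?thesis using nz by (simp add: q_def power_divide)
  qed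
  have X_sum: "((\<lambda>n. K (T n ms)) has_sum X ms) UNIV" if ms: "length ms = k" for ms
  proof -
    \<comment> \<open>The sum over n telescopes along \<open>U\<close>. Since \<open>l < j\<close>,
      the entries after j stay fixed while entry j falls, so truncation makes \<open>X (U n)\<close>
      vanish from \<open>R\<close> on.\<close>
    define U where "U n = ms[l := ms ! l + int n, j := ms ! j - int n]" for n
    have KT: "K (T n ms) = X (U n) - X (U (Suc n))" for n
    proof -
      have "dec l (T n ms) = U n" "dec j (T n ms) = U (Suc n)"
        using ms lj by (auto simp: dec_def T_def U_def list_eq_iff_nth_eq nth_list_update)
      then show ?thesis by (simp add: K_def times_diff_def)
    qed
    obtain b where b: "\<And>ms'. length ms' = k \<Longrightarrow> drop (Suc j) ms' = drop (Suc j) ms \<Longrightarrow>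
        ms' ! j < b \<Longrightarrow> X ms' = 0"
      using trunc ms lj unfolding lower_truncated_def by blast
    define R where "R = nat (ms ! j - b + 1)"
    have U0: "X (U n) = 0" if "n \<ge> R" for n
      using that ms lj by (intro b) (auto simp: U_def R_def)
    have "(\<Sum>n<R. K (T n ms)) = X (U 0) - X (U R)"
      unfolding KT by (rule sum_lessThan_telescope')
    also have "\<dots> = X ms" using U0[of R] by (simp add: U_def)
    finally show ?thesis
      by (intro has_sum_finite_neutralI[where B = "{..<R}"]) (auto simp: KT U0)
  qed
  define G where "G n ms = (q ^ n / z) * (K ms * monom_val zs ms)" for n ms
  have geo: "((\<lambda>n. q ^ n / z * S) has_sum S / (z - z')) UNIV"
  proof -
    have "((\<lambda>n. q ^ n) has_sum 1 / (1 - q)) UNIV"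
      using q by (intro norm_summable_imp_has_sum geometric_sums)
         (simp_all add: norm_power summable_geometric)
    then have "((\<lambda>n. q ^ n * (S / z)) has_sum 1 / (1 - q) * (S / z)) UNIV"
      by (rule has_sum_cmult_left)
    moreover have "1 / (1 - q) * (S / z) = S / (z - z')"
      using nz zz by (simp add: q_def field_simps)
    moreover have "q ^ n * (S / z) = q ^ n / z * S" for n by simp
    ultimately show ?thesis by (simp only:)
  qed
  have inner: "((\<lambda>ms. G n ms) has_sum q ^ n / z * S) ?L" for n
    unfolding G_def K_def by (rule has_sum_cmult_right[OF sum])
  \<comment> \<open>The norms of \<open>G\<close> are products of geometric terms with terms of the
    finite norm sum \<open>C\<close>, so the double series converges absolutely and may be
    reordered.\<close>
  have summ: "(\<lambda>(n, ms). G n ms) summable_on UNIV \<times> ?L"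
  proof -
    have K_summable: "(\<lambda>ms. norm (K ms * monom_val zs ms)) summable_on ?L"
      using has_sum_imp_summable[OF sum] unfolding K_def
      by (subst summable_on_iff_abs_summable_on_complex[symmetric])
    define C where "C = (\<Sum>\<^sub>\<infinity>ms\<in>?L. norm (K ms * monom_val zs ms))"
    have norm_G: "norm (G n ms) = norm q ^ n / norm z * norm (K ms * monom_val zs ms)" for n ms
      unfolding G_def by (simp only: norm_mult norm_divide norm_power)
    have C_sum: "((\<lambda>ms. norm (G n ms)) has_sum norm q ^ n / norm z * C) ?L" for n
      unfolding norm_G C_def by (rule has_sum_cmult_right[OF has_sum_infsum[OF K_summable]])
    have "summable (\<lambda>n. norm q ^ n / norm z * C)"
      using q by (intro summable_mult2 summable_divide summable_geometric) simp
    moreover have "C \<ge> 0" unfolding C_def by (rule infsum_nonneg) simp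
    ultimately have "(\<lambda>n. norm q ^ n / norm z * C) summable_on UNIV"
      by (intro summable_nonneg_imp_summable_on) simp_all
    then have "(\<lambda>(n, ms). norm (G n ms)) summable_on UNIV \<times> ?L"
      by (intro summable_on_SigmaI[where g = "\<lambda>n. norm q ^ n / norm z * C"]) (use C_sum in simp_all)
    then show ?thesis
      by (subst summable_on_iff_abs_summable_on_complex) (simp add: case_prod_unfold)
  qed
  have G_T: "G n (T n ms) = K (T n ms) * monom_val zs ms" if "length ms = k" for n ms
    unfolding G_def mon_T[OF that, of n] by (simp only: mult_ac)
  have "((\<lambda>(n, ms). G n ms) has_sum S / (z - z')) (UNIV \<times> ?L)"
    by (rule has_sum_SigmaI[OF _ geo summ]) (use inner in simp)
  then have "((\<lambda>(n, ms). G n (T n ms)) has_sum S / (z - z')) (UNIV \<times> ?L)"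
    by (subst has_sum_reindex_bij_witness[where i = "\<lambda>(n, ms). (n, T' n ms)" and
          j = "\<lambda>(n, ms). (n, T n ms)" and T = "UNIV \<times> ?L" and h = "\<lambda>(n, ms). G n ms"])
       (auto simp: TT' len)
  then have "((\<lambda>(n, ms). K (T n ms) * monom_val zs ms) has_sum S / (z - z')) (UNIV \<times> ?L)"
    by (rule has_sum_cong[THEN iffD1, rotated]) (auto simp: G_T)
  \<comment> \<open>Summing over n first now recovers \<open>X ms\<close> by
    \<open>X_sum\<close>.\<close>
  then have "((\<lambda>(ms, n). K (T n ms) * monom_val zs ms) has_sum S / (z - z')) (?L \<times> UNIV)"
    by (subst has_sum_swap) (simp add: case_prod_unfold)
  then show ?thesis unfolding z_def[symmetric] z'_def[symmetric]
    by (rule has_sum_SigmaD) (use X_sum in \<open>auto intro!: has_sum_cmult_left\<close>)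
qed

lemma has_sum_divide_diffs:
  assumes zs: "radially_ordered zs" and k: "length zs = k"
    and ps: "\<And>l j. (l, j) \<in> set ps \<Longrightarrow> l < j \<and> j < k"
    and trunc: "lower_truncated k X"
    and sum: "((\<lambda>ms. times_diffs ps X ms * monom_val zs ms) has_sum S) {ms. length ms = k}"
  shows "((\<lambda>ms. X ms * monom_val zs ms) has_sum S / (\<Prod>(l, j)\<leftarrow>ps. zs ! l - zs ! j))
           {ms. length ms = k}"
  using ps trunc sum
proof (induction ps arbitrary: X)
  case (Cons p ps)
  have "((\<lambda>ms. times_diff (fst p) (snd p) X ms * monom_val zs ms) has_sum
      S / (\<Prod>(l, j)\<leftarrow>ps. zs ! l - zs ! j)) {ms. length ms = k}"
    using Cons.prems
    by (intro Cons.IH) (cases p; auto intro!: lower_truncated_times_diff)+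
  from has_sum_divide_diff[OF zs k _ _ Cons.prems(2) this] show ?case
    using Cons.prems(1)[of "fst p" "snd p"] by (cases p) (simp add: field_simps)
qed simp

subsection \<open>Products of modes\<close>

lemma exp_lp: "z \<noteq> 0 \<Longrightarrow> exp (lp p z) = z"
proof -
  assume z: "z \<noteq> 0"
  have "exp (lp p z) = of_real (cmod z) * exp (\<i> * of_real (Arg2pi z)) * exp (2 * of_real pi * \<i> * of_int p)"
    using z by (simp add: lp_def exp_add exp_of_real)
  also have "exp (2 * of_real pi * \<i> * of_int p) = 1"
    using exp_integer_2pi[of "of_int p"] by (simp add: mult_ac)
  finally show ?thesis using Arg2pi_eq[of z] by simp
qed

lemma branch_monom_diff:
  assumes "z \<noteq> 0"
  shows "branch_monom p (of_int m - a) n z = z powi m * branch_monom p (- a) n z"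
proof -
  have "exp ((of_int m - a) * lp p z) = exp (of_int m * lp p z) * exp (- a * lp p z)"
    by (simp add: left_diff_distrib flip: exp_add)
  also have "exp (of_int m * lp p z) = z powi m"
    using exp_power_int[of "lp p z" m] exp_lp[OF assms] by simp
  finally show ?thesis by (simp add: branch_monom_def)
qed

text \<open>Turns powers of the logarithm into powers of x, the form in which
  \<open>log_series_unique\<close> is stated.\<close>

lemma lp_exp_real: "lp 0 (of_real (exp x)) = of_real x"
proof -
  have "Arg2pi (of_real (exp x)) = 0" by (simp only: Arg2pi_eq_0) simp
  then show ?thesis by (simp add: lp_def norm_of_real del: of_real_exp exp_of_real)
qed

lemma finite_log_exponents: "finite (log_exponents k N)"
  using finite_lists_length_eq[of "{..N}" k] by (simp add: log_exponents_def conj_commute)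

text \<open>The consequences of the twisted axioms from which the equivalence is derived.
  \<open>phi_log_bound\<close> is uniform in the vector, and \<open>wt\<close> is complex so that it
  can be added to the weights of the module.\<close>

locale graded_modes = vector_space sW
  for sW :: "complex \<Rightarrow> 'w::ab_group_add \<Rightarrow> 'w" +
  fixes G :: "complex \<Rightarrow> 'w set"
    and I :: "'i set"
    and al wt :: "'i \<Rightarrow> complex"
    and phi :: "'i \<Rightarrow> 'w series"
  assumes phi_linear: "i \<in> I \<Longrightarrow> Vector_Spaces.linear sW sW (phi i r k)"
    and phi_powers: "\<lbrakk>i \<in> I; r + al i \<notin> \<int>\<rbrakk> \<Longrightarrow> phi i r k w = 0"
    and phi_truncation: "i \<in> I \<Longrightarrow> \<exists>m0::int. \<forall>m<m0. \<forall>k. phi i (of_int m - al i) k w = 0"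
    and phi_log_bound: "i \<in> I \<Longrightarrow> \<exists>K. \<forall>k\<ge>K. \<forall>r w. phi i r k w = 0"
    and phi_weight: "\<lbrakk>i \<in> I; w \<in> G n\<rbrakk> \<Longrightarrow> phi i r k w \<in> G (n + r + wt i)"
    and span_weights: "span (\<Union>n. G n) = UNIV"
    and dual_separates: "(\<And>w'. w' \<in> graded_dual sW G \<Longrightarrow> w' v = 0) \<Longrightarrow> v = 0"
begin

definition mode :: "'i \<Rightarrow> int \<Rightarrow> nat \<Rightarrow> 'w \<Rightarrow> 'w" where
  "mode i m k = phi i (of_int m - al i) k"

primrec modes :: "'i list \<Rightarrow> nat list \<Rightarrow> 'w \<Rightarrow> int list \<Rightarrow> 'w" where
  "modes [] ks w ms = w"
| "modes (i # is) ks w ms = mode i (hd ms) (hd ks) (modes is (tl ks) w (tl ms))"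

lemma phi_simps:
  assumes "i \<in> I"
  shows "phi i r k 0 = 0" "phi i r k (u + v) = phi i r k u + phi i r k v"
    "phi i r k (u - v) = phi i r k u - phi i r k v" "phi i r k (sW c u) = sW c (phi i r k u)"
proof -
  interpret l: Vector_Spaces.linear sW sW "phi i r k" by (rule phi_linear[OF assms])
  show "phi i r k 0 = 0" "phi i r k (u + v) = phi i r k u + phi i r k v"
    "phi i r k (u - v) = phi i r k u - phi i r k v" "phi i r k (sW c u) = sW c (phi i r k u)"
    by (rule l.zero l.add l.diff l.scale)+
qed

lemma mode_simps:
  assumes "i \<in> I"
  shows "mode i m k 0 = 0" "mode i m k (u + v) = mode i m k u + mode i m k v"
    "mode i m k (u - v) = mode i m k u - mode i m k v" "mode i m k (sW c u) = sW c (mode i m k u)"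
  unfolding mode_def by (rule phi_simps[OF assms])+

lemma dual_simps:
  assumes "w' \<in> graded_dual sW G"
  shows "w' 0 = 0" "w' (u + v) = w' u + w' v" "w' (u - v) = w' u - w' v" "w' (sW c u) = c * w' u"
proof -
  interpret l: Vector_Spaces.linear sW "(*)" w' using assms by (simp add: graded_dual_def)
  show "w' 0 = 0" "w' (u + v) = w' u + w' v" "w' (u - v) = w' u - w' v" "w' (sW c u) = c * w' u"
    by (rule l.zero l.add l.diff l.scale)+
qed

lemma modes_simps:
  assumes "set is \<subseteq> I"
  shows "modes is ks 0 ms = 0" "modes is ks (u + v) ms = modes is ks u ms + modes is ks v ms"
    "modes is ks (sW c u) ms = sW c (modes is ks u ms)"
  using assms by (induction "is" arbitrary: ks ms) (auto simp: mode_simps)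

lemma modes_weight:
  assumes "set is \<subseteq> I" "w \<in> G n" "length ms = length is"
  shows "modes is ks w ms \<in> G (n + of_int (sum_list ms) + (\<Sum>i\<leftarrow>is. wt i - al i))"
  using assms
proof (induction "is" arbitrary: ks ms)
  case (Cons i js)
  then obtain m ms' where ms: "ms = m # ms'" "length ms' = length js" by (auto simp: length_Suc_conv)
  have "modes js (tl ks) w ms' \<in> G (n + of_int (sum_list ms') + (\<Sum>i\<leftarrow>js. wt i - al i))"
    using Cons ms by auto
  from phi_weight[OF _ this, of i "of_int m - al i" "hd ks"] Cons.prems(1) show ?case
    by (simp add: ms mode_def algebra_simps)
qed simp

text \<open>For homogeneous \<open>w\<close> the vector \<open>modes is ks w ms\<close> lies in a
  single weight space, whose weight determines \<open>sum_list ms\<close>, and \<open>w'\<close> is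
  nonzero in finitely many weights only. Powers of logarithms do not affect the weight, hence one
  \<open>S\<close> for all \<open>ks\<close>.\<close>

lemma modes_degrees:
  assumes w': "w' \<in> graded_dual sW G" and "is": "set is \<subseteq> I"
  shows "\<exists>S. finite S \<and>
    (\<forall>ks ms. length ms = length is \<longrightarrow> w' (modes is ks w ms) \<noteq> 0 \<longrightarrow> sum_list ms \<in> S)"
    (is "?P w")
proof -
  have "w \<in> span (\<Union>n. G n)" by (simp add: span_weights)
  then show ?thesis
  proof (induction rule: span_induct_alt)
    case base
    then show ?case by (auto simp: modes_simps[OF "is"] dual_simps[OF w'])
  next
    case (step c x y)
    obtain n where x: "x \<in> G n" using step by auto
    let ?c = "\<Sum>i\<leftarrow>is. wt i - al i"
    define F where "F = {n. \<exists>v\<in>G n. w' v \<noteq> 0}"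
    have "finite F" using w' by (simp add: F_def graded_dual_def)
    then have "finite ((\<lambda>s::int. n + of_int s + ?c) -` F)"
      by (rule finite_vimageI) (simp add: inj_on_def)
    moreover have x_deg: "sum_list ms \<in> (\<lambda>s::int. n + of_int s + ?c) -` F"
      if "length ms = length is" "w' (modes is ks x ms) \<noteq> 0" for ks ms
      using modes_weight[OF "is" x that(1), of ks] that(2) by (auto simp: F_def)
    moreover obtain S where "finite S" and y_deg:
      "\<And>ks ms. length ms = length is \<Longrightarrow> w' (modes is ks y ms) \<noteq> 0 \<Longrightarrow> sum_list ms \<in> S"
      using step by blast
    moreover have "sum_list ms \<in> (\<lambda>s::int. n + of_int s + ?c) -` F \<union> S"
      if "length ms = length is" "w' (modes is ks (sW c x + y) ms) \<noteq> 0" for ks ms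
    proof -
      have "w' (modes is ks x ms) \<noteq> 0 \<or> w' (modes is ks y ms) \<noteq> 0"
        using that(2) by (auto simp: modes_simps[OF "is"] dual_simps[OF w'])
      then show ?thesis using x_deg y_deg that(1) by blast
    qed
    ultimately show ?case
      by (intro exI[of _ "(\<lambda>s::int. n + of_int s + ?c) -` F \<union> S"]) blast
  qed
qed

text \<open>An oversized power of the logarithm at the outer field is killed by that field's own
  bound, whatever vector it meets; any other one lies in the tail.\<close>

lemma modes_log_bound:
  assumes "set is \<subseteq> I"
  shows "\<exists>N. \<forall>ks w ms. length ks = length is \<longrightarrow> \<not> set ks \<subseteq> {..N} \<longrightarrow> modes is ks w ms = 0"
  using assms
proof (induction "is")
  case (Cons i js)
  then obtain N where N: "\<And>ks w ms. length ks = length js \<Longrightarrow> \<not> set ks \<subseteq> {..N} \<Longrightarrow> modes js ks w ms = 0"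
    by auto
  from Cons.prems obtain K where K: "\<And>k r w. k \<ge> K \<Longrightarrow> phi i r k w = 0"
    using phi_log_bound[of i] by auto
  have "modes (i # js) ks w ms = 0"
    if ks: "length ks = length (i # js)" "\<not> set ks \<subseteq> {..max N K}" for ks w ms
  proof -
    obtain k ks' where k: "ks = k # ks'" "length ks' = length js" using ks by (auto simp: length_Suc_conv)
    show ?thesis
    proof (cases "k \<ge> K")
      case True
      then show ?thesis by (simp add: k mode_def K)
    next
      case False
      then have "\<not> set ks' \<subseteq> {..N}" using ks by (auto simp: k)
      then show ?thesis using Cons.prems N[of ks'] k by (simp add: mode_simps)
    qed
  qed
  then show ?case by blast
qed simp

text \<open>The exponents after position j determine the vector on which field j acts, and the field
  is truncated on that vector.\<close>

lemma modes_lower_truncated: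
  assumes "set is \<subseteq> I"
  shows "lower_truncated (length is) (modes is ks w)"
  using assms
proof (induction "is" arbitrary: ks)
  case Nil
  then show ?case by (simp add: lower_truncated_def)
next
  case (Cons i js)
  show ?case unfolding lower_truncated_def
  proof (intro allI impI)
    fix ms :: "int list" and j assume ms: "length ms = length (i # js) \<and> j < length (i # js)"
    show "\<exists>b. \<forall>ms'. length ms' = length (i # js) \<and> drop (Suc j) ms' = drop (Suc j) ms \<and> ms' ! j < b
        \<longrightarrow> modes (i # js) ks w ms' = 0"
    proof (cases j)
      case 0
      obtain b where "\<And>m k. m < b \<Longrightarrow> phi i (of_int m - al i) k (modes js (tl ks) w (tl ms)) = 0"
        using phi_truncation[of i] Cons.prems by (metis list.set_intros(1) subsetD)
      then show ?thesis using 0 ms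
        by (intro exI[of _ b]) (auto simp: mode_def length_Suc_conv)
    next
      case (Suc j')
      have "lower_truncated (length js) (modes js (tl ks) w)" using Cons by auto
      then obtain b where b: "\<And>ms'. length ms' = length js \<Longrightarrow>
          drop (Suc j') ms' = drop (Suc j') (tl ms) \<Longrightarrow> ms' ! j' < b \<Longrightarrow> modes js (tl ks) w ms' = 0"
        unfolding lower_truncated_def using Suc ms by (metis length_tl length_Cons diff_Suc_1 Suc_less_eq)
      have "modes (i # js) ks w ms' = 0" if "length ms' = length (i # js)"
        "drop (Suc j) ms' = drop (Suc j) ms" "ms' ! j < b" for ms'
        using that ms Cons.prems b[of "tl ms'"] Suc by (simp add: mode_simps drop_Suc nth_tl)
      then show ?thesis by blast
    qed
  qed
qed

definition exponents :: "'i list \<Rightarrow> int list \<Rightarrow> nat list \<Rightarrow> (complex \<times> nat) list" where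
  "exponents is ms ks = zip (map2 (\<lambda>m i. of_int m - al i) ms is) ks"

lemma foldr_exponents:
  assumes "length ms = length is" "length ks = length is"
  shows "foldr (\<lambda>(i, r, k) u. phi i r k u) (zip is (exponents is ms ks)) w = modes is ks w ms"
  using assms
proof (induction "is" arbitrary: ms ks)
  case (Cons i js)
  then obtain m ms' k ks' where "ms = m # ms'" "ks = k # ks'" by (auto simp: length_Suc_conv)
  with Cons show ?case by (auto simp: exponents_def mode_def)
qed simp

lemma product_term_exponents:
  assumes "length ms = length is" "length ks = length is" "length zs = length is" "0 \<notin> set zs"
  shows "product_term phi w' is w p zs (exponents is ms ks) =
    w' (modes is ks w ms) * monom_val zs ms *
      (\<Prod>j<length is. branch_monom p (- al (is ! j)) (ks ! j) (zs ! j))"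
proof -
  have "(\<Prod>j<length is. branch_monom p (fst (exponents is ms ks ! j)) (snd (exponents is ms ks ! j)) (zs ! j))
    = (\<Prod>j<length is. (zs ! j) powi (ms ! j) * branch_monom p (- al (is ! j)) (ks ! j) (zs ! j))"
  proof (intro prod.cong refl)
    fix j assume j: "j \<in> {..<length is}"
    then have "zs ! j \<noteq> 0" using assms by (metis lessThan_iff nth_mem)
    then show "branch_monom p (fst (exponents is ms ks ! j)) (snd (exponents is ms ks ! j)) (zs ! j) =
        (zs ! j) powi (ms ! j) * branch_monom p (- al (is ! j)) (ks ! j) (zs ! j)"
      using j assms by (simp add: exponents_def branch_monom_diff)
  qed
  then show ?thesis using assms
    by (simp add: product_term_def foldr_exponents prod.distrib monom_val_def)
qed

text \<open>A nonvanishing vector forces every power of the variables into \<open>- al i\<close>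
  plus an integer.\<close>

lemma foldr_nonzero_exponents:
  assumes "set is \<subseteq> I" "length es = length is"
    and "foldr (\<lambda>(i, r, k) u. phi i r k u) (zip is es) w \<noteq> 0"
  shows "\<exists>ms ks. length ms = length is \<and> length ks = length is \<and> es = exponents is ms ks"
  using assms
proof (induction "is" arbitrary: es)
  case (Cons i js)
  then obtain r k es' where es: "es = (r, k) # es'" "length es' = length js"
    by (cases es) auto
  let ?u = "foldr (\<lambda>(i, r, k) u. phi i r k u) (zip js es') w"
  have nz: "phi i r k ?u \<noteq> 0" using Cons.prems es by simp
  then have "?u \<noteq> 0" using Cons.prems by (auto simp: phi_simps)
  with Cons.IH[of es'] Cons.prems es obtain ms ks where
    mk: "length ms = length js" "length ks = length js" "es' = exponents js ms ks" by auto
  have "r + al i \<in> \<int>" using nz phi_powers Cons.prems by auto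
  then obtain m where "r = of_int m - al i" by (metis Ints_cases add_diff_cancel_right')
  with mk es show ?case
    by (intro exI[of _ "m # ms"] exI[of _ "k # ks"]) (simp add: exponents_def)
qed (simp add: exponents_def)

lemma exponents_inj:
  assumes "length ms = length is" "length ks = length is" "length ms' = length is" "length ks' = length is"
    and "exponents is ms ks = exponents is ms' ks'"
  shows "ms = ms' \<and> ks = ks'"
  using assms
proof (induction "is" arbitrary: ms ks ms' ks')
  case (Cons i js)
  then obtain m1 ms1 k1 ks1 m2 ms2 k2 ks2
    where "ms = m1 # ms1" "ks = k1 # ks1" "ms' = m2 # ms2" "ks' = k2 # ks2"
    by (metis length_Suc_conv length_Cons)
  with Cons show ?case by (auto simp: exponents_def)
qed simp

text \<open>Sorting the exponents by their powers of logarithms splits the series into Laurent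
  series, one for each \<open>ks\<close>. Only finitely many are nonzero, and on each of them the
  logarithmic factor is constant.\<close>

lemma has_sum_product_term:
  assumes "is": "set is \<subseteq> I" and zs: "length zs = length is" "0 \<notin> set zs"
    and w': "w' \<in> graded_dual sW G"
    and N: "\<And>ks ms. length ks = length is \<Longrightarrow> \<not> set ks \<subseteq> {..N} \<Longrightarrow> modes is ks w ms = 0"
    and sums: "\<And>ks. ks \<in> log_exponents (length is) N \<Longrightarrow>
       ((\<lambda>ms. w' (modes is ks w ms) * monom_val zs ms) has_sum s ks) {ms. length ms = length is}"
  shows "(product_term phi w' is w p zs has_sum
      (\<Sum>ks\<in>log_exponents (length is) N. s ks *
         (\<Prod>j<length is. branch_monom p (- al (is ! j)) (ks ! j) (zs ! j)))) {es. length es = length is}"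
proof -
  let ?k = "length is"
  let ?L = "{ms :: int list. length ms = ?k}"
  let ?t = "product_term phi w' is w p zs"
  let ?b = "\<lambda>ks. \<Prod>j<?k. branch_monom p (- al (is ! j)) (ks ! j) (zs ! j)"
  define E where "E ks = (\<lambda>ms. exponents is ms ks) ` ?L" for ks
  have len: "length es = ?k" if "es \<in> E ks" "length ks = ?k" for es ks
    using that by (auto simp: E_def exponents_def)
  have part: "((\<lambda>es. if es \<in> E ks then ?t es else 0) has_sum s ks * ?b ks) {es. length es = ?k}"
    if ks: "ks \<in> log_exponents ?k N" for ks
  proof -
    have lk: "length ks = ?k" using ks by (simp add: log_exponents_def)
    have "inj_on (\<lambda>ms. exponents is ms ks) ?L"
      using exponents_inj lk by (auto simp: inj_on_def)
    moreover have "((\<lambda>ms. ?t (exponents is ms ks)) has_sum s ks * ?b ks) ?L"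
      using has_sum_cmult_left[OF sums[OF ks], of "?b ks"]
      by (rule has_sum_cong[THEN iffD1, rotated]) (simp add: product_term_exponents zs lk)
    ultimately have "(?t has_sum s ks * ?b ks) (E ks)"
      unfolding E_def by (simp add: has_sum_reindex o_def)
    then show ?thesis
      by (rule has_sum_cong_neutral[THEN iffD1, rotated -1]) (auto dest: len[OF _ lk])
  qed
  \<comment> \<open>A term with nonvanishing vector lies in exactly one class \<open>E ks\<close>,
    and \<open>N\<close> keeps this \<open>ks\<close> within the range of summation.\<close>
  have total: "(\<Sum>ks\<in>log_exponents ?k N. if es \<in> E ks then ?t es else 0) = ?t es"
    if es: "length es = ?k" for es
  proof (cases "foldr (\<lambda>(i, r, k) u. phi i r k u) (zip is es) w = 0")
    case True
    then have "?t es = 0" unfolding product_term_def by (simp only: dual_simps(1)[OF w'] mult_zero_left)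
    then show ?thesis by (simp cong: if_cong)
  next
    case False
    from foldr_nonzero_exponents[OF "is" es False] obtain ms ks where
      mk: "length ms = ?k" "length ks = ?k" "es = exponents is ms ks" by blast
    have "modes is ks w ms \<noteq> 0" using False unfolding mk(3) foldr_exponents[OF mk(1,2)] .
    then have "set ks \<subseteq> {..N}" using N[OF mk(2)] by blast
    then have ks: "ks \<in> log_exponents ?k N" using mk(2) by (simp add: log_exponents_def)
    have iff: "es \<in> E ks' \<longleftrightarrow> ks' = ks" if "ks' \<in> log_exponents ?k N" for ks'
    proof
      assume "es \<in> E ks'"
      then obtain ms' where "length ms' = ?k" "es = exponents is ms' ks'" by (auto simp: E_def)
      then show "ks' = ks"
        using that mk exponents_inj[of ms' "is" ks' ms ks] by (simp add: log_exponents_def)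
    next
      assume "ks' = ks"
      then show "es \<in> E ks'" using mk(1,3) by (auto simp: E_def)
    qed
    have "(\<Sum>ks'\<in>log_exponents ?k N. if es \<in> E ks' then ?t es else 0) =
        (\<Sum>ks'\<in>log_exponents ?k N. if ks' = ks then ?t es else 0)"
      by (intro sum.cong) (simp_all add: iff)
    also have "\<dots> = ?t es" using ks by (simp add: finite_log_exponents)
    finally show ?thesis .
  qed
  have "((\<lambda>es. \<Sum>ks\<in>log_exponents ?k N. if es \<in> E ks then ?t es else 0) has_sum
     (\<Sum>ks\<in>log_exponents ?k N. s ks * ?b ks)) {es. length es = ?k}"
    by (rule has_sum_finite_sum) (rule part)
  then show ?thesis
    by (rule has_sum_cong[THEN iffD1, rotated]) (simp add: total)
qed

text \<open>A fixed \<open>ks\<close> selects a subfamily of a summable complex family; its common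
  factor \<open>b\<close> can be divided out because no logarithm vanishes.\<close>

lemma summable_modes:
  assumes "is": "set is \<subseteq> I" and zs: "length zs = length is" "0 \<notin> set zs"
    and lp: "\<And>z. z \<in> set zs \<Longrightarrow> lp p z \<noteq> 0"
    and sum: "product_term phi w' is w p zs summable_on {es. length es = length is}"
    and ks: "length ks = length is"
  shows "(\<lambda>ms. w' (modes is ks w ms) * monom_val zs ms) summable_on {ms. length ms = length is}"
proof -
  let ?k = "length is"
  let ?L = "{ms :: int list. length ms = ?k}"
  let ?t = "product_term phi w' is w p zs"
  define b where "b = (\<Prod>j<?k. branch_monom p (- al (is ! j)) (ks ! j) (zs ! j))"
  have "lp p (zs ! j) \<noteq> 0" if "j < ?k" for j using lp that zs(1) by simp
  then have "b \<noteq> 0" by (simp add: branch_monom_def b_def)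
  then have b: "x * b * inverse b = x" for x by simp
  have "?t summable_on (\<lambda>ms. exponents is ms ks) ` ?L"
    by (rule summable_on_subset[OF sum]) (auto simp: exponents_def ks)
  moreover have "inj_on (\<lambda>ms. exponents is ms ks) ?L"
    using exponents_inj ks by (auto simp: inj_on_def)
  ultimately have "(\<lambda>ms. ?t (exponents is ms ks)) summable_on ?L"
    using summable_on_reindex[of "\<lambda>ms. exponents is ms ks" ?L ?t] by (simp only: o_def)
  then have "(\<lambda>ms. (w' (modes is ks w ms) * monom_val zs ms) * b) summable_on ?L"
    by (subst (asm) summable_on_cong[where g = "\<lambda>ms. (w' (modes is ks w ms) * monom_val zs ms) * b"])
       (simp_all add: product_term_exponents zs ks b_def)
  then have "(\<lambda>ms. (w' (modes is ks w ms) * monom_val zs ms) * b * inverse b) summable_on ?L"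
    by (rule summable_on_cmult_left)
  then show ?thesis unfolding b .
qed

end

subsection \<open>Rationality\<close>

text \<open>Two-variable form of \<open>times_diff 0 1\<close>; with integer indices
  \<open>times_x1_minus_x2\<close> acts in the same way.\<close>

definition shift_diff :: "(int \<Rightarrow> int \<Rightarrow> 'a::ab_group_add) \<Rightarrow> int \<Rightarrow> int \<Rightarrow> 'a" where
  "shift_diff X m n = X (m - 1) n - X m (n - 1)"

lemma times_diff_funpow_shift_diff:
  "(times_diff 0 1 ^^ N) X (m # n # ms) = (shift_diff ^^ N) (\<lambda>m n. X (m # n # ms)) m n"
proof (induction N arbitrary: m n)
  case (Suc N)
  then show ?case by (simp add: times_diff_def shift_diff_def)
qed simp

text \<open>The partners of a new leftmost field, with multiplicities. Positions are relative to the
  tail, so \<open>pole_pairs\<close> shifts them by one.\<close>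

primrec row_pairs :: "('i \<Rightarrow> 'i \<Rightarrow> nat) \<Rightarrow> 'i \<Rightarrow> 'i list \<Rightarrow> nat list" where
  "row_pairs M i [] = []"
| "row_pairs M i (j # js) = replicate (M i j) 0 @ map Suc (row_pairs M i js)"

text \<open>Lists the pair \<open>(l, j)\<close>, \<open>l < j\<close>, with multiplicity \<open>M (is ! l) (is ! j)\<close>.\<close>

primrec pole_pairs :: "('i \<Rightarrow> 'i \<Rightarrow> nat) \<Rightarrow> 'i list \<Rightarrow> (nat \<times> nat) list" where
  "pole_pairs M [] = []"
| "pole_pairs M (i # js) =
     map (\<lambda>n. (0, Suc n)) (row_pairs M i js) @ map (map_prod Suc Suc) (pole_pairs M js)"

lemma row_pairs_less: "n \<in> set (row_pairs M i js) \<Longrightarrow> n < length js"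
  by (induction js arbitrary: n) (auto simp: set_replicate_conv_if split: if_splits)

lemma pole_pairs_less: "(l, j) \<in> set (pole_pairs M is) \<Longrightarrow> l < j \<and> j < length is"
  by (induction "is" arbitrary: l j) (auto dest: row_pairs_less)

lemma prod_row_pairs:
  "length zs = length js \<Longrightarrow>
   (\<Prod>n\<leftarrow>row_pairs M i js. z - zs ! n) = (\<Prod>n<length js. (z - zs ! n :: complex) ^ M i (js ! n))"
proof (induction js arbitrary: zs)
  case (Cons j js)
  then obtain z' zs' where zs: "zs = z' # zs'" "length zs' = length js" by (auto simp: length_Suc_conv)
  have "(\<Prod>n\<leftarrow>map Suc (row_pairs M i js). z - zs ! n) = (\<Prod>n\<leftarrow>row_pairs M i js. z - zs' ! n)"
    by (simp add: zs o_def)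
  then show ?case using Cons.IH[OF zs(2)]
    by (simp add: zs prod.lessThan_Suc_shift prod_list_replicate map_replicate_const[symmetric] o_def
        del: prod.lessThan_Suc)
qed simp

lemma prod_pole_pairs:
  "length zs = length is \<Longrightarrow>
   (\<Prod>(l, j)\<leftarrow>pole_pairs M is. zs ! l - zs ! j) =
   (\<Prod>j<length is. \<Prod>l<j. (zs ! l - zs ! j :: complex) ^ M (is ! l) (is ! j))"
proof (induction "is" arbitrary: zs)
  case (Cons i js)
  then obtain z zs' where zs: "zs = z # zs'" "length zs' = length js" by (auto simp: length_Suc_conv)
  have "(\<Prod>(l, j)\<leftarrow>map (map_prod Suc Suc) (pole_pairs M js). zs ! l - zs ! j) =
        (\<Prod>(l, j)\<leftarrow>pole_pairs M js. zs' ! l - zs' ! j)"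
    by (simp add: zs o_def case_prod_unfold)
  moreover have "(\<Prod>(l, j)\<leftarrow>map (\<lambda>n. (0, Suc n)) (row_pairs M i js). zs ! l - zs ! j) =
        (\<Prod>n\<leftarrow>row_pairs M i js. z - zs' ! n)"
    by (simp add: zs o_def)
  ultimately show ?case using Cons.IH[OF zs(2)] prod_row_pairs[OF zs(2), of z M i]
    by (simp add: zs prod.lessThan_Suc_shift prod.distrib o_def del: prod.lessThan_Suc)
qed simp

text \<open>All other entries are at least \<open>c\<close>; since \<open>c\<close> is nonpositive,
  one more \<open>c\<close> may be added for \<open>x\<close> itself, which gives the plain factor
  \<open>length ms\<close>.\<close>

lemma sum_list_ge:
  fixes ms :: "int list"
  assumes "\<And>x. x \<in> set ms \<Longrightarrow> c \<le> x" "c \<le> 0" "x \<in> set ms"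
  shows "x + int (length ms) * c \<le> sum_list ms"
proof -
  have ge: "int (length ms) * c \<le> sum_list ms" if "\<And>x. x \<in> set ms \<Longrightarrow> c \<le> x" for ms
    using that
  proof (induction ms)
    case (Cons y ms)
    then have "c \<le> y" "int (length ms) * c \<le> sum_list ms" by auto
    then show ?case by (simp add: algebra_simps)
  qed simp
  show ?thesis using assms
  proof (induction ms)
    case (Cons y ms)
    then show ?case using ge[of ms] by (force simp: algebra_simps)
  qed simp
qed

text \<open>Entries bounded below whose sum is bounded above are themselves bounded above, so the
  lists have entries in a finite interval.\<close>

lemma finite_int_lists_bounded:
  fixes c :: "nat \<Rightarrow> int"
  assumes "finite S"
  shows "finite {ms. length ms = k \<and> (\<forall>j<k. c j \<le> ms ! j) \<and> sum_list ms \<in> S}"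
proof -
  \<comment> \<open>Inserting 0 makes the common lower bound nonpositive, as
    \<open>sum_list_ge\<close> requires.\<close>
  define lo where "lo = Min (insert 0 (c ` {..<k}))"
  define hi where "hi = Max (insert 0 S) - int k * lo"
  have lo: "lo \<le> 0" "j < k \<Longrightarrow> lo \<le> c j" for j by (simp_all add: lo_def)
  have "set ms \<subseteq> {lo..hi}"
    if "length ms = k" "\<forall>j<k. c j \<le> ms ! j" "sum_list ms \<in> S" for ms
  proof
    fix x assume x: "x \<in> set ms"
    have ge: "lo \<le> y" if "y \<in> set ms" for y
      using that \<open>length ms = k\<close> \<open>\<forall>j<k. c j \<le> ms ! j\<close> lo(2) by (force simp: in_set_conv_nth)
    have "sum_list ms \<le> Max (insert 0 S)" using that assms by simp
    with sum_list_ge[OF ge lo(1) x] have "x \<le> hi" using that by (simp add: hi_def)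
    with ge[OF x] show "x \<in> {lo..hi}" by simp
  qed
  then show ?thesis
    by (intro finite_subset[OF _ finite_lists_length_eq[of "{lo..hi}" k]]) auto
qed

text \<open>Different indices may give the same exponent list, so their coefficients have to be
  collected.\<close>

lemma polynomial_fun_sum:
  assumes "finite F" "\<And>x. x \<in> F \<Longrightarrow> length (g x) = k"
  shows "polynomial_fun k (\<lambda>zs. \<Sum>x\<in>F. d x * (\<Prod>j<k. (zs ! j) ^ (g x ! j :: nat)))"
  unfolding polynomial_fun_def
proof (intro exI[of _ "g ` F"] exI[of _ "\<lambda>e. \<Sum>x | x \<in> F \<and> g x = e. d x"] conjI allI impI)
  fix zs :: "complex list"
  have "(\<Sum>x\<in>F. d x * (\<Prod>j<k. (zs ! j) ^ (g x ! j))) =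
     (\<Sum>e\<in>g ` F. \<Sum>x | x \<in> F \<and> g x = e. d x * (\<Prod>j<k. (zs ! j) ^ (g x ! j)))"
    by (rule sum.image_gen[OF assms(1)])
  also have "\<dots> = (\<Sum>e\<in>g ` F. (\<Sum>x | x \<in> F \<and> g x = e. d x) * (\<Prod>j<k. (zs ! j) ^ (e ! j)))"
    unfolding sum_distrib_right by (intro sum.cong) auto
  finally show "(\<Sum>x\<in>F. d x * (\<Prod>j<k. (zs ! j) ^ (g x ! j))) =
     (\<Sum>e\<in>g ` F. (\<Sum>x | x \<in> F \<and> g x = e. d x) * (\<Prod>j<k. (zs ! j) ^ (e ! j)))" .
qed (use assms in auto)

lemma rational_fun_laurent:
  assumes F: "finite F" "\<And>ms. ms \<in> F \<Longrightarrow> length ms = k \<and> (\<forall>j<k. ms ! j + int (a j) \<ge> 0)"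
  shows "rational_fun k a b (\<lambda>zs. (\<Sum>ms\<in>F. d ms * monom_val zs ms) /
           (\<Prod>j<k. \<Prod>i<j. (zs ! i - zs ! j) ^ b i j))"
proof -
  define g where "g ms = map (\<lambda>j. nat (ms ! j + int (a j))) [0..<k]" for ms :: "int list"
  let ?P = "\<lambda>zs. \<Sum>ms\<in>F. d ms * (\<Prod>j<k. (zs ! j) ^ (g ms ! j))"
  have "polynomial_fun k ?P" by (rule polynomial_fun_sum[OF F(1)]) (simp add: g_def)
  moreover have "(\<Sum>ms\<in>F. d ms * monom_val zs ms) = ?P zs / (\<Prod>j<k. (zs ! j) ^ a j)"
    if zs: "length zs = k" "off_poles zs" for zs
  proof -
    have "monom_val zs ms = (\<Prod>j<k. (zs ! j) ^ (g ms ! j)) / (\<Prod>j<k. (zs ! j) ^ a j)"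
      if ms: "ms \<in> F" for ms
    proof -
      have "(zs ! j) powi (ms ! j) = (zs ! j) ^ (g ms ! j) / (zs ! j) ^ a j" if j: "j < k" for j
      proof -
        have nz: "zs ! j \<noteq> 0" using zs j by (auto simp: off_poles_def in_set_conv_nth)
        have "(zs ! j) ^ (g ms ! j) = (zs ! j) powi (ms ! j + int (a j))"
          using F(2)[OF ms] j by (simp add: g_def power_int_def)
        then show ?thesis using nz by (simp add: power_int_add)
      qed
      then show ?thesis using zs by (simp add: monom_val_def prod_dividef)
    qed
    then show ?thesis by (simp add: sum_divide_distrib)
  qed
  ultimately show ?thesis unfolding rational_fun_def
    by (intro exI[of _ ?P]) (simp add: field_simps)
qed

section \<open>Weak commutativity bounds the exponents from below\<close>

context graded_modes
begin

text \<open>A general scalar \<open>c\<close> stands in the place of the sign; the exponents are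
  integers because \<open>mode\<close> absorbs the shift by \<open>al\<close>.\<close>

definition weakly_commute :: "nat \<Rightarrow> complex \<Rightarrow> 'i \<Rightarrow> 'i \<Rightarrow> bool" where
  "weakly_commute N c i j \<longleftrightarrow> (\<forall>k l w.
     (shift_diff ^^ N) (\<lambda>m n. mode i m k (mode j n l w)) =
     (shift_diff ^^ N) (\<lambda>m n. sW c (mode j n l (mode i m k w))))"

text \<open>Weak commutativity moves the first field past all the others, next to \<open>w\<close>.\<close>

lemma row_pairs_vanish:
  assumes "i \<in> I" "set js \<subseteq> I" and comm: "\<And>j. j \<in> I \<Longrightarrow> \<exists>c. weakly_commute (M i j) c i j"
    and trunc: "\<And>m k. m < b \<Longrightarrow> mode i m k w = 0"
    and "length ms = length js" "m < b"
  shows "times_diffs (map (\<lambda>n. (0, Suc n)) (row_pairs M i js)) (modes (i # js) ks w) (m # ms) = 0"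
  using assms(2,5,6)
proof (induction js arbitrary: ks ms m)
  case Nil
  then show ?case by (simp add: trunc)
next
  case (Cons j js)
  then obtain m1 ms' where ms: "ms = m1 # ms'" "length ms' = length js" by (auto simp: length_Suc_conv)
  have j: "j \<in> I" and js: "set js \<subseteq> I" using Cons.prems by auto
  obtain c where c: "weakly_commute (M i j) c i j" using comm[OF j] by blast
  let ?k = "hd ks" and ?l = "hd (tl ks)" and ?u = "modes js (tl (tl ks)) w"
  let ?R1 = "map (\<lambda>n. (0, Suc n)) (row_pairs M i js)"
  let ?R2 = "map (\<lambda>n. (0, Suc (Suc n))) (row_pairs M i js)"
  let ?R0 = "replicate (M i j) (0, 1)"
  define X where "X = modes (i # j # js) ks w"
  \<comment> \<open>The product with \<open>i\<close> and \<open>j\<close> interchanged; after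
    multiplication with the factors \<open>?R0\<close> it agrees with \<open>X\<close>.\<close>
  define X' where "X' ms = sW c (mode j (hd (tl ms)) ?l (mode i (hd ms) ?k (?u (tl (tl ms)))))" for ms
  have split: "map (\<lambda>n. (0, Suc n)) (row_pairs M i (j # js)) = ?R0 @ ?R2"
    by (simp add: o_def)
  have swap: "times_diffs ?R0 X ms = times_diffs ?R0 X' ms" if len: "length ms = Suc (Suc (length js))" for ms
  proof -
    obtain m n ms' where "ms = m # n # ms'" using len by (auto simp: length_Suc_conv)
    then show ?thesis
      using c unfolding weakly_commute_def times_diffs_replicate One_nat_def[symmetric]
      by (simp only: times_diff_funpow_shift_diff X_def X'_def modes.simps list.sel)
  qed
  \<comment> \<open>In \<open>X'\<close> the mode of \<open>j\<close> is outermost, with an exponent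
    that \<open>?R2\<close> does not touch, so the induction hypothesis applies inside it.\<close>
  have vanish: "times_diffs ?R2 X' ms = 0" if len: "length ms = Suc (Suc (length js))" and "ms ! 0 < b" for ms
  proof -
    obtain m n ms' where ms: "ms = m # n # ms'" "length ms' = length js"
      using len by (auto simp: length_Suc_conv)
    have "times_diffs ?R2 X' ms = times_diffs ?R1 (\<lambda>ms. X' (hd ms # n # tl ms)) (m # ms')"
      by (simp add: ms times_diffs_skip)
    also have "\<dots> = times_diffs ?R1
        (\<lambda>ms. sW c (mode j n ?l (modes (i # js) (?k # tl (tl ks)) w ms))) (m # ms')"
      by (simp add: X'_def)
    also have "\<dots> = sW c (mode j n ?l (times_diffs ?R1 (modes (i # js) (?k # tl (tl ks)) w) (m # ms')))"
      by (rule times_diffs_linear) (simp add: mode_simps j scale_right_diff_distrib)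
    also have "times_diffs ?R1 (modes (i # js) (?k # tl (tl ks)) w) (m # ms') = 0"
      using that ms by (intro Cons.IH[OF js ms(2)]) simp
    finally show ?thesis by (simp only: mode_simps(1)[OF j] scale_zero_right)
  qed
  \<comment> \<open>\<open>?R0\<close> acts first to permit the interchange; as the factors commute,
    it can then be moved last, where it preserves vanishing below \<open>b\<close>.\<close>
  have "times_diffs (?R0 @ ?R2) X (m # ms) = times_diffs ?R2 (times_diffs ?R0 X') (m # ms)"
    unfolding times_diffs_simps
    by (rule times_diffs_cong[where k = "Suc (Suc (length js))"]) (use swap ms in auto)
  also have "\<dots> = times_diffs ?R0 (times_diffs ?R2 X') (m # ms)"
    by (simp only: times_diffs_swap)
  also have "\<dots> = 0"
    by (rule times_diffs_vanish_below[where k = "Suc (Suc (length js))" and l = 0 and c = b])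
       (use vanish ms Cons.prems in auto)
  finally show ?case by (simp only: split X_def)
qed

text \<open>For \<open>l = 0\<close> the factors of the first row move the first field next to
  \<open>w\<close>. For a later \<open>l\<close> the first field stays outermost and the factors
  without \<open>x_0\<close> act inside it, where the induction hypothesis applies. In either case
  the remaining factors preserve vanishing.\<close>

lemma pole_pairs_vanish:
  assumes "set is \<subseteq> I"
    and comm: "\<And>i j. i \<in> I \<Longrightarrow> j \<in> I \<Longrightarrow> \<exists>c. weakly_commute (M i j) c i j"
    and trunc: "\<And>i m k. i \<in> I \<Longrightarrow> m < b i \<Longrightarrow> mode i m k w = 0"
    and "length ms = length is" "l < length is" "ms ! l < b (is ! l)"
  shows "times_diffs (pole_pairs M is) (modes is ks w) ms = 0"
  using assms(1,4-)
proof (induction "is" arbitrary: ks ms l)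
  case (Cons i js)
  have i: "i \<in> I" and js: "set js \<subseteq> I" using Cons.prems by auto
  let ?X = "modes (i # js) ks w"
  let ?P1 = "map (\<lambda>n. (0, Suc n)) (row_pairs M i js)"
  let ?P2 = "map (map_prod Suc Suc) (pole_pairs M js)"
  have "times_diffs ?P2 (times_diffs ?P1 ?X) ms = 0"
  proof (cases l)
    case 0
    have "times_diffs ?P1 ?X ms = 0" if len: "length ms = length (i # js)" and "ms ! 0 < b i" for ms
    proof -
      obtain m ms' where ms: "ms = m # ms'" "length ms' = length js"
        using len by (auto simp: length_Suc_conv)
      show ?thesis unfolding ms(1)
        by (rule row_pairs_vanish[where b = "b i"]) (use i js ms that comm trunc in auto)
    qed
    then show ?thesis
      by (rule times_diffs_vanish_below) (use Cons.prems 0 in auto)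
  next
    case (Suc l')
    have "times_diffs ?P2 ?X ms = 0" if len: "length ms = length (i # js)" and "ms ! l < b (js ! l')" for ms
    proof -
      obtain m ms' where ms: "ms = m # ms'" "length ms' = length js"
        using len by (auto simp: length_Suc_conv)
      have "times_diffs ?P2 ?X ms =
          times_diffs (pole_pairs M js) (\<lambda>ms. mode i m (hd ks) (modes js (tl ks) w ms)) ms'"
        by (simp add: ms times_diffs_shift)
      also have "\<dots> = mode i m (hd ks) (times_diffs (pole_pairs M js) (modes js (tl ks) w) ms')"
        by (rule times_diffs_linear) (simp add: mode_simps i)
      also have "\<dots> = 0"
        using Cons.IH[OF js ms(2), of l' "tl ks"] that Cons.prems(3) by (simp add: ms Suc mode_simps i)
      finally show ?thesis .
    qed
    then have "times_diffs ?P1 (times_diffs ?P2 ?X) ms = 0"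
      by (rule times_diffs_vanish_below) (use Cons.prems Suc in auto)
    then show ?thesis by (simp only: times_diffs_swap)
  qed
  then show ?case by (simp only: pole_pairs.simps times_diffs_simps)
qed simp

text \<open>The order of the pole at \<open>z_j = 0\<close> is controlled by truncation of field j
  on \<open>w\<close>, because each field can be brought next to \<open>w\<close>; the order at
  \<open>z_l = z_j\<close> is the multiplicity of that factor in \<open>pole_pairs\<close>.\<close>

lemma modes_sum_rational:
  assumes "is": "set is \<subseteq> I" and w': "w' \<in> graded_dual sW G"
    and comm: "\<And>i j. i \<in> I \<Longrightarrow> j \<in> I \<Longrightarrow> \<exists>c. weakly_commute (M i j) c i j"
    and trunc: "\<And>i m k. i \<in> I \<Longrightarrow> m < - int (a i) \<Longrightarrow> mode i m k w = 0"
  shows "\<exists>f. rational_fun (length is) (\<lambda>j. a (is ! j)) (\<lambda>l j. M (is ! l) (is ! j)) f \<and>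
    (\<forall>zs. length zs = length is \<and> radially_ordered zs \<longrightarrow>
      ((\<lambda>ms. w' (modes is ks w ms) * monom_val zs ms) has_sum f zs) {ms. length ms = length is})"
proof -
  let ?k = "length is"
  let ?L = "{ms :: int list. length ms = ?k}"
  let ?ps = "pole_pairs M is"
  define P where "P = times_diffs ?ps (\<lambda>ms. w' (modes is ks w ms))"
  have P_eq: "P ms = w' (times_diffs ?ps (modes is ks w) ms)" for ms
    unfolding P_def by (rule times_diffs_linear) (rule dual_simps[OF w'])
  define F where "F = {ms \<in> ?L. P ms \<noteq> 0}"
  have F_ge: "ms ! j + int (a (is ! j)) \<ge> 0" if "ms \<in> F" "j < ?k" for ms j
    using pole_pairs_vanish[of "is" M "\<lambda>i. - int (a i)", OF "is" comm trunc, where ms = ms and l = j and ks = ks] that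
    by (force simp: F_def P_eq dual_simps[OF w'])
  have "finite F"
  proof -
    obtain S where S: "finite S"
      "\<And>ks ms. length ms = ?k \<Longrightarrow> w' (modes is ks w ms) \<noteq> 0 \<Longrightarrow> sum_list ms \<in> S"
      using modes_degrees[OF w' "is"] by blast
    have pairs: "l < ?k \<and> j < ?k" if "(l, j) \<in> set ?ps" for l j
      using pole_pairs_less[OF that] by auto
    have "sum_list ms \<in> (+) (int (length ?ps)) ` S" if "ms \<in> F" for ms
    proof -
      have "sum_list ms - int (length ?ps) \<in> S"
        by (rule times_diffs_degrees[where k = ?k and X = "\<lambda>ms. w' (modes is ks w ms)"])
           (use that S(2) pairs in \<open>auto simp: F_def P_def\<close>)
      then show ?thesis by (rule image_eqI[rotated]) simp
    qed
    then have "F \<subseteq> {ms. length ms = ?k \<and> (\<forall>j<?k. - int (a (is ! j)) \<le> ms ! j) \<and>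
        sum_list ms \<in> (+) (int (length ?ps)) ` S}"
      using F_ge by (force simp: F_def)
    then show ?thesis by (rule finite_subset) (rule finite_int_lists_bounded, use S in simp)
  qed
  define f where "f zs = (\<Sum>ms\<in>F. P ms * monom_val zs ms) /
           (\<Prod>j<?k. \<Prod>l<j. (zs ! l - zs ! j) ^ M (is ! l) (is ! j))" for zs
  have "rational_fun ?k (\<lambda>j. a (is ! j)) (\<lambda>l j. M (is ! l) (is ! j)) f"
    unfolding f_def[abs_def] using \<open>finite F\<close> F_ge by (intro rational_fun_laurent) (auto simp: F_def)
  moreover have "((\<lambda>ms. w' (modes is ks w ms) * monom_val zs ms) has_sum f zs) ?L"
    if zs: "length zs = ?k" "radially_ordered zs" for zs
  proof -
    have "((\<lambda>ms. P ms * monom_val zs ms) has_sum (\<Sum>ms\<in>F. P ms * monom_val zs ms)) ?L"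
      using \<open>finite F\<close> by (intro has_sum_finite_neutralI[where B = F]) (auto simp: F_def)
    moreover have "lower_truncated ?k (\<lambda>ms. w' (modes is ks w ms))"
      using modes_lower_truncated[OF "is", of ks w] dual_simps(1)[OF w']
      unfolding lower_truncated_def by metis
    ultimately show ?thesis
      unfolding f_def prod_pole_pairs[OF zs(1), symmetric] P_def
      using zs pole_pairs_less by (intro has_sum_divide_diffs) blast+
  qed
  ultimately show ?thesis by blast
qed

lemma weakly_commute_rationality:
  assumes comm: "\<And>i j. i \<in> I \<Longrightarrow> j \<in> I \<Longrightarrow> \<exists>c. weakly_commute (M i j) c i j"
  shows "\<exists>A. \<forall>w'\<in>graded_dual sW G. \<forall>w is. set is \<subseteq> I \<longrightarrow>
    (\<forall>p zs. length zs = length is \<and> radially_ordered zs \<longrightarrow>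
       (\<lambda>es. norm (product_term phi w' is w p zs es)) summable_on {es. length es = length is}) \<and>
    (\<exists>N f. correlation_function al phi w' is w N f \<and>
       (\<forall>ks\<in>log_exponents (length is) N.
          rational_fun (length is) (\<lambda>j. A (is ! j) w) (\<lambda>l j. M (is ! l) (is ! j)) (f ks)))"
proof -
  have "\<exists>n. \<forall>m k. m < - int n \<longrightarrow> mode i m k w = 0" if i: "i \<in> I" for i w
  proof -
    obtain m0 where "\<And>m k. m < m0 \<Longrightarrow> mode i m k w = 0"
      using phi_truncation[OF i] unfolding mode_def by blast
    then show ?thesis by (intro exI[of _ "nat (- m0)"]) auto
  qed
  \<comment> \<open>\<open>A i w\<close> is a truncation order of one field on \<open>w\<close>, so
    it involves neither the other fields nor \<open>w'\<close>.\<close>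
  then obtain A where A: "\<And>i w m k. i \<in> I \<Longrightarrow> m < - int (A i w) \<Longrightarrow> mode i m k w = 0"
    by metis
  show ?thesis
  proof (intro exI[of _ A] ballI allI impI)
    fix w' w "is" assume w': "w' \<in> graded_dual sW G" and "is": "set is \<subseteq> I"
    let ?k = "length is"
    obtain N where N: "\<And>ks w ms. length ks = ?k \<Longrightarrow> \<not> set ks \<subseteq> {..N} \<Longrightarrow> modes is ks w ms = 0"
      using modes_log_bound[OF "is"] by blast
    have "\<forall>ks. \<exists>f. rational_fun ?k (\<lambda>j. A (is ! j) w) (\<lambda>l j. M (is ! l) (is ! j)) f \<and>
      (\<forall>zs. length zs = ?k \<and> radially_ordered zs \<longrightarrow>
        ((\<lambda>ms. w' (modes is ks w ms) * monom_val zs ms) has_sum f zs) {ms. length ms = ?k})"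
      by (intro allI modes_sum_rational[OF "is" w']) (use comm A in blast)+
    from choice[OF this] obtain f where f:
      "\<And>ks. rational_fun ?k (\<lambda>j. A (is ! j) w) (\<lambda>l j. M (is ! l) (is ! j)) (f ks)"
      "\<And>ks zs. length zs = ?k \<Longrightarrow> radially_ordered zs \<Longrightarrow>
        ((\<lambda>ms. w' (modes is ks w ms) * monom_val zs ms) has_sum f ks zs) {ms. length ms = ?k}"
      by blast
    have sum: "(product_term phi w' is w p zs has_sum F_branch al is N f p zs) {es. length es = ?k}"
      if "length zs = ?k" "radially_ordered zs" for p zs
      unfolding F_branch_def
      by (rule has_sum_product_term[OF "is" _ _ w' N]) (use that f(2) in \<open>auto simp: radially_ordered_def\<close>)
    then have "(\<lambda>es. norm (product_term phi w' is w p zs es)) summable_on {es. length es = ?k}"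
      if "length zs = ?k" "radially_ordered zs" for p zs
      using that has_sum_imp_summable by (subst summable_on_iff_abs_summable_on_complex[symmetric]) blast
    moreover have "correlation_function al phi w' is w N f"
      unfolding correlation_function_def using f(1) sum by blast
    ultimately show "(\<forall>p zs. length zs = ?k \<and> radially_ordered zs \<longrightarrow>
       (\<lambda>es. norm (product_term phi w' is w p zs es)) summable_on {es. length es = ?k}) \<and>
      (\<exists>N f. correlation_function al phi w' is w N f \<and>
       (\<forall>ks\<in>log_exponents ?k N.
          rational_fun ?k (\<lambda>j. A (is ! j) w) (\<lambda>l j. M (is ! l) (is ! j)) (f ks)))"
      using f(1) by blast
  qed
qed

end

subsection \<open>Coefficients of two-point functions\<close>

lemma sum_log_exponents_2:
  "sum g (log_exponents 2 N) = (\<Sum>k\<le>N. \<Sum>l\<le>N. g [k, l])"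
proof -
  have "log_exponents 2 N = (\<lambda>(k, l). [k, l]) ` ({..N} \<times> {..N})"
    by (auto simp: log_exponents_def numeral_2_eq_2 length_Suc_conv image_iff)
  moreover have "inj_on (\<lambda>(k, l). [k, l]) ({..N} \<times> {..N})"
    by (auto simp: inj_on_def)
  ultimately show ?thesis
    by (simp add: sum.reindex o_def case_prod_unfold sum.cartesian_product)
qed

lemma shift_diff_Suc:
  "(shift_diff ^^ Suc N) X m n = (shift_diff ^^ N) X (m - 1) n - (shift_diff ^^ N) X m (n - 1)"
  unfolding funpow.simps o_apply by (rule shift_diff_def)

lemma shift_diff_linear:
  assumes "\<And>a b. f (a - b) = f a - f b"
  shows "(shift_diff ^^ N) (\<lambda>m n. f (X m n)) = (\<lambda>m n. f ((shift_diff ^^ N) X m n))"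
  by (induction N) (simp_all add: shift_diff_def fun_eq_iff assms)

text \<open>Interchanging the variables changes the sign of each factor
  \<open>x_1 - x_2\<close>.\<close>

lemma shift_diff_swap:
  fixes X :: "int \<Rightarrow> int \<Rightarrow> complex"
  shows "(shift_diff ^^ N) (\<lambda>m n. X n m) m n = (-1) ^ N * (shift_diff ^^ N) X n m"
  by (induction N arbitrary: m n) (simp_all add: shift_diff_def algebra_simps)

lemma shift_diff_support:
  assumes "\<And>m n. X m n \<noteq> 0 \<Longrightarrow> m + n \<in> S \<and> b \<le> n" "(shift_diff ^^ N) X m n \<noteq> 0"
  shows "m + n - int N \<in> S \<and> b \<le> n"
  using assms(2)
proof (induction N arbitrary: m n)
  case (Suc N)
  then have "(shift_diff ^^ N) X (m - 1) n \<noteq> 0 \<or> (shift_diff ^^ N) X m (n - 1) \<noteq> 0"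
    by (auto simp: shift_diff_Suc simp del: funpow.simps)
  then show ?case using Suc.IH[of "m - 1" n] Suc.IH[of m "n - 1"] by (auto simp: algebra_simps)
qed (use assms(1) in simp)

lemma finite_shift_diff:
  assumes "finite {(m, n). X m n \<noteq> 0}"
  shows "finite {(m, n). (shift_diff ^^ N) X m n \<noteq> 0}"
proof (induction N)
  case (Suc N)
  let ?A = "{(m, n). (shift_diff ^^ N) X m n \<noteq> 0}"
  have "{(m, n). (shift_diff ^^ Suc N) X m n \<noteq> 0} \<subseteq>
      (\<lambda>(m, n). (m + 1, n)) ` ?A \<union> (\<lambda>(m, n). (m, n + 1)) ` ?A"
  proof clarify
    fix m n assume "(shift_diff ^^ Suc N) X m n \<noteq> 0"
      and no: "(m, n) \<notin> (\<lambda>(m, n). (m, n + 1)) ` ?A"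
    then have "(m - 1, n) \<in> ?A \<or> (m, n - 1) \<in> ?A" by (auto simp: shift_diff_Suc simp del: funpow.simps)
    with no show "(m, n) \<in> (\<lambda>(m, n). (m + 1, n)) ` ?A" by (force simp: image_iff)
  qed
  then show ?case using Suc by (meson finite_UnI finite_imageI finite_subset)
qed (use assms in simp)

lemma laurent_has_sum_shift_diff:
  assumes "laurent_has_sum X z1 z2 S" "z1 \<noteq> 0" "z2 \<noteq> 0"
  shows "laurent_has_sum ((shift_diff ^^ N) X) z1 z2 ((z1 - z2) ^ N * S)"
proof (induction N)
  case (Suc N)
  let ?X = "(shift_diff ^^ N) X" and ?S = "(z1 - z2) ^ N * S"
  have hs: "((\<lambda>(m, n). ?X m n * z1 powi m * z2 powi n) has_sum ?S) UNIV"
    using Suc by (simp add: laurent_has_sum_def)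
  have "((\<lambda>(m, n). ?X (m - 1) n * z1 powi (m - 1) * z2 powi n) has_sum ?S) UNIV"
    using hs by (subst has_sum_reindex_bij_witness[where i = "\<lambda>(m, n). (m + 1, n)"
        and j = "\<lambda>(m, n). (m - 1, n)" and T = UNIV and h = "\<lambda>(m, n). ?X m n * z1 powi m * z2 powi n"]) auto
  from has_sum_cmult_right[OF this, of z1]
  have 1: "((\<lambda>(m, n). ?X (m - 1) n * z1 powi m * z2 powi n) has_sum z1 * ?S) UNIV"
    by (rule has_sum_cong[THEN iffD1, rotated]) (use assms in \<open>auto simp: power_int_diff\<close>)
  have "((\<lambda>(m, n). ?X m (n - 1) * z1 powi m * z2 powi (n - 1)) has_sum ?S) UNIV"
    using hs by (subst has_sum_reindex_bij_witness[where i = "\<lambda>(m, n). (m, n + 1)"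
        and j = "\<lambda>(m, n). (m, n - 1)" and T = UNIV and h = "\<lambda>(m, n). ?X m n * z1 powi m * z2 powi n"]) auto
  from has_sum_cmult_right[OF this, of "- z2"]
  have 2: "((\<lambda>(m, n). - (?X m (n - 1) * z1 powi m * z2 powi n)) has_sum - z2 * ?S) UNIV"
    by (rule has_sum_cong[THEN iffD1, rotated]) (use assms in \<open>auto simp: power_int_diff\<close>)
  have "((\<lambda>(m, n). shift_diff ?X m n * z1 powi m * z2 powi n) has_sum z1 * ?S + - z2 * ?S) UNIV"
    using has_sum_add[OF 1 2]
    by (rule has_sum_cong[THEN iffD1, rotated]) (auto simp: shift_diff_def algebra_simps)
  then show ?case by (simp add: laurent_has_sum_def algebra_simps)
qed (use assms in simp)

lemma laurent_has_sum_swap: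
  "laurent_has_sum X z1 z2 S \<Longrightarrow> laurent_has_sum (\<lambda>m n. X n m) z2 z1 S"
  unfolding laurent_has_sum_def
  by (subst has_sum_reindex_bij_witness[where i = "\<lambda>(m, n). (n, m)"
        and j = "\<lambda>(m, n). (n, m)" and T = UNIV and h = "\<lambda>(m, n). X m n * z1 powi m * z2 powi n"])
     (auto simp: mult_ac)

lemma laurent_has_sum_cmult:
  "laurent_has_sum X z1 z2 S \<Longrightarrow> laurent_has_sum (\<lambda>m n. c * X m n) z1 z2 (c * S)"
  unfolding laurent_has_sum_def
  by (drule has_sum_cmult_right[where c = c]) (simp add: case_prod_unfold mult.assoc)

lemma laurent_has_sum_diff:
  assumes "laurent_has_sum X z1 z2 S" "laurent_has_sum Y z1 z2 T"
  shows "laurent_has_sum (\<lambda>m n. X m n - Y m n) z1 z2 (S - T)"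
  using has_sum_add[OF assms(1)[unfolded laurent_has_sum_def]
      laurent_has_sum_cmult[OF assms(2), of "- 1", unfolded laurent_has_sum_def]]
  by (simp add: laurent_has_sum_def case_prod_unfold algebra_simps)

text \<open>The diagonal pole is cleared by \<open>(z1 - z2) ^ b 0 1\<close>, and the powers of
  \<open>z1\<close> and \<open>z2\<close> in the denominator only shift exponents. Surplus factors
  up to \<open>B\<close> act on the coefficients by \<open>shift_diff\<close> and keep the support
  finite.\<close>

lemma rational_fun_2_laurent:
  assumes "rational_fun 2 a b f" "b 0 1 \<le> B"
  shows "\<exists>Q. finite {(m, n). Q m n \<noteq> 0} \<and> (\<forall>z1 z2. z1 \<noteq> 0 \<and> z2 \<noteq> 0 \<and> z1 \<noteq> z2 \<longrightarrow>
           laurent_has_sum Q z1 z2 ((z1 - z2) ^ B * f [z1, z2]))"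
proof -
  obtain P where P: "polynomial_fun 2 P"
    and f: "\<And>zs. length zs = 2 \<Longrightarrow> off_poles zs \<Longrightarrow> f zs = P zs /
      ((\<Prod>j<2. (zs ! j) ^ a j) * (\<Prod>j<2. \<Prod>i<j. (zs ! i - zs ! j) ^ b i j))"
    using assms(1) unfolding rational_fun_def by blast
  obtain E c where E: "finite E" "\<And>e. e \<in> E \<Longrightarrow> length e = 2"
    and P_eq: "\<And>zs. length zs = 2 \<Longrightarrow> P zs = (\<Sum>e\<in>E. c e * (\<Prod>j<2. (zs ! j) ^ (e ! j :: nat)))"
    using P unfolding polynomial_fun_def by blast
  define M where "M e = (int (e ! 0) - int (a 0), int (e ! 1) - int (a 1))" for e :: "nat list"
  define Q where "Q m n = (\<Sum>e\<in>E. if (m, n) = M e then c e else 0)" for m n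
  have "{(m, n). Q m n \<noteq> 0} \<subseteq> M ` E"
  proof clarify
    fix m n assume "Q m n \<noteq> 0" 
    then obtain e where "e \<in> E" "(if (m, n) = M e then c e else 0) \<noteq> 0"
      unfolding Q_def by (rule sum.not_neutral_contains_not_neutral)
    then show "(m, n) \<in> M ` E" by (auto split: if_splits)
  qed
  then have fin: "finite {(m, n). Q m n \<noteq> 0}" by (rule finite_subset) (use E in simp)
  have Q_sum: "laurent_has_sum Q z1 z2 ((z1 - z2) ^ b 0 1 * f [z1, z2])"
    if z: "z1 \<noteq> 0" "z2 \<noteq> 0" "z1 \<noteq> z2" for z1 z2
  proof -
    let ?t = "\<lambda>e. c e * z1 powi fst (M e) * z2 powi snd (M e)"
    have "((\<lambda>x. \<Sum>e\<in>E. if x = M e then ?t e else 0) has_sum (\<Sum>e\<in>E. ?t e)) UNIV"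
    proof (rule has_sum_finite_sum)
      show "((\<lambda>x. if x = M e then ?t e else 0) has_sum ?t e) UNIV" for e
        by (rule has_sum_finite_neutralI[where B = "{M e}"]) auto
    qed
    moreover have "(if x = M e then ?t e else 0) =
        (if x = M e then c e else 0) * z1 powi fst x * z2 powi snd x" for x e by simp
    then have "(\<Sum>e\<in>E. if x = M e then ?t e else 0) =
        (case x of (m, n) \<Rightarrow> Q m n * z1 powi m * z2 powi n)" for x
      by (simp only: Q_def sum_distrib_right case_prod_unfold prod.collapse)
    ultimately have "laurent_has_sum Q z1 z2 (\<Sum>e\<in>E. ?t e)"
      by (simp add: laurent_has_sum_def)
    moreover have "(z1 - z2) ^ b 0 1 * f [z1, z2] = (\<Sum>e\<in>E. ?t e)"
    proof -
      have "f [z1, z2] = P [z1, z2] / (z1 ^ a 0 * z2 ^ a 1 * (z1 - z2) ^ b 0 1)"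
        using f[of "[z1, z2]"] z by (simp add: off_poles_def numeral_2_eq_2 lessThan_Suc)
      then have "(z1 - z2) ^ b 0 1 * f [z1, z2] = P [z1, z2] / (z1 ^ a 0 * z2 ^ a 1)"
        using z by simp
      also have "\<dots> = (\<Sum>e\<in>E. ?t e)"
        unfolding P_eq[of "[z1, z2]", simplified] sum_divide_distrib
        using z by (intro sum.cong) (auto simp: M_def power_int_diff numeral_2_eq_2 lessThan_Suc)
      finally show ?thesis .
    qed
    ultimately show ?thesis by simp
  qed
  have pw: "(z1 - z2) ^ (B - b 0 1) * ((z1 - z2) ^ b 0 1 * f [z1, z2]) = (z1 - z2) ^ B * f [z1, z2]"
    for z1 z2
    using assms(2) by (simp flip: power_add mult.assoc)
  have "laurent_has_sum ((shift_diff ^^ (B - b 0 1)) Q) z1 z2 ((z1 - z2) ^ B * f [z1, z2])"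
    if z: "z1 \<noteq> 0" "z2 \<noteq> 0" "z1 \<noteq> z2" for z1 z2
    using laurent_has_sum_shift_diff[OF Q_sum[OF z] z(1,2), of "B - b 0 1"] unfolding pw .
  then show ?thesis using finite_shift_diff[OF fin] by blast
qed

section \<open>Identification of the coefficients of a two-point function\<close>

context graded_modes
begin

lemma weakly_commute_mono:
  assumes "weakly_commute N c i j" "N \<le> N'"
  shows "weakly_commute N' c i j"
proof -
  have "(shift_diff ^^ N') X = (shift_diff ^^ (N' - N)) ((shift_diff ^^ N) X)"
    for X :: "int \<Rightarrow> int \<Rightarrow> 'w"
    using funpow_add[of "N' - N" N "shift_diff :: (int \<Rightarrow> int \<Rightarrow> 'w) \<Rightarrow> _"] assms(2)
    by simp
  then show ?thesis using assms(1) unfolding weakly_commute_def by simp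
qed

text \<open>Coefficient of \<open>x_1^m (log x_1)^k x_2^n (log x_2)^l\<close> in the matrix element
  of two fields, after multiplication with \<open>(x_1 - x_2)^B\<close> and removal of
  \<open>x_1^(-al i) x_2^(-al j)\<close>.\<close>

definition pair_coeff :: "nat \<Rightarrow> 'i \<Rightarrow> 'i \<Rightarrow> ('w \<Rightarrow> complex) \<Rightarrow> 'w \<Rightarrow> nat \<Rightarrow> nat \<Rightarrow> int \<Rightarrow> int \<Rightarrow> complex" where
  "pair_coeff B i j w' w k l = (shift_diff ^^ B) (\<lambda>m n. w' (mode i m k (mode j n l w)))"

text \<open>After multiplication with \<open>(x\<^sub>1 - x\<^sub>2)\<^sup>B\<close> the matrix elements form finitely many Laurent
  polynomials, with values \<open>q\<close>, so that the continuation \<open>F\<close> is visible on all of \<open>z\<^sub>1 \<noteq> z\<^sub>2\<close>.\<close>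

definition pair_expansion ::
  "nat \<Rightarrow> 'i \<Rightarrow> 'i \<Rightarrow> ('w \<Rightarrow> complex) \<Rightarrow> 'w \<Rightarrow> nat \<Rightarrow> (nat list \<Rightarrow> complex list \<Rightarrow> complex) \<Rightarrow>
   (nat \<Rightarrow> nat \<Rightarrow> complex \<Rightarrow> complex \<Rightarrow> complex) \<Rightarrow> bool" where
  "pair_expansion B i j w' w N f q \<longleftrightarrow>
     (\<forall>k l z1 z2. z1 \<noteq> 0 \<and> z2 \<noteq> 0 \<and> z1 \<noteq> z2 \<longrightarrow>
        laurent_has_sum (pair_coeff B i j w' w k l) z1 z2 (q k l z1 z2)) \<and>
     (\<forall>k l. finite {(m, n). pair_coeff B i j w' w k l m n \<noteq> 0}) \<and>
     (\<forall>k l m n. N < k \<or> N < l \<longrightarrow> pair_coeff B i j w' w k l m n = 0) \<and>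
     (\<forall>N' p z1 z2. N \<le> N' \<and> z1 \<noteq> 0 \<and> z2 \<noteq> 0 \<and> z1 \<noteq> z2 \<longrightarrow>
        (z1 - z2) ^ B * F_branch al [i, j] N f p [z1, z2] =
        (\<Sum>k\<le>N'. \<Sum>l\<le>N'. q k l z1 z2 * branch_monom p (- al i) k z1 * branch_monom p (- al j) l z2))"

lemma pair_coeff_dual:
  assumes "w' \<in> graded_dual sW G"
  shows "pair_coeff B i j w' w k l m n = w' ((shift_diff ^^ B) (\<lambda>m n. mode i m k (mode j n l w)) m n)"
  unfolding pair_coeff_def by (simp only: shift_diff_linear[where f = w', OF dual_simps(3)[OF assms]])

lemma pair_coeff_dual_swap:
  assumes w': "w' \<in> graded_dual sW G"
  shows "c * (-1) ^ B * pair_coeff B j i w' w l k n m =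
    w' ((shift_diff ^^ B) (\<lambda>m n. sW c (mode j n l (mode i m k w))) m n)"
proof -
  have "w' ((shift_diff ^^ B) (\<lambda>m n. sW c (mode j n l (mode i m k w))) m n) =
      (shift_diff ^^ B) (\<lambda>m n. c * w' (mode j n l (mode i m k w))) m n"
    using fun_cong[OF fun_cong[OF shift_diff_linear[where f = w' and N = B
        and X = "\<lambda>m n. sW c (mode j n l (mode i m k w))", OF dual_simps(3)[OF w']]], of m n]
    by (simp add: dual_simps[OF w'])
  also have "\<dots> = c * (shift_diff ^^ B) (\<lambda>m n. w' (mode j n l (mode i m k w))) m n"
    by (simp only: shift_diff_linear[where f = "(*) c", OF right_diff_distrib])
  also have "(shift_diff ^^ B) (\<lambda>m n. w' (mode j n l (mode i m k w))) m n =
      (-1) ^ B * pair_coeff B j i w' w l k n m"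
    unfolding pair_coeff_def by (rule shift_diff_swap)
  finally show ?thesis by simp
qed

lemma pair_expansionD:
  assumes "pair_expansion B i j w' w N f q"
  shows "\<lbrakk>z1 \<noteq> 0; z2 \<noteq> 0; z1 \<noteq> z2\<rbrakk> \<Longrightarrow> laurent_has_sum (pair_coeff B i j w' w k l) z1 z2 (q k l z1 z2)"
    and "finite {(m, n). pair_coeff B i j w' w k l m n \<noteq> 0}"
    and "N < k \<or> N < l \<Longrightarrow> pair_coeff B i j w' w k l m n = 0"
    and "\<lbrakk>N \<le> N'; z1 \<noteq> 0; z2 \<noteq> 0; z1 \<noteq> z2\<rbrakk> \<Longrightarrow>
      (z1 - z2) ^ B * F_branch al [i, j] N f p [z1, z2] =
        (\<Sum>k\<le>N'. \<Sum>l\<le>N'. q k l z1 z2 * branch_monom p (- al i) k z1 * branch_monom p (- al j) l z2)"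
  using assms unfolding pair_expansion_def by blast+

text \<open>After multiplication with \<open>(z1 - z2) ^ B\<close> the series of the product and the
  Laurent polynomials of \<open>F\<close> have the same sum at real points
  \<open>exp x > exp y > 1\<close>. Then \<open>log_series_unique2\<close> identifies the
  coefficients, so those of the product have finite support and their sums \<open>q\<close> make
  sense at all distinct nonzero \<open>z1\<close>, \<open>z2\<close>.\<close>

lemma correlation_pair_expansion:
  assumes ij: "i \<in> I" "j \<in> I" and w': "w' \<in> graded_dual sW G"
    and corr: "correlation_function al phi w' [i, j] w N f"
    and B: "\<And>ks. ks \<in> log_exponents 2 N \<Longrightarrow> \<exists>a b. rational_fun 2 a b (f ks) \<and> b 0 1 \<le> B"
  shows "\<exists>q. pair_expansion B i j w' w N f q"
proof -
  have ij_set: "set [i, j] \<subseteq> I" using ij by simp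
  define c where "c k l m n = w' (mode i m k (mode j n l w))" for k l m n
  define good where "good k l Q \<longleftrightarrow> (k \<le> N \<and> l \<le> N \<longrightarrow>
        (\<forall>z1 z2. z1 \<noteq> 0 \<and> z2 \<noteq> 0 \<and> z1 \<noteq> z2 \<longrightarrow>
           laurent_has_sum Q z1 z2 ((z1 - z2) ^ B * f [k, l] [z1, z2]))) \<and>
       finite {(m, n). Q m n \<noteq> 0} \<and> (N < k \<or> N < l \<longrightarrow> Q = (\<lambda>_ _. 0))" for k l Q
  have "\<exists>Q. good k l Q" for k l
  proof (cases "k \<le> N \<and> l \<le> N")
    case True
    then have "[k, l] \<in> log_exponents 2 N" by (simp add: log_exponents_def)
    then obtain a b where "rational_fun 2 a b (f [k, l])" "b 0 1 \<le> B" using B by blast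
    from rational_fun_2_laurent[OF this] True show ?thesis unfolding good_def by (meson not_le)
  next
    case False
    then show ?thesis by (intro exI[of _ "\<lambda>_ _. 0"]) (auto simp: good_def)
  qed
  then obtain Q where "\<And>k l. good k l (Q k l)" by metis
  then have Q_sum: "\<And>k l z1 z2. \<lbrakk>k \<le> N; l \<le> N; z1 \<noteq> 0; z2 \<noteq> 0; z1 \<noteq> z2\<rbrakk> \<Longrightarrow>
           laurent_has_sum (Q k l) z1 z2 ((z1 - z2) ^ B * f [k, l] [z1, z2])"
    and Q_fin: "\<And>k l. finite {(m, n). Q k l m n \<noteq> 0}"
    and Q_0: "\<And>k l m n. N < k \<or> N < l \<Longrightarrow> Q k l = (\<lambda>_ _. 0)"
    unfolding good_def by blast+
  define q where "q k l z1 z2 = (if k \<le> N \<and> l \<le> N then (z1 - z2) ^ B * f [k, l] [z1, z2] else 0)"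
    for k l z1 z2
  have Qq: "laurent_has_sum (Q k l) z1 z2 (q k l z1 z2)" if "z1 \<noteq> 0" "z2 \<noteq> 0" "z1 \<noteq> z2" for k l z1 z2
  proof (cases "k \<le> N \<and> l \<le> N")
    case False
    then have "Q k l = (\<lambda>_ _. 0)" by (intro Q_0) auto
    then show ?thesis using False by (auto simp: laurent_has_sum_def q_def case_prod_unfold)
  qed (use Q_sum that in \<open>simp add: q_def\<close>)
  have F_q: "(z1 - z2) ^ B * F_branch al [i, j] N f p [z1, z2] =
        (\<Sum>k\<le>N'. \<Sum>l\<le>N'. q k l z1 z2 * branch_monom p (- al i) k z1 * branch_monom p (- al j) l z2)"
    if "N \<le> N'" for N' p z1 z2
  proof -
    let ?b = "\<lambda>k l. branch_monom p (- al i) k z1 * branch_monom p (- al j) l z2"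
    have "(\<Sum>k\<le>N'. \<Sum>l\<le>N'. q k l z1 z2 * ?b k l) = (\<Sum>k\<le>N. \<Sum>l\<le>N'. q k l z1 z2 * ?b k l)"
      using that by (intro sum.mono_neutral_right) (auto simp: q_def)
    also have "\<dots> = (\<Sum>k\<le>N. \<Sum>l\<le>N. q k l z1 z2 * ?b k l)"
      using that by (intro sum.cong refl sum.mono_neutral_right) (auto simp: q_def)
    also have "\<dots> = (z1 - z2) ^ B * F_branch al [i, j] N f p [z1, z2]"
      by (simp add: F_branch_def sum_log_exponents_2[unfolded numeral_2_eq_2] lessThan_Suc q_def
          sum_distrib_left mult_ac)
    finally show ?thesis by (simp add: mult.assoc)
  qed
  obtain K where K: "\<And>ks w ms. length ks = length [i, j] \<Longrightarrow> \<not> set ks \<subseteq> {..K} \<Longrightarrow> modes [i, j] ks w ms = 0"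
    using modes_log_bound[OF ij_set] by blast
  \<comment> \<open>Powers of logarithms are bounded by \<open>N\<close> in \<open>F\<close> and by
    \<open>K\<close> in the product; both sums are padded with zeros to a common range.\<close>
  define N' where "N' = max N K"
  have c_0: "c k l m n = 0" if "N' < k \<or> N' < l" for k l m n
    using K[of "[k, l]" w "[m, n]"] that by (auto simp: c_def N'_def dual_simps[OF w'])
  obtain S where S: "finite S" "\<And>ks ms. length ms = length [i, j] \<Longrightarrow>
      w' (modes [i, j] ks w ms) \<noteq> 0 \<Longrightarrow> sum_list ms \<in> S"
    using modes_degrees[OF w' ij_set] by blast
  obtain b where b: "\<And>n l. n < b \<Longrightarrow> mode j n l w = 0"
    using phi_truncation[OF ij(2), of w] unfolding mode_def by blast
  have c_supp: "m + n \<in> S \<and> b \<le> n" if "c k l m n \<noteq> 0" for k l m n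
    using S(2)[of "[m, n]" "[k, l]"] b[of n l] that
    by (force simp: c_def mode_simps ij dual_simps[OF w'])
  have supp: "m + n - int B \<in> S \<and> b \<le> n" if "(shift_diff ^^ B) (c k l) m n \<noteq> 0" for k l m n
    by (rule shift_diff_support[OF c_supp that])
  have corr_eq: "(shift_diff ^^ B) (c k l) m n - Q k l m n = 0" if "k \<le> N'" "l \<le> N'" for k l m n
  proof -
    \<comment> \<open>A total degree in \<open>S\<close>, shifted by \<open>B\<close>, together with
      \<open>b \<le> n\<close> bounds m by \<open>T\<close>; \<open>D\<close> bounds the exponents
      of \<open>z1\<close> in the Laurent polynomials.\<close>
    define T where "T = Max (insert 0 S) + int B - b"
    define D where "D = Max (insert 0 (\<Union>k\<le>N'. \<Union>l\<le>N'. fst ` {(m, n). Q k l m n \<noteq> 0}))"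
    define e where "e k l m n = (if k \<le> N' \<and> l \<le> N' then (shift_diff ^^ B) (c k l) m n - Q k l m n else 0)"
      for k l m n
    \<comment> \<open>For \<open>y > 0\<close> both points have modulus above 1, so their logarithms
      are nonzero, as \<open>summable_modes\<close> requires.\<close>
    have sum2: "(\<lambda>(m, n). c k l m n * of_real (exp x) powi m * of_real (exp y) powi n) summable_on UNIV"
      if "x > y" "y > 0" for k l x y
    proof -
      let ?zs = "[complex_of_real (exp x), complex_of_real (exp y)]"
      have "product_term phi w' [i, j] w 0 ?zs summable_on {es. length es = length [i, j]}"
      proof (rule has_sum_imp_summable)
        have "radially_ordered ?zs" using that by (simp add: radially_ordered_def norm_of_real del: of_real_exp)
        then show "(product_term phi w' [i, j] w 0 ?zs has_sum F_branch al [i, j] N f 0 ?zs)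
            {es. length es = length [i, j]}"
          using corr unfolding correlation_function_def by simp
      qed
      then have "(\<lambda>ms. w' (modes [i, j] [k, l] w ms) * monom_val ?zs ms) summable_on
          {ms. length ms = length [i, j]}"
        using ij that by (intro summable_modes) (auto simp: lp_exp_real simp del: of_real_exp)
      then show ?thesis
        by (subst summable_on_reindex_bij_witness[where i = "\<lambda>ms. (ms ! 0, ms ! 1)" and j = "\<lambda>(m, n). [m, n]"
              and T = "{ms. length ms = length [i, j]}"
              and h = "\<lambda>ms. w' (modes [i, j] [k, l] w ms) * monom_val ?zs ms"])
           (auto simp: length_Suc_conv monom_val_def lessThan_Suc c_def)
    qed
    define s where "s k l x y = (\<Sum>\<^sub>\<infinity>(m, n). c k l m n * of_real (exp x) powi m * of_real (exp y) powi n)"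
      for k l and x y :: real
    have c_s: "laurent_has_sum (c k l) (of_real (exp x)) (of_real (exp y)) (s k l x y)"
      if "x > y" "y > 0" for k l x y
      unfolding laurent_has_sum_def s_def by (rule has_sum_infsum[OF sum2[OF that]])
    \<comment> \<open>The same series summed in two ways: as prescribed by \<open>F\<close>, and
      sorted by powers of logarithms.\<close>
    have total: "F_branch al [i, j] N f 0 [of_real (exp x), of_real (exp y)] =
        (\<Sum>k\<le>N'. \<Sum>l\<le>N'. s k l x y * (branch_monom 0 (- al i) k (of_real (exp x)) *
           branch_monom 0 (- al j) l (of_real (exp y))))"
      if xy: "x > y" "y > 0" for x y
    proof -
      let ?zs = "[complex_of_real (exp x), complex_of_real (exp y)]"
      have "(product_term phi w' [i, j] w 0 ?zs has_sum
          (\<Sum>ks\<in>log_exponents (length [i, j]) N'. s (ks ! 0) (ks ! 1) x y *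
            (\<Prod>a<length [i, j]. branch_monom 0 (- al ([i, j] ! a)) (ks ! a) (?zs ! a))))
          {es. length es = length [i, j]}"
      proof (rule has_sum_product_term[OF _ _ _ w'])
        show "modes [i, j] ks w ms = 0" if "length ks = length [i, j]" "\<not> set ks \<subseteq> {..N'}" for ks ms
          using K[of ks w ms] that by (force simp: N'_def)
        fix ks assume "ks \<in> log_exponents (length [i, j]) N'"
        then obtain k l where ks: "ks = [k, l]" by (auto simp: log_exponents_def length_Suc_conv)
        show "((\<lambda>ms. w' (modes [i, j] ks w ms) * monom_val ?zs ms) has_sum s (ks ! 0) (ks ! 1) x y)
            {ms. length ms = length [i, j]}"
          using c_s[OF xy, of k l] unfolding laurent_has_sum_def
          by (subst (asm) has_sum_reindex_bij_witness[where i = "\<lambda>ms. (ms ! 0, ms ! 1)" and j = "\<lambda>(m, n). [m, n]"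
              and T = "{ms. length ms = length [i, j]}" and s' = "s k l x y"
              and h = "\<lambda>ms. w' (modes [i, j] [k, l] w ms) * monom_val ?zs ms"])
           (auto simp: length_Suc_conv monom_val_def lessThan_Suc c_def ks)
      qed (use ij in \<open>auto simp del: of_real_exp\<close>)
      moreover have "radially_ordered ?zs"
        using xy by (simp add: radially_ordered_def norm_of_real del: of_real_exp)
      then have "(product_term phi w' [i, j] w 0 ?zs has_sum F_branch al [i, j] N f 0 ?zs)
            {es. length es = length [i, j]}"
        using corr unfolding correlation_function_def by simp
      ultimately have "F_branch al [i, j] N f 0 ?zs =
        (\<Sum>ks\<in>log_exponents (length [i, j]) N'. s (ks ! 0) (ks ! 1) x y *
            (\<Prod>a<length [i, j]. branch_monom 0 (- al ([i, j] ! a)) (ks ! a) (?zs ! a)))"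
        using has_sum_unique by blast
      also have "\<dots> = (\<Sum>ks\<in>log_exponents 2 N'. s (ks ! 0) (ks ! 1) x y *
            (branch_monom 0 (- al i) (ks ! 0) (?zs ! 0) * branch_monom 0 (- al j) (ks ! 1) (?zs ! 1)))"
        by (simp add: lessThan_Suc numeral_2_eq_2 mult_ac)
      finally show ?thesis by (simp add: sum_log_exponents_2)
    qed
    have "e k l m n = 0"
    proof (rule log_series_unique2[where N = N' and b = "max T D"
          and s = "\<lambda>k l x y. (of_real (exp x) - of_real (exp y)) ^ B * s k l x y -
                     q k l (of_real (exp x)) (of_real (exp y))"])
      show "e k l m n = 0" if "m > max T D" for k l m n
      proof (rule ccontr)
        assume e: "e k l m n \<noteq> 0"
        then have kl: "k \<le> N'" "l \<le> N'" by (auto simp: e_def split: if_splits)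
        from e consider "(shift_diff ^^ B) (c k l) m n \<noteq> 0" | "Q k l m n \<noteq> 0"
          by (cases "Q k l m n = 0") (auto simp: e_def split: if_splits)
        then show False
        proof cases
          case 1
          then have "m + n - int B \<le> Max (insert 0 S)" "b \<le> n" using supp[OF 1] S by auto
          then show False using that by (simp add: T_def)
        next
          case 2
          then have "m \<in> fst ` {(m, n). Q k l m n \<noteq> 0}" by (force simp: image_iff)
          then have "m \<in> insert 0 (\<Union>k\<le>N'. \<Union>l\<le>N'. fst ` {(m, n). Q k l m n \<noteq> 0})"
            using kl by blast
          then have "m \<le> D" unfolding D_def by (rule Max_ge[rotated]) (use Q_fin in simp)
          then show False using that by simp
        qed
      qed
      show "finite {n. e k l m n \<noteq> 0}" for k l m
      proof (rule finite_subset)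
        show "{n. e k l m n \<noteq> 0} \<subseteq> (\<lambda>s. s + int B - m) ` S \<union> snd ` {(m, n). Q k l m n \<noteq> 0}"
        proof
          fix n assume "n \<in> {n. e k l m n \<noteq> 0}"
          then consider "(shift_diff ^^ B) (c k l) m n \<noteq> 0" | "Q k l m n \<noteq> 0"
            by (cases "Q k l m n = 0") (auto simp: e_def split: if_splits)
          then show "n \<in> (\<lambda>s. s + int B - m) ` S \<union> snd ` {(m, n). Q k l m n \<noteq> 0}"
          proof cases
            case 1
            then have "m + n - int B \<in> S" using supp by blast
            then have "n \<in> (\<lambda>s. s + int B - m) ` S" by (rule image_eqI[rotated]) simp
            then show ?thesis by blast
          qed (force simp: image_iff)
        qed
      qed (use S Q_fin in auto)
      show "laurent_has_sum (e k l) (of_real (exp x)) (of_real (exp y))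
         ((of_real (exp x) - of_real (exp y)) ^ B * s k l x y - q k l (of_real (exp x)) (of_real (exp y)))"
        if "k \<le> N'" "l \<le> N'" "x > y" "y > 0" for k l x y
      proof -
        have "complex_of_real (exp x) \<noteq> of_real (exp y)"
          using that by (simp del: of_real_exp)
        then have "laurent_has_sum (\<lambda>m n. (shift_diff ^^ B) (c k l) m n - Q k l m n)
          (of_real (exp x)) (of_real (exp y))
         ((of_real (exp x) - of_real (exp y)) ^ B * s k l x y - q k l (of_real (exp x)) (of_real (exp y)))"
          using that by (intro laurent_has_sum_diff laurent_has_sum_shift_diff c_s Qq) (auto simp del: of_real_exp)
        then show ?thesis using that by (simp add: e_def[abs_def])
      qed
      show "(\<Sum>k\<le>N'. \<Sum>l\<le>N'. ((of_real (exp x) - of_real (exp y)) ^ B * s k l x y -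
           q k l (of_real (exp x)) (of_real (exp y))) * of_real x ^ k * of_real y ^ l) = 0"
        if xy: "x > y" "y > 0" for x y
      proof -
        define z1 where "z1 = complex_of_real (exp x)"
        define z2 where "z2 = complex_of_real (exp y)"
        \<comment> \<open>The common factor from the powers \<open>- al i\<close> and
          \<open>- al j\<close> is nonzero and cancels.\<close>
        let ?E = "exp (- al i * x) * exp (- al j * y)"
        have bm: "branch_monom 0 (- al i) k z1 = exp (- al i * x) * of_real x ^ k"
          "branch_monom 0 (- al j) k z2 = exp (- al j * y) * of_real y ^ k" for k
          by (simp_all only: branch_monom_def z1_def z2_def lp_exp_real)
        have "(\<Sum>k\<le>N'. \<Sum>l\<le>N'. q k l z1 z2 * branch_monom 0 (- al i) k z1 * branch_monom 0 (- al j) l z2) =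
           (z1 - z2) ^ B * (\<Sum>k\<le>N'. \<Sum>l\<le>N'. s k l x y * (branch_monom 0 (- al i) k z1 * branch_monom 0 (- al j) l z2))"
          using F_q[of N' z1 z2 0] total[OF xy] by (simp only: z1_def z2_def) (simp add: N'_def)
        then have "0 = (\<Sum>k\<le>N'. \<Sum>l\<le>N'. ?E * (((z1 - z2) ^ B * s k l x y - q k l z1 z2) *
              of_real x ^ k * of_real y ^ l))"
          by (simp only: bm sum_distrib_left) (simp add: sum_subtractf algebra_simps)
        also have "\<dots> = ?E * (\<Sum>k\<le>N'. \<Sum>l\<le>N'. ((z1 - z2) ^ B * s k l x y - q k l z1 z2) *
              of_real x ^ k * of_real y ^ l)"
          by (simp only: sum_distrib_left)
        finally show ?thesis unfolding z1_def z2_def by simp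
      qed
    qed (use that in auto)
    then show ?thesis using that by (simp add: e_def)
  qed
  have shift_c: "(shift_diff ^^ B) (c k l) = Q k l" for k l
  proof (intro ext)
    fix m n
    show "(shift_diff ^^ B) (c k l) m n = Q k l m n"
    proof (cases "k \<le> N' \<and> l \<le> N'")
      case True
      then show ?thesis using corr_eq by simp
    next
      case False
      then have "c k l m n = 0" for m n using c_0 by auto
      \<comment> \<open>With an empty set of degrees, \<open>shift_diff_support\<close> says that
        multiples of the zero family vanish.\<close>
      then have "(shift_diff ^^ B) (c k l) m n = 0"
        using shift_diff_support[of "c k l" "{}" 0 B m n] by auto
      moreover have "Q k l = (\<lambda>_ _. 0)" using False by (intro Q_0) (auto simp: N'_def)
      ultimately show ?thesis by simp
    qed
  qed
  have c_eq: "(\<lambda>m n. w' (mode i m k (mode j n l w))) = c k l" for k l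
    by (simp add: c_def fun_eq_iff)
  show ?thesis unfolding pair_expansion_def pair_coeff_def c_eq shift_c
    by (intro exI[of _ q] conjI allI impI) (use Qq Q_fin Q_0 F_q in auto)
qed

end

subsection \<open>Commutativity\<close>

lemma branch_monom_exp_real:
  "branch_monom 0 a k (of_real (exp x)) = exp (a * of_real x) * of_real x ^ k"
  by (simp only: branch_monom_def lp_exp_real)

lemma times_x1_minus_x2_Suc:
  "(times_x1_minus_x2 ^^ Suc N) A r k s l =
   (times_x1_minus_x2 ^^ N) A (r - 1) k s l - (times_x1_minus_x2 ^^ N) A r k (s - 1) l"
  unfolding funpow.simps o_apply by (simp only: times_x1_minus_x2_def)

lemma times_x1_minus_x2_shift_diff:
  "(times_x1_minus_x2 ^^ N) A (of_int m - a) k (of_int n - b) l =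
   (shift_diff ^^ N) (\<lambda>m n. A (of_int m - a) k (of_int n - b) l) m n"
proof (induction N arbitrary: m n)
  case (Suc N)
  have "(times_x1_minus_x2 ^^ Suc N) A (of_int m - a) k (of_int n - b) l =
      (times_x1_minus_x2 ^^ N) A (of_int (m - 1) - a) k (of_int n - b) l -
      (times_x1_minus_x2 ^^ N) A (of_int m - a) k (of_int (n - 1) - b) l"
    unfolding times_x1_minus_x2_Suc by (simp add: algebra_simps)
  then show ?case by (simp only: Suc.IH shift_diff_Suc)
qed simp

text \<open>Multiplication with \<open>x_1\<close> or \<open>x_2\<close> shifts a power by 1 and so
  preserves its coset modulo the integers.\<close>

lemma times_x1_minus_x2_eq_0:
  assumes "\<And>r k s l. r + a \<notin> \<int> \<or> s + b \<notin> \<int> \<Longrightarrow> A r k s l = 0" "r + a \<notin> \<int> \<or> s + b \<notin> \<int>"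
  shows "(times_x1_minus_x2 ^^ N) A r k s l = 0"
  using assms(2)
proof (induction N arbitrary: r s)
  case (Suc N)
  have shift: "r - 1 + a \<in> \<int> \<longleftrightarrow> r + a \<in> \<int>" for r a :: complex
    using Ints_add[of "r - 1 + a" 1] Ints_diff[of "r + a" 1] by (auto simp: algebra_simps)
  have "(times_x1_minus_x2 ^^ N) A (r - 1) k s l = 0" "(times_x1_minus_x2 ^^ N) A r k (s - 1) l = 0"
    by (rule Suc.IH; use Suc.prems in \<open>simp add: shift\<close>)+
  then show ?case by (simp only: times_x1_minus_x2_Suc diff_self)
qed (use assms(1) in simp)

lemma laurent_has_sum_unique:
  "laurent_has_sum X z1 z2 S \<Longrightarrow> laurent_has_sum X z1 z2 T \<Longrightarrow> S = T"
  unfolding laurent_has_sum_def by (rule has_sum_unique)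

text \<open>\<open>correlation_function\<close> allows separate pole orders for each
  \<open>ks\<close>, but there are finitely many \<open>ks\<close>.\<close>

lemma correlation_pair_pole_bound:
  assumes "correlation_function al phi w' [i, j] w N f"
  shows "\<exists>B. \<forall>ks\<in>log_exponents 2 N. \<exists>a b. rational_fun 2 a b (f ks) \<and> b 0 1 \<le> B"
proof -
  have "\<forall>ks\<in>log_exponents 2 N. \<exists>n a b. rational_fun 2 a b (f ks) \<and> b 0 1 \<le> n"
    using assms unfolding correlation_function_def
    by (simp add: numeral_2_eq_2) (meson order.refl)
  then obtain g where g: "\<And>ks. ks \<in> log_exponents 2 N \<Longrightarrow> \<exists>a b. rational_fun 2 a b (f ks) \<and> b 0 1 \<le> (g ks :: nat)"
    by metis
  show ?thesis
  proof (intro exI[of _ "Max (g ` log_exponents 2 N)"] ballI)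
    fix ks assume ks: "ks \<in> log_exponents 2 N"
    then have "g ks \<le> Max (g ` log_exponents 2 N)" by (simp add: finite_log_exponents)
    then show "\<exists>a b. rational_fun 2 a b (f ks) \<and> b 0 1 \<le> Max (g ` log_exponents 2 N)"
      using g[OF ks] order_trans by blast
  qed
qed

context graded_modes
begin

text \<open>At a common exponent \<open>B\<close> the coefficients of both orders agree up to
  \<open>c * (-1) ^ B\<close>, and through \<open>pair_expansion\<close> they determine every branch
  of \<open>F\<close> at all distinct nonzero points. The sign turns \<open>(z2 - z1) ^ B\<close>
  into \<open>(z1 - z2) ^ B\<close>, which is then cancelled.\<close>

lemma weakly_commute_commutativity:
  assumes ij: "i \<in> I" "j \<in> I" and w': "w' \<in> graded_dual sW G"
    and comm: "weakly_commute M c i j"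
    and corr: "correlation_function al phi w' [i, j] w N12 f12"
      "correlation_function al phi w' [j, i] w N21 f21"
    and z: "z1 \<noteq> 0" "z2 \<noteq> 0" "z1 \<noteq> z2"
  shows "F_branch al [i, j] N12 f12 p [z1, z2] = c * F_branch al [j, i] N21 f21 p [z2, z1]"
proof -
  obtain B12 where B12: "\<And>ks. ks \<in> log_exponents 2 N12 \<Longrightarrow>
      \<exists>a b. rational_fun 2 a b (f12 ks) \<and> b 0 1 \<le> B12"
    using correlation_pair_pole_bound[OF corr(1)] by blast
  obtain B21 where B21: "\<And>ks. ks \<in> log_exponents 2 N21 \<Longrightarrow>
      \<exists>a b. rational_fun 2 a b (f21 ks) \<and> b 0 1 \<le> B21"
    using correlation_pair_pole_bound[OF corr(2)] by blast
  \<comment> \<open>Large enough for weak commutativity and for the diagonal poles of both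
    correlation functions; the bounds for these poles may depend on \<open>w\<close> and
    \<open>w'\<close> here.\<close>
  define B where "B = max M (max B12 B21)"
  define N where "N = max N12 N21"
  have B: "\<And>ks. ks \<in> log_exponents 2 N12 \<Longrightarrow> \<exists>a b. rational_fun 2 a b (f12 ks) \<and> b 0 1 \<le> B"
    "\<And>ks. ks \<in> log_exponents 2 N21 \<Longrightarrow> \<exists>a b. rational_fun 2 a b (f21 ks) \<and> b 0 1 \<le> B"
    using B12 B21 unfolding B_def by (meson max.coboundedI1 max.coboundedI2 order.refl)+
  have commB: "weakly_commute B c i j" by (rule weakly_commute_mono[OF comm]) (simp add: B_def)
  obtain q12 where q12: "pair_expansion B i j w' w N12 f12 q12"
    using correlation_pair_expansion[OF ij w' corr(1) B(1)] by blast
  obtain q21 where q21: "pair_expansion B j i w' w N21 f21 q21"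
    using correlation_pair_expansion[OF ij(2,1) w' corr(2) B(2)] by blast
  have D: "pair_coeff B i j w' w k l m n = (c * (-1) ^ B) * pair_coeff B j i w' w l k n m" for k l m n
  proof -
    have "pair_coeff B i j w' w k l m n = w' ((shift_diff ^^ B) (\<lambda>m n. mode i m k (mode j n l w)) m n)"
      by (rule pair_coeff_dual[OF w'])
    also have "\<dots> = w' ((shift_diff ^^ B) (\<lambda>m n. sW c (mode j n l (mode i m k w))) m n)"
      using commB unfolding weakly_commute_def by simp
    also have "\<dots> = (c * (-1) ^ B) * pair_coeff B j i w' w l k n m"
      by (rule pair_coeff_dual_swap[OF w', symmetric])
    finally show ?thesis .
  qed
  have q: "q12 k l z1 z2 = (c * (-1) ^ B) * q21 l k z2 z1" for k l
  proof -
    have "laurent_has_sum (\<lambda>m n. pair_coeff B j i w' w l k n m) z1 z2 (q21 l k z2 z1)"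
      by (rule laurent_has_sum_swap[OF pair_expansionD(1)[OF q21]]) (use z in auto)
    from laurent_has_sum_cmult[OF this, of "c * (-1) ^ B"]
    have "laurent_has_sum (pair_coeff B i j w' w k l) z1 z2 ((c * (-1) ^ B) * q21 l k z2 z1)"
      by (simp only: D[symmetric])
    then show ?thesis using laurent_has_sum_unique pair_expansionD(1)[OF q12 z] by blast
  qed
  let ?b1 = "\<lambda>k. branch_monom p (- al i) k z1" and ?b2 = "\<lambda>l. branch_monom p (- al j) l z2"
  have "(z1 - z2) ^ B * F_branch al [i, j] N12 f12 p [z1, z2] =
      (\<Sum>k\<le>N. \<Sum>l\<le>N. q12 k l z1 z2 * ?b1 k * ?b2 l)"
    by (rule pair_expansionD(4)[OF q12]) (use z in \<open>auto simp: N_def\<close>)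
  also have "\<dots> = (c * (-1) ^ B) * (\<Sum>k\<le>N. \<Sum>l\<le>N. q21 l k z2 z1 * ?b2 l * ?b1 k)"
    by (simp add: q sum_distrib_left mult_ac)
  also have "(\<Sum>k\<le>N. \<Sum>l\<le>N. q21 l k z2 z1 * ?b2 l * ?b1 k) = (\<Sum>l\<le>N. \<Sum>k\<le>N. q21 l k z2 z1 * ?b2 l * ?b1 k)"
    by (rule sum.swap)
  also have "\<dots> = (z2 - z1) ^ B * F_branch al [j, i] N21 f21 p [z2, z1]"
    by (rule pair_expansionD(4)[OF q21, symmetric]) (use z in \<open>auto simp: N_def\<close>)
  also have "(c * (-1) ^ B) * \<dots> = (z1 - z2) ^ B * (c * F_branch al [j, i] N21 f21 p [z2, z1])"
  proof -
    have "(z1 - z2) ^ B = (-1) ^ B * (z2 - z1) ^ B"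
      by (simp flip: power_mult_distrib)
    then show ?thesis by simp
  qed
  finally show ?thesis using z by simp
qed

text \<open>The equality of branch 0, read at real points, determines all coefficients by
  \<open>log_series_unique2\<close>, and the functionals separate vectors. \<open>M\<close> is fixed
  before \<open>w\<close> and \<open>w'\<close>, so it serves all of them.\<close>

lemma commutativity_weakly_commute:
  assumes ij: "i \<in> I" "j \<in> I"
    and ex: "\<And>w' w. w' \<in> graded_dual sW G \<Longrightarrow> \<exists>N12 f12 N21 f21.
        correlation_function al phi w' [i, j] w N12 f12 \<and> correlation_function al phi w' [j, i] w N21 f21 \<and>
        (\<forall>ks\<in>log_exponents 2 N12. \<exists>a b. rational_fun 2 a b (f12 ks) \<and> b 0 1 \<le> M) \<and>
        (\<forall>ks\<in>log_exponents 2 N21. \<exists>a b. rational_fun 2 a b (f21 ks) \<and> b 0 1 \<le> M) \<and>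
        (\<forall>z1 z2. z1 \<noteq> 0 \<and> z2 \<noteq> 0 \<and> z1 \<noteq> z2 \<longrightarrow>
           F_branch al [i, j] N12 f12 0 [z1, z2] = c * F_branch al [j, i] N21 f21 0 [z2, z1])"
  shows "weakly_commute M c i j"
  unfolding weakly_commute_def
proof (intro allI ext)
  fix k l w m n
  let ?V12 = "(shift_diff ^^ M) (\<lambda>m n. mode i m k (mode j n l w)) m n"
  let ?V21 = "(shift_diff ^^ M) (\<lambda>m n. sW c (mode j n l (mode i m k w))) m n"
  have "?V12 - ?V21 = 0"
  proof (rule dual_separates)
    fix w' assume w': "w' \<in> graded_dual sW G"
    obtain N12 f12 N21 f21 where
      corr: "correlation_function al phi w' [i, j] w N12 f12" "correlation_function al phi w' [j, i] w N21 f21"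
      and B: "\<And>ks. ks \<in> log_exponents 2 N12 \<Longrightarrow> \<exists>a b. rational_fun 2 a b (f12 ks) \<and> b 0 1 \<le> M"
        "\<And>ks. ks \<in> log_exponents 2 N21 \<Longrightarrow> \<exists>a b. rational_fun 2 a b (f21 ks) \<and> b 0 1 \<le> M"
      and eq: "\<And>z1 z2. z1 \<noteq> 0 \<Longrightarrow> z2 \<noteq> 0 \<Longrightarrow> z1 \<noteq> z2 \<Longrightarrow>
           F_branch al [i, j] N12 f12 0 [z1, z2] = c * F_branch al [j, i] N21 f21 0 [z2, z1]"
      using ex[OF w', of w] by blast
    define N where "N = max N12 N21"
    define D12 where "D12 = pair_coeff M i j w' w"
    define D21 where "D21 = pair_coeff M j i w' w"
    obtain q12 where q12: "pair_expansion M i j w' w N12 f12 q12"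
      using correlation_pair_expansion[OF ij w' corr(1) B(1)] by blast
    note q12 = pair_expansionD[OF this, folded D12_def]
    obtain q21 where q21: "pair_expansion M j i w' w N21 f21 q21"
      using correlation_pair_expansion[OF ij(2,1) w' corr(2) B(2)] by blast
    note q21 = pair_expansionD[OF this, folded D21_def]
    let ?c = "c * (-1) ^ M"
    define e where "e k l m n = (if k \<le> N \<and> l \<le> N then D12 k l m n - ?c * D21 l k n m else 0)" for k l m n
    \<comment> \<open>A finite set with the exponents of both families, those of the second order
      read with the variables swapped; it supplies the top exponent and the finiteness that
      uniqueness requires.\<close>
    define R where "R = (\<Union>k\<le>N. \<Union>l\<le>N. {(m, n). D12 k l m n \<noteq> 0} \<union> prod.swap ` {(m, n). D21 l k m n \<noteq> 0})"
    have "finite R" unfolding R_def using q12(2) q21(2) by auto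
    have e_R: "(m, n) \<in> R" if "e k l m n \<noteq> 0" for k l m n
    proof -
      have kl: "k \<le> N" "l \<le> N" using that by (auto simp: e_def split: if_splits)
      have "D12 k l m n \<noteq> 0 \<or> D21 l k n m \<noteq> 0" using that by (auto simp: e_def split: if_splits)
      then have "(m, n) \<in> {(m, n). D12 k l m n \<noteq> 0} \<union> prod.swap ` {(m, n). D21 l k m n \<noteq> 0}"
        by (force simp: image_iff)
      then show ?thesis unfolding R_def using kl by blast
    qed
    have e_0: "e k l m n = 0" if kl: "k \<le> N" "l \<le> N" for k l m n
    proof (rule log_series_unique2[where N = N and b = "Max (insert 0 (fst ` R))"
          and s = "\<lambda>k l x y. q12 k l (of_real (exp x)) (of_real (exp y)) -
                     ?c * q21 l k (of_real (exp y)) (of_real (exp x))"])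
      show "e k l m n = 0" if m: "m > Max (insert 0 (fst ` R))" for k l m n
      proof (rule ccontr)
        assume "e k l m n \<noteq> 0"
        from e_R[OF this] have "m \<in> fst ` R" by (rule image_eqI[rotated]) simp
        then have "m \<in> insert 0 (fst ` R)" by simp
        then have "m \<le> Max (insert 0 (fst ` R))" by (rule Max_ge[rotated]) (use \<open>finite R\<close> in simp)
        then show False using m by simp
      qed
      show "finite {n. e k l m n \<noteq> 0}" for k l m
      proof (rule finite_subset)
        show "{n. e k l m n \<noteq> 0} \<subseteq> snd ` R"
        proof clarify
          fix n assume "e k l m n \<noteq> 0"
          from e_R[OF this] show "n \<in> snd ` R" by (rule image_eqI[rotated]) simp
        qed
      qed (use \<open>finite R\<close> in simp)
      show "laurent_has_sum (e k l) (of_real (exp x)) (of_real (exp y))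
          (q12 k l (of_real (exp x)) (of_real (exp y)) - ?c * q21 l k (of_real (exp y)) (of_real (exp x)))"
        if "k \<le> N" "l \<le> N" "x > y" "y > 0" for k l x y
      proof -
        have ne: "complex_of_real (exp x) \<noteq> of_real (exp y)" "complex_of_real (exp y) \<noteq> of_real (exp x)"
          using that by (simp_all del: of_real_exp)
        have "laurent_has_sum (\<lambda>m n. D12 k l m n - ?c * D21 l k n m) (of_real (exp x)) (of_real (exp y))
          (q12 k l (of_real (exp x)) (of_real (exp y)) - ?c * q21 l k (of_real (exp y)) (of_real (exp x)))"
          by (rule laurent_has_sum_diff[OF q12(1)[OF _ _ ne(1)]
                laurent_has_sum_cmult[OF laurent_has_sum_swap[OF q21(1)[OF _ _ ne(2)]]]])
             (simp_all del: of_real_exp)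
        then show ?thesis using that by (simp add: e_def[abs_def])
      qed
      show "(\<Sum>k\<le>N. \<Sum>l\<le>N. (q12 k l (of_real (exp x)) (of_real (exp y)) -
           ?c * q21 l k (of_real (exp y)) (of_real (exp x))) * of_real x ^ k * of_real y ^ l) = 0"
        if xy: "x > y" "y > 0" for x y
      proof -
        define z1 where "z1 = complex_of_real (exp x)"
        define z2 where "z2 = complex_of_real (exp y)"
        have z: "z1 \<noteq> 0" "z2 \<noteq> 0" "z1 \<noteq> z2" using xy by (simp_all add: z1_def z2_def del: of_real_exp)
        let ?E = "exp (- al i * x) * exp (- al j * y)"
        let ?b1 = "\<lambda>k. branch_monom 0 (- al i) k z1" and ?b2 = "\<lambda>l. branch_monom 0 (- al j) l z2"
        have bm: "branch_monom 0 (- al i) k z1 = exp (- al i * x) * of_real x ^ k"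
          "branch_monom 0 (- al j) k z2 = exp (- al j * y) * of_real y ^ k" for k
          by (simp_all only: branch_monom_exp_real z1_def z2_def)
        have "?E * (\<Sum>k\<le>N. \<Sum>l\<le>N. (q12 k l z1 z2 - ?c * q21 l k z2 z1) * of_real x ^ k * of_real y ^ l) =
          (\<Sum>k\<le>N. \<Sum>l\<le>N. q12 k l z1 z2 * ?b1 k * ?b2 l) -
          ?c * (\<Sum>k\<le>N. \<Sum>l\<le>N. q21 l k z2 z1 * ?b2 l * ?b1 k)"
          by (simp only: bm sum_distrib_left) (simp add: sum_subtractf algebra_simps)
        also have "(\<Sum>k\<le>N. \<Sum>l\<le>N. q21 l k z2 z1 * ?b2 l * ?b1 k) =
            (\<Sum>l\<le>N. \<Sum>k\<le>N. q21 l k z2 z1 * ?b2 l * ?b1 k)"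
          by (rule sum.swap)
        also have "\<dots> = (z2 - z1) ^ M * F_branch al [j, i] N21 f21 0 [z2, z1]"
          by (rule q21(4)[symmetric]) (use z in \<open>auto simp: N_def\<close>)
        also have "(\<Sum>k\<le>N. \<Sum>l\<le>N. q12 k l z1 z2 * ?b1 k * ?b2 l) =
            (z1 - z2) ^ M * F_branch al [i, j] N12 f12 0 [z1, z2]"
          by (rule q12(4)[symmetric]) (use z in \<open>auto simp: N_def\<close>)
        also have "F_branch al [i, j] N12 f12 0 [z1, z2] = c * F_branch al [j, i] N21 f21 0 [z2, z1]"
          by (rule eq[OF z])
        also have "(z1 - z2) ^ M = (-1) ^ M * (z2 - z1) ^ M"
          by (simp flip: power_mult_distrib)
        finally show ?thesis unfolding z1_def z2_def by simp
      qed
    qed (use kl in auto)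
    have D: "D12 k l m n = ?c * D21 l k n m"
    proof (cases "k \<le> N \<and> l \<le> N")
      case True
      then show ?thesis using e_0[of k l m n] by (simp add: e_def)
    next
      case False
      then have "D12 k l m n = 0" "D21 l k n m = 0"
        by (auto intro!: q12(3) q21(3) simp: N_def)
      then show ?thesis by simp
    qed
    have "w' ?V12 = D12 k l m n" unfolding D12_def by (rule pair_coeff_dual[OF w', symmetric])
    moreover have "w' ?V21 = ?c * D21 l k n m"
      unfolding D21_def by (rule pair_coeff_dual_swap[OF w', symmetric])
    ultimately show "w' (?V12 - ?V21) = 0" using D by (simp add: dual_simps[OF w'])
  qed
  then show "?V12 = ?V21" by simp
qed

text \<open>Both sides vanish at powers outside \<open>- al i\<close> and \<open>- al j\<close> plus
  integers, so comparing modes with integer indices loses nothing.\<close>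

lemma weak_commutativity_iff:
  "weak_commutativity sW I par phi \<longleftrightarrow>
     (\<forall>i\<in>I. \<forall>j\<in>I. \<exists>M>0. weakly_commute M (koszul (par i) (par j)) i j)"
proof -
  have eq: "(\<forall>w. (times_x1_minus_x2 ^^ M) (\<lambda>r k s l. phi i r k (phi j s l w)) =
        (times_x1_minus_x2 ^^ M) (\<lambda>r k s l. sW c (phi j s l (phi i r k w)))) \<longleftrightarrow>
      weakly_commute M c i j" (is "(\<forall>w. ?T1 w = ?T2 w) \<longleftrightarrow> _")
    if ij: "i \<in> I" "j \<in> I" for i j M c
  proof
    assume L: "\<forall>w. ?T1 w = ?T2 w"
    show "weakly_commute M c i j" unfolding weakly_commute_def mode_def
    proof (intro allI ext)
      fix k l w m n
      have "?T1 w (of_int m - al i) k (of_int n - al j) l = ?T2 w (of_int m - al i) k (of_int n - al j) l"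
        using L by simp
      then show "(shift_diff ^^ M) (\<lambda>m n. phi i (of_int m - al i) k (phi j (of_int n - al j) l w)) m n =
         (shift_diff ^^ M) (\<lambda>m n. sW c (phi j (of_int n - al j) l (phi i (of_int m - al i) k w))) m n"
        unfolding times_x1_minus_x2_shift_diff .
    qed
  next
    assume R: "weakly_commute M c i j"
    show "\<forall>w. ?T1 w = ?T2 w"
    proof (intro allI ext)
      fix w r k s l
      show "?T1 w r k s l = ?T2 w r k s l"
      proof (cases "r + al i \<in> \<int> \<and> s + al j \<in> \<int>")
        case True
        then obtain m n where "r + al i = of_int m" "s + al j = of_int n"
          by (auto elim!: Ints_cases)
        then have rs: "r = of_int m - al i" "s = of_int n - al j" by (simp_all add: algebra_simps)
        show ?thesis unfolding rs times_x1_minus_x2_shift_diff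
          using fun_cong[OF fun_cong[OF R[unfolded weakly_commute_def mode_def, rule_format, of k l w]]] .
      next
        case False
        then have "?T1 w r k s l = 0"
          by (intro times_x1_minus_x2_eq_0[where a = "al i" and b = "al j"])
             (auto simp: phi_powers phi_simps ij)
        moreover have "?T2 w r k s l = 0" using False
          by (intro times_x1_minus_x2_eq_0[where a = "al i" and b = "al j"])
             (auto simp: phi_powers phi_simps ij)
        ultimately show ?thesis by simp
      qed
    qed
  qed
  then show ?thesis unfolding weak_commutativity_def by (simp only: eq cong: ball_cong)
qed

end

subsection \<open>Twisted field maps\<close>

context twisted_graded_space
begin

lemma W_wt_span: "span (\<Union>n. W_wt sW Wgr n) = UNIV"
proof -
  have "v \<in> span (\<Union>n. W_wt sW Wgr n)" for v
  proof -
    obtain c where c: "\<And>j. c j \<in> (case j of (n, s, c) \<Rightarrow> Wgr n s c)" "(\<Sum>j | c j \<noteq> 0. c j) = v"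
      using W_grading unfolding internal_direct_sum_def by metis
    have "c j \<in> span (\<Union>n. W_wt sW Wgr n)" for j
    proof (cases j)
      case (fields n s d)
      then have "c j \<in> Wgr n s d" using c(1)[of j] by simp
      then have "c j \<in> W_wt sW Wgr n" unfolding W_wt_def by (intro span_base) blast
      then show ?thesis by (intro span_base) blast
    qed
    then have "(\<Sum>j | c j \<noteq> 0. c j) \<in> span (\<Union>n. W_wt sW Wgr n)" by (intro span_sum)
    then show ?thesis by (simp add: c(2))
  qed
  then show ?thesis by blast
qed

text \<open>If the component \<open>c j\<close> of \<open>v\<close> is nonzero, a functional that is \<open>1\<close> on \<open>c j\<close> and \<open>0\<close> on the
  span of all other homogeneous subspaces does not vanish on \<open>v\<close>.\<close>

lemma graded_dual_separates:
  assumes "\<And>w'. w' \<in> graded_dual sW (W_wt sW Wgr) \<Longrightarrow> w' v = 0"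
  shows "v = 0"
proof (rule ccontr)
  assume v: "v \<noteq> 0"
  define A where "A = (\<lambda>(n, s, c). Wgr n s c)"
  have sub: "subspace (A j)" for j
    using W_grading unfolding internal_direct_sum_def A_def by blast
  have uniq: "c = d" if "\<And>j. c j \<in> A j" "finite {j. c j \<noteq> 0}" "\<And>j. d j \<in> A j" "finite {j. d j \<noteq> 0}"
    "(\<Sum>j | c j \<noteq> 0. c j) = (\<Sum>j | d j \<noteq> 0. d j)" for c d
    using W_grading that unfolding internal_direct_sum_def A_def by metis
  obtain c where c: "\<And>j. c j \<in> A j" "finite {j. c j \<noteq> 0}" "(\<Sum>j | c j \<noteq> 0. c j) = v"
    using W_grading unfolding internal_direct_sum_def A_def by metis
  have "\<exists>j. c j \<noteq> 0"
  proof (rule ccontr)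
    assume "\<not> (\<exists>j. c j \<noteq> 0)"
    then have "{j. c j \<noteq> 0} = {}" by simp
    then have "(\<Sum>j | c j \<noteq> 0. c j) = 0" by (simp only: sum.empty)
    with c(3) v show False by simp
  qed
  then obtain j where j: "c j \<noteq> 0" by blast
  define U where "U = span (\<Union>l\<in>- {j}. A l)"
  \<comment> \<open>Elements of \<open>U\<close> have a decomposition without component at
    \<open>j\<close>; uniqueness of decompositions will exclude \<open>c j\<close> from
    \<open>U\<close>.\<close>
  have U_sum: "\<exists>d. (\<forall>l. d l \<in> A l) \<and> finite {l. d l \<noteq> 0} \<and> (\<Sum>l | d l \<noteq> 0. d l) = x \<and> d j = 0"
    if "x \<in> U" for x
    using that unfolding U_def
  proof (induction rule: span_induct_alt)
    case base
    show ?case by (intro exI[of _ "\<lambda>_. 0"]) (simp add: subspace_0[OF sub])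
  next
    case (step a x y)
    then obtain l where l: "x \<in> A l" "l \<noteq> j" by blast
    obtain d where d: "\<And>l. d l \<in> A l" "finite {l. d l \<noteq> 0}" "(\<Sum>l | d l \<noteq> 0. d l) = y" "d j = 0"
      using step by blast
    define d' where "d' = d(l := sW a x + d l)"
    have supp: "{i. d' i \<noteq> 0} \<subseteq> insert l {i. d i \<noteq> 0}" by (auto simp: d'_def)
    let ?F = "insert l {i. d i \<noteq> 0}"
    have "(\<Sum>i | d' i \<noteq> 0. d' i) = (\<Sum>i\<in>?F. d' i)"
      using supp d(2) by (intro sum.mono_neutral_left) auto
    also have "\<dots> = (\<Sum>i\<in>?F. (if i = l then sW a x else 0) + d i)"
      by (intro sum.cong) (auto simp: d'_def)
    also have "\<dots> = sW a x + (\<Sum>i\<in>?F. d i)"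
      using d(2) by (simp add: sum.distrib del: sum.insert)
    also have "(\<Sum>i\<in>?F. d i) = y"
      unfolding d(3)[symmetric] using d(2) by (intro sum.mono_neutral_right) auto
    finally have "(\<Sum>i | d' i \<noteq> 0. d' i) = sW a x + y" .
    moreover have "finite {i. d' i \<noteq> 0}" by (rule finite_subset[OF supp]) (use d(2) in simp)
    moreover have "sW a x + d l \<in> A l"
      by (intro subspace_add[OF sub] subspace_scale[OF sub] d(1) l(1))
    then have "d' i \<in> A i" for i using d(1) by (simp add: d'_def)
    moreover have "d' j = 0" using d(4) l(2) by (simp add: d'_def)
    ultimately show ?case by blast
  qed
  have "c j \<notin> U"
  proof
    assume "c j \<in> U"
    then obtain d where d: "\<And>l. d l \<in> A l" "finite {l. d l \<noteq> 0}" "(\<Sum>l | d l \<noteq> 0. d l) = c j" "d j = 0"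
      using U_sum by blast
    define d0 where "d0 l = (if l = j then c j else 0)" for l
    have supp0: "{l. d0 l \<noteq> 0} = {j}" using j by (auto simp: d0_def)
    have "d0 = d"
      by (rule uniq) (use d c(1) in \<open>simp_all add: supp0 subspace_0[OF sub] d0_def\<close>)
    from fun_cong[OF this, of j] have "d j = c j" by (simp add: d0_def)
    with d(4) j show False by simp
  qed
  interpret vp: vector_space_pair sW "(*) :: complex \<Rightarrow> complex \<Rightarrow> complex"
    by unfold_locales (simp_all add: algebra_simps)
  obtain B where B: "independent B" "B \<subseteq> U" "U \<subseteq> span B"
    using basis_exists[of U] by metis
  have "span B \<subseteq> U" unfolding U_def by (rule span_minimal) (use B(2) in \<open>simp_all add: U_def\<close>)
  with B have B: "independent B" "span B = U" by blast+
  \<comment> \<open>A basis of \<open>U\<close> enlarged by \<open>c j\<close> yields the functional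
    by linear extension.\<close>
  have "independent (insert (c j) B)" using B \<open>c j \<notin> U\<close> by (simp add: independent_insertI)
  then obtain f where f: "Vector_Spaces.linear sW (*) f" "\<And>x. x \<in> insert (c j) B \<Longrightarrow> f x = (if x = c j then 1 else 0)"
    using vp.linear_independent_extend[of "insert (c j) B" "\<lambda>x. if x = c j then 1 else 0"] by blast
  interpret f: Vector_Spaces.linear sW "(*)" f by (rule f(1))
  have "c j \<notin> B" using \<open>c j \<notin> U\<close> B span_base by blast
  then have f_B: "f x = 0" if "x \<in> B" for x using f(2)[of x] that by auto
  have f_U: "f x = 0" if "x \<in> U" for x
    using that unfolding B(2)[symmetric] by (induction rule: span_induct_alt) (simp_all add: f.add f.scale f_B)
  have f_A: "f x = 0" if "x \<in> A l" "l \<noteq> j" for x l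
    by (rule f_U) (use that in \<open>auto simp: U_def intro!: span_base\<close>)
  have "f v = (\<Sum>l | c l \<noteq> 0. f (c l))" by (simp add: c(3)[symmetric] f.sum)
  also have "\<dots> = (\<Sum>l\<in>{j}. f (c l))"
    using c(2) j f_A[OF c(1)] by (intro sum.mono_neutral_right) auto
  also have "\<dots> = 1" using f(2)[of "c j"] by simp
  finally have "f v \<noteq> 0" by simp
  moreover have "f \<in> graded_dual sW (W_wt sW Wgr)"
  proof -
    \<comment> \<open>\<open>f\<close> is nonzero in no weight but \<open>fst j\<close>, so it lies
      in the restricted dual.\<close>
    have "f x = 0" if "x \<in> W_wt sW Wgr n" "n \<noteq> fst j" for x n
    proof -
      have base: "f y = 0" if y: "y \<in> (\<Union>t d. Wgr n t d)" for y
      proof -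
        obtain t d where "y \<in> A (n, t, d)" using y by (auto simp: A_def)
        then show ?thesis by (rule f_A) (use \<open>n \<noteq> fst j\<close> in auto)
      qed
      show ?thesis using that(1) unfolding W_wt_def
        by (induction rule: span_induct_alt) (simp_all add: f.add f.scale base del: UN_iff)
    qed
    then have "{n. \<exists>x\<in>W_wt sW Wgr n. f x \<noteq> 0} \<subseteq> {fst j}" by blast
    then show ?thesis using f(1) finite_subset unfolding graded_dual_def by blast
  qed
  ultimately show False using assms by blast
qed

end

section \<open>Weights and powers of logarithms for twisted fields\<close>

context twisted_field_maps
begin

lemma W_wt_subspace: "subspace (W_wt sW Wgr n)"
  unfolding W_wt_def by (rule subspace_span)

text \<open>\<open>L0W\<close> need not be semisimple, and differentiating log x couples consecutive
  powers: by \<open>D_phi\<close>, the shifted \<open>L0W\<close> sends \<open>phi i r k u\<close>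
  to \<open>phi i r k (?D n u)\<close> plus a multiple of \<open>phi i r (k + 1) u\<close>. The
  first term has an argument closer to annihilation, the second is closer to the bound
  \<open>K\<close>, so the induction measure drops in both.\<close>

lemma phi_weight:
  assumes i: "i \<in> I" and bound: "\<And>k r w. k \<ge> K \<Longrightarrow> phi i r k w = 0"
    and w: "w \<in> W_wt sW Wgr n"
  shows "phi i r k w \<in> W_wt sW Wgr (n + r + of_real (wt i))"
proof -
  let ?n' = "n + r + of_real (wt i)"
  let ?D = "\<lambda>c u. L0W u - sW c u"
  have phi_lin: "Vector_Spaces.linear sW sW (phi i r k)" for k by (rule phi_linear[OF i])
  have D_phi: "?D ?n' (phi i r k u) = phi i r k (?D n u) + sW (of_nat (k + 1)) (phi i r (k + 1) u)" for k u
  proof -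
    interpret l: Vector_Spaces.linear sW sW "phi i r k" by (rule phi_lin)
    have "L0W (phi i r k u) = phi i r k (L0W u) + (sW r (phi i r k u) + sW (of_nat (k + 1)) (phi i r (k + 1) u))
        + sW (of_real (wt i)) (phi i r k u)"
      using L0_property[OF i, of r k u] by (simp add: times_x_def series_deriv_def algebra_simps)
    then show ?thesis by (simp add: l.diff l.scale scale_left_distrib algebra_simps)
  qed
  have gen: "u \<in> W_wt sW Wgr m \<longleftrightarrow> (\<exists>a. (?D m ^^ a) u = 0)" for u m
    by (simp add: W_wt_eigen gen_eigenspace_def)
  have lower: "u \<in> W_wt sW Wgr m" if Du: "?D m u \<in> W_wt sW Wgr m" for u m
  proof -
    obtain a where "(?D m ^^ a) (?D m u) = 0" using Du unfolding gen by blast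
    then have "(?D m ^^ Suc a) u = 0" by (simp only: funpow_Suc_right o_apply)
    then show ?thesis unfolding gen by blast
  qed
  have zero: "0 \<in> W_wt sW Wgr ?n'" by (rule subspace_0[OF W_wt_subspace])
  have "phi i r k u \<in> W_wt sW Wgr ?n'" if "(?D n ^^ a) u = 0" for a k u
    using that
  proof (induction "a + (K - k)" arbitrary: a k u rule: less_induct)
    case less
    interpret l: Vector_Spaces.linear sW sW "phi i r k" by (rule phi_lin)
    consider "k \<ge> K" | "a = 0" | a' where "k < K" "a = Suc a'" by (cases a) force+
    then show ?case
    proof cases
      case 1
      then show ?thesis using bound zero by simp
    next
      case 2
      then show ?thesis using less.prems zero by (simp add: l.zero)
    next
      case (3 a')
      have "(?D n ^^ a') (?D n u) = 0" using less.prems unfolding 3(2) funpow_Suc_right o_apply .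
      then have "phi i r k (?D n u) \<in> W_wt sW Wgr ?n'" using 3 by (intro less.hyps) auto
      moreover have "phi i r (k + 1) u \<in> W_wt sW Wgr ?n'"
        by (rule less.hyps[OF _ less.prems]) (use 3 in auto)
      ultimately have "?D ?n' (phi i r k u) \<in> W_wt sW Wgr ?n'"
        unfolding D_phi by (intro subspace_add subspace_scale W_wt_subspace)
      then show ?thesis by (rule lower)
    qed
  qed
  then show ?thesis using w unfolding gen by blast
qed

text \<open>Coefficient form of the derivative of \<open>x^(-N_g) phi_0(x) x^(N_g)\<close> by log x.
  In each summand the factor k + 1 is split as (k + 1 - m) + m; the first part gives
  \<open>phi\<close> after \<open>NgW\<close>, the second minus \<open>NgW\<close> after
  \<open>phi\<close>.\<close>

lemma phi_Suc_log:
  assumes i: "i \<in> I"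
  shows "sW (of_nat (Suc k)) (phi i r (Suc k) w) = phi i r k (NgW w) - NgW (phi i r k w)"
proof -
  have NgW_lin: "Vector_Spaces.linear sW sW NgW"
    using LgW_parts by (simp add: semisimple_nilpotent_parts_def)
  interpret N: Vector_Spaces.linear sW sW NgW by (rule NgW_lin)
  define T where "T m = (NgW ^^ m) (phi i r 0 ((NgW ^^ (Suc k - m)) w))" for m
  define c where "c m = ((-1) ^ m / (fact m * fact (k - m)) :: complex)" for m
  define d where "d m = ((-1) ^ m / (fact m * fact (Suc k - m)) :: complex)" for m
  have 1: "phi i r k (NgW w) = (\<Sum>m\<le>k. sW (c m) (T m))"
  proof -
    have "(NgW ^^ (k - m)) (NgW w) = (NgW ^^ (Suc k - m)) w" if "m \<le> k" for m
      using that by (simp add: Suc_diff_le funpow_swap1)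
    then show ?thesis unfolding log_structure[OF i, of r k "NgW w"]
      by (intro sum.cong) (simp_all add: T_def c_def)
  qed
  have 2: "NgW (phi i r k w) = (\<Sum>m\<le>k. sW (c m) (T (Suc m)))"
    unfolding log_structure[OF i, of r k w] by (simp add: N.sum N.scale T_def c_def)
  have 3: "phi i r (Suc k) w = (\<Sum>m\<le>Suc k. sW (d m) (T m))"
    unfolding log_structure[OF i, of r "Suc k" w] T_def d_def ..
  have cd: "of_nat (Suc k - m) * d m = c m" "of_nat (Suc m) * d (Suc m) = - c m" if "m \<le> k" for m
  proof -
    have "fact (Suc k - m) = (of_nat (Suc k - m) * fact (k - m) :: complex)"
      using that by (simp add: Suc_diff_le)
    moreover have "(of_nat (Suc k - m) :: complex) \<noteq> 0"
      unfolding of_nat_eq_0_iff using that by simp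
    ultimately show "of_nat (Suc k - m) * d m = c m"
      by (simp add: c_def d_def del: of_nat_diff)
    have "(of_nat (Suc m) :: complex) \<noteq> 0" by (simp del: of_nat_Suc)
    then show "of_nat (Suc m) * d (Suc m) = - c m" by (simp add: c_def d_def del: of_nat_Suc)
  qed
  have "sW (of_nat (Suc k)) (phi i r (Suc k) w) =
      (\<Sum>m\<le>Suc k. sW (of_nat (Suc k - m) * d m) (T m) + sW (of_nat m * d m) (T m))"
    unfolding 3 scale_sum_right
  proof (intro sum.cong refl)
    fix m assume "m \<in> {..Suc k}"
    then have "of_nat (Suc k) = (of_nat (Suc k - m) + of_nat m :: complex)"
      by (simp only: of_nat_add[symmetric]) simp
    then show "sW (of_nat (Suc k)) (sW (d m) (T m)) =
        sW (of_nat (Suc k - m) * d m) (T m) + sW (of_nat m * d m) (T m)"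
      by (simp only: scale_scale scale_left_distrib distrib_right)
  qed
  also have "\<dots> = (\<Sum>m\<le>Suc k. sW (of_nat (Suc k - m) * d m) (T m)) + (\<Sum>m\<le>Suc k. sW (of_nat m * d m) (T m))"
    by (rule sum.distrib)
  also have "(\<Sum>m\<le>Suc k. sW (of_nat (Suc k - m) * d m) (T m)) = (\<Sum>m\<le>k. sW (c m) (T m))"
    using cd(1) by (simp add: atMost_Suc[of k, THEN arg_cong])
  also have "(\<Sum>m\<le>Suc k. sW (of_nat m * d m) (T m)) = (\<Sum>m\<le>k. sW (- c m) (T (Suc m)))"
    unfolding sum.atMost_Suc_shift using cd(2) by simp
  also have "\<dots> = - (\<Sum>m\<le>k. sW (c m) (T (Suc m)))" by (simp add: sum_negf)
  finally show ?thesis unfolding 1 2 by simp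
qed

text \<open>By \<open>phi_Suc_log\<close> and \<open>Ng_property\<close>, the coefficient of the
  (k+1)-st power of log x for \<open>i\<close> is a multiple of that of the k-th power for
  \<open>Ng i\<close>, or 0. Each power thus costs one application of \<open>NgV\<close> to the
  generator, and \<open>NgV\<close> is locally nilpotent.\<close>

lemma phi_log_bound:
  assumes V: "generated_vertex_superalgebra sV Vgr Y vac L0V Lm1V g LgV SgV NgV I a wt par al Ng"
    and i: "i \<in> I"
  shows "\<exists>K. \<forall>k\<ge>K. \<forall>r w. phi i r k w = 0"
proof -
  interpret V: generated_vertex_superalgebra sV Vgr Y vac L0V Lm1V g LgV SgV NgV I a wt par al Ng
    by (rule V)
  have bound: "phi i r k w = 0" if "i \<in> I" "(NgV ^^ K) (a i) = 0" "k \<ge> K" for i r k w K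
    using that
  proof (induction K arbitrary: i k r w)
    case 0
    \<comment> \<open>Vacuous, since generators are nonzero.\<close>
    then show ?case using V.generator_eigen by auto
  next
    case (Suc K)
    then obtain k' where k: "k = Suc k'" "k' \<ge> K" by (cases k) auto
    have "phi i r k' (NgW w) - NgW (phi i r k' w) = 0"
    proof (cases "Ng i")
      case None
      then show ?thesis using Ng_property[OF Suc.prems(1), of r k' w] by simp
    next
      case (Some j)
      with V.Ng_Some[OF Suc.prems(1)] have j: "j \<in> I" "NgV (a i) = a j" by blast+
      have "(NgV ^^ K) (a j) = 0" using Suc.prems(2) by (simp add: funpow_swap1 j)
      then have "phi j r k' w = 0" by (rule Suc.IH[OF j(1) _ k(2)])
      then show ?thesis using Ng_property[OF Suc.prems(1), of r k' w] Some by simp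
    qed
    then have "sW (of_nat (Suc k')) (phi i r (Suc k') w) = 0"
      by (simp only: phi_Suc_log[OF Suc.prems(1)])
    then show ?case by (simp add: k del: of_nat_Suc)
  qed
  obtain K where "(NgV ^^ K) (a i) = 0"
    using V.LgV_parts unfolding semisimple_nilpotent_parts_def locally_nilpotent_def by blast
  with bound[OF i] show ?thesis by blast
qed

lemma graded_modes:
  assumes "\<And>i. i \<in> I \<Longrightarrow> \<exists>K. \<forall>k\<ge>K. \<forall>r w. phi i r k w = 0"
  shows "graded_modes sW (W_wt sW Wgr) I al (\<lambda>i. of_real (wt i)) phi"
proof (intro graded_modes.intro graded_modes_axioms.intro)
  show "phi i r k w \<in> W_wt sW Wgr (n + r + of_real (wt i))" if "i \<in> I" "w \<in> W_wt sW Wgr n" for i w n r k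
    using assms[OF that(1)] phi_weight[OF that(1) _ that(2)] by blast
qed (fact vector_space_axioms phi_linear phi_powers phi_truncation assms W_wt_span
    graded_dual_separates)+

end

theorem theorem3p1:
  fixes sV :: "complex \<Rightarrow> 'v::ab_group_add \<Rightarrow> 'v"
    and Vgr :: "real \<Rightarrow> bit \<Rightarrow> 'v set"
    and Y :: "'v \<Rightarrow> int \<Rightarrow> 'v \<Rightarrow> 'v"
    and vac :: 'v
    and L0V Lm1V g LgV SgV NgV :: "'v \<Rightarrow> 'v"
    and I :: "'i set"
    and a :: "'i \<Rightarrow> 'v"
    and wt :: "'i \<Rightarrow> real"
    and par :: "'i \<Rightarrow> bit"
    and al :: "'i \<Rightarrow> complex"
    and Ng :: "'i \<Rightarrow> 'i option"
    and sW :: "complex \<Rightarrow> 'w::ab_group_add \<Rightarrow> 'w"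
    and Wgr :: "complex \<Rightarrow> bit \<Rightarrow> complex \<Rightarrow> 'w set"
    and L0W L0S L0N Lm1W gW LgW SgW NgW :: "'w \<Rightarrow> 'w"
    and phi :: "'i \<Rightarrow> complex \<Rightarrow> nat \<Rightarrow> 'w \<Rightarrow> 'w"
  assumes V: "generated_vertex_superalgebra sV Vgr Y vac L0V Lm1V g LgV SgV NgV I a wt par al Ng"
    and W: "twisted_field_maps sW Wgr L0W L0S L0N Lm1W gW LgW SgW NgW I wt par al Ng phi"
  shows "weak_commutativity sW I par phi \<longleftrightarrow>
         product_rationality sW Wgr I al phi \<and> commutativity sW Wgr I par al phi"
proof -
  interpret graded_modes sW "W_wt sW Wgr" I al "\<lambda>i. of_real (wt i)" phi
    by (rule twisted_field_maps.graded_modes[OF W twisted_field_maps.phi_log_bound[OF W V]])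
  show ?thesis
  proof
    assume "weak_commutativity sW I par phi"
    then have "\<forall>i\<in>I. \<forall>j\<in>I. \<exists>M. weakly_commute M (koszul (par i) (par j)) i j"
      unfolding weak_commutativity_iff by blast
    then obtain M where M: "\<And>i j. i \<in> I \<Longrightarrow> j \<in> I \<Longrightarrow> weakly_commute (M i j) (koszul (par i) (par j)) i j"
      by metis
    have "product_rationality sW Wgr I al phi"
      unfolding product_rationality_def
      using weakly_commute_rationality[of M] M by blast
    moreover have "commutativity sW Wgr I par al phi"
      unfolding commutativity_def
      using weakly_commute_commutativity M by blast
    ultimately show "product_rationality sW Wgr I al phi \<and> commutativity sW Wgr I par al phi" ..
  next
    assume R: "product_rationality sW Wgr I al phi \<and> commutativity sW Wgr I par al phi"
    then obtain A B where AB: "\<And>w' w is. w' \<in> graded_dual sW (W_wt sW Wgr) \<Longrightarrow> set is \<subseteq> I \<Longrightarrow>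
        \<exists>N f. correlation_function al phi w' is w N f \<and>
          (\<forall>ks\<in>log_exponents (length is) N.
             rational_fun (length is) (\<lambda>j. A (is ! j) w) (\<lambda>l j. B (is ! l) (is ! j)) (f ks))"
      unfolding product_rationality_def by blast
    \<comment> \<open>\<open>B i j\<close> and \<open>B j i\<close> bound the diagonal poles of the
      two orders; their sum serves both, and 1 is added because weak commutativity asks for a
      positive exponent.\<close>
    have pair: "\<exists>N f. correlation_function al phi w' [i, j] w N f \<and>
        (\<forall>ks\<in>log_exponents 2 N. \<exists>a b. rational_fun 2 a b (f ks) \<and> b 0 1 \<le> B i j + B j i + 1)"
      if w': "w' \<in> graded_dual sW (W_wt sW Wgr)" and ij: "i \<in> I" "j \<in> I" for w' w i j
    proof -
      obtain N f where "correlation_function al phi w' [i, j] w N f"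
        and f: "\<And>ks. ks \<in> log_exponents 2 N \<Longrightarrow>
           rational_fun 2 (\<lambda>a. A ([i, j] ! a) w) (\<lambda>l a. B ([i, j] ! l) ([i, j] ! a)) (f ks)"
        using AB[OF w', of "[i, j]" w] ij by (auto simp: numeral_2_eq_2)
      moreover have "\<exists>a b. rational_fun 2 a b (f ks) \<and> b 0 1 \<le> B i j + B j i + 1"
        if "ks \<in> log_exponents 2 N" for ks
        by (intro exI conjI, rule f[OF that]) simp
      ultimately show ?thesis by blast
    qed
    have "weakly_commute (B i j + B j i + 1) (koszul (par i) (par j)) i j" if ij: "i \<in> I" "j \<in> I" for i j
    proof (rule commutativity_weakly_commute[OF ij])
      fix w' w assume w': "w' \<in> graded_dual sW (W_wt sW Wgr)"
      obtain N12 f12 where 12: "correlation_function al phi w' [i, j] w N12 f12"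
        "\<forall>ks\<in>log_exponents 2 N12. \<exists>a b. rational_fun 2 a b (f12 ks) \<and> b 0 1 \<le> B i j + B j i + 1"
        using pair[OF w' ij] by blast
      obtain N21 f21 where 21: "correlation_function al phi w' [j, i] w N21 f21"
        "\<forall>ks\<in>log_exponents 2 N21. \<exists>a b. rational_fun 2 a b (f21 ks) \<and> b 0 1 \<le> B i j + B j i + 1"
        using pair[OF w' ij(2,1)] by (simp only: add.commute[of "B j i"]) blast
      have "F_branch al [i, j] N12 f12 0 [z1, z2] =
          koszul (par i) (par j) * F_branch al [j, i] N21 f21 0 [z2, z1]"
        if "z1 \<noteq> 0" "z2 \<noteq> 0" "z1 \<noteq> z2" for z1 z2
        using R w' ij 12(1) 21(1) that unfolding commutativity_def by blast
      with 12 21 show "\<exists>N12 f12 N21 f21.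
        correlation_function al phi w' [i, j] w N12 f12 \<and> correlation_function al phi w' [j, i] w N21 f21 \<and>
        (\<forall>ks\<in>log_exponents 2 N12. \<exists>a b. rational_fun 2 a b (f12 ks) \<and> b 0 1 \<le> B i j + B j i + 1) \<and>
        (\<forall>ks\<in>log_exponents 2 N21. \<exists>a b. rational_fun 2 a b (f21 ks) \<and> b 0 1 \<le> B i j + B j i + 1) \<and>
        (\<forall>z1 z2. z1 \<noteq> 0 \<and> z2 \<noteq> 0 \<and> z1 \<noteq> z2 \<longrightarrow>
           F_branch al [i, j] N12 f12 0 [z1, z2] =
           koszul (par i) (par j) * F_branch al [j, i] N21 f21 0 [z2, z1])"
        by blast
    qed
    then show "weak_commutativity sW I par phi"
      unfolding weak_commutativity_iff by (meson add_gr_0 zero_less_one)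
  qed
qed

end
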